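(* Let $\mathcal G$ be a Hilbert space, $Q\in\mathcal N_0(\mathcal G)$ and $\omega\in\mathbb R$, and let $\Sigma$ be the $\mathcal B(\mathcal G)$-valued positive measure in the integral representation of $Q$. Then $$Q(\omega)=Q_{\mathrm{op}}(\omega)\dotplus\big(\{0\}\times\mathrm{ran}\,\Sigma(\{\omega\})^{\frac12}\big),$$ where $$Q_{\mathrm{op}}(\omega)=\Big\{\big(f_0;\lim_{\lambda\hat\to\omega}Q(\lambda)f_0\big) : f_0\in\mathcal G,\ \int_{\mathbb R}\frac{\mathrm d(\Sigma(t)f_0,f_0)}{(t-\omega)^2}<\infty\Big\}$$ (the nontangential limit existing for every such $f_0$).
   Context: Herglotz-Nevanlinna functions: a $\mathcal B(\mathcal G)$-valued function $Q$, meromorphic on $\mathbb C\setminus\mathbb R$ with $Q(\lambda)^*=Q(\overline\lambda)$, belongs to $\mathcal N_0(\mathcal G)$ if the kernel $K_Q(\lambda,\mu)=\frac{Q(\lambda)-Q(\mu)^*}{\lambda-\overline\mu}$ is nonnegative, i.e. all matrices $\big((K_Q(\lambda_i,\lambda_j)\xi_i,\xi_j)\big)_{i,j=1}^m$ with $\lambda_i\in\mathbb C^+$, $\xi_i\in\mathcal G$ have no negative eigenvalues. Such $Q$ has an integral representation $Q(\lambda)=C+D\lambda+\int_{\mathbb R}\big(\frac1{t-\lambda}-\frac t{1+t^2}\big)\,\mathrm d\Sigma(t)$, $\lambda\in\mathbb C\setminus\mathbb R$, with $C,D\in\mathcal B(\mathcal G)$, $D\ge0$, and $\Sigma$ a $\mathcal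 B(\mathcal G)$-valued positive measure. $\mathfrak h(Q)$ consists of the points of $\mathbb C\setminus\mathbb R$ where $Q$ is holomorphic and the real points to a neighbourhood of which $Q$ continues holomorphically. Linear relations are linear subspaces of $\mathcal G\times\mathcal G$ with elements $(x;y)$; $\dotplus$ denotes the direct sum of subspaces. Minimal realisation: $(\mathcal H,A,\gamma)$ with $\mathcal H$ a Hilbert space (or, in general, Pontryagin space), $A$ a self-adjoint linear relation in $\mathcal H$, $\gamma:\mathcal G\to\mathcal H$ bounded linear, such that for some $\lambda_0\in\mathfrak h(Q)\cap\rho(A)\cap\mathbb C^+$ it holds $Q(\lambda)=Q(\lambda_0)^*+(\lambda-\overline{\lambda_0})\gamma^*(I+(\lambda-\lambda_0)(A-\lambda)^{-1})\gamma$ for $\lambda\in\mathfrak h(Q)\cap\rho(A)$ and $\mathcal H=\overline{\mathrm{span}}\{(I+(\lambda-\lambda_0)(A-\lambda)^{-1})\gamma x:\lambda\in\rho(A),x\in\mathcal G\}$. Generalised value: $Q(\omega)$ is the linear relation $Q(\omega)=Q(\lambda_0)^*+(\omega-\overline{\lambda_0})\gamma^*(I+(\omega-\lambda_0)(A-\omega)^{-1})\gamma$ in $\mathcal G\times\mathcal G$, where $(A-\omega)^{-1}$ is understood as a relation; it does not depend on the chosen minimal realisation. $\lambda\hat\to\omega$ denotes nontangential convergence: $\lambda\to\omega$ within $W_{\omega,\theta}=\{\omega+re^{i\phi}:r>0,|\phi-\frac\pi2|\le\frac\pi2-\theta\}$ for every $\theta\in(0,\frac\pi2)$. *)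

theory Defs
  imports "HOL-Analysis.Analysis" "Jordan_Normal_Form.Char_Poly"
begin

no_notation Matrix.scalar_prod (infix "\<bullet>" 70)

section \<open>Complex Hilbert spaces\<close>

class complex_vector = real_vector +
  fixes scaleC :: "complex \<Rightarrow> 'a \<Rightarrow> 'a" (infixr "*\<^sub>C" 75)
  assumes scaleC_add_right: "c *\<^sub>C (x + y) = c *\<^sub>C x + c *\<^sub>C y"
    and scaleC_add_left: "(c + d) *\<^sub>C x = c *\<^sub>C x + d *\<^sub>C x"
    and scaleC_scaleC: "c *\<^sub>C (d *\<^sub>C x) = (c * d) *\<^sub>C x"
    and scaleC_one: "1 *\<^sub>C x = x"
    and scaleR_scaleC: "scaleR r x = complex_of_real r *\<^sub>C x"

global_interpretation complex_vector:
  vector_space "scaleC :: complex \<Rightarrow> 'a \<Rightarrow> 'a::complex_vector"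
  defines csubspace = complex_vector.subspace
    and cspan = complex_vector.span
  by unfold_locales
    (simp_all add: scaleC_add_right scaleC_add_left scaleC_scaleC scaleC_one)

instantiation prod :: (complex_vector, complex_vector) complex_vector
begin

definition "c *\<^sub>C p = (c *\<^sub>C fst p, c *\<^sub>C snd p)"

instance
  by standard
    (simp_all add: scaleC_prod_def prod_eq_iff scaleC_add_right scaleC_add_left
      scaleC_scaleC scaleC_one scaleR_scaleC)

end

text \<open>The inner product is linear in its first argument. Its real part is the
  real inner product of the library, so that norm and topology are inherited from
  \<^class>\<open>real_inner\<close>; positive definiteness is part of that class.\<close>

class complex_inner = complex_vector + real_inner +
  fixes cinner :: "'a \<Rightarrow> 'a \<Rightarrow> complex"
  assumes cinner_commute: "cinner x y = cnj (cinner y x)"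
    and cinner_add_left: "cinner (x + y) z = cinner x z + cinner y z"
    and cinner_scaleC_left: "cinner (c *\<^sub>C x) y = c * cinner x y"
    and inner_eq_Re_cinner: "inner x y = Re (cinner x y)"

class chilbert_space = complex_inner + complete_space

instantiation complex :: chilbert_space
begin

definition "c *\<^sub>C (x :: complex) = c * x"
definition "cinner (x :: complex) y = x * cnj y"

instance
  by standard
    (simp_all add: scaleC_complex_def cinner_complex_def algebra_simps
      scaleR_conv_of_real inner_complex_def)

end


section \<open>Bounded operators\<close>

definition bounded_clinear :: "('a::complex_inner \<Rightarrow> 'b::complex_inner) \<Rightarrow> bool" where
  "bounded_clinear T \<longleftrightarrow> bounded_linear T \<and> (\<forall>c x. T (c *\<^sub>C x) = c *\<^sub>C T x)"

definition cadjoint :: "('a::complex_inner \<Rightarrow> 'b::complex_inner) \<Rightarrow> 'b \<Rightarrow> 'a" where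
  "cadjoint T = (SOME S. \<forall>x y. cinner (T x) y = cinner x (S y))"

definition positive_op :: "('a::complex_inner \<Rightarrow> 'a) \<Rightarrow> bool" where
  "positive_op T \<longleftrightarrow> bounded_clinear T \<and> (\<forall>x. cinner (T x) x \<in> \<real>\<^sub>\<ge>\<^sub>0)"

definition op_sqrt :: "('a::complex_inner \<Rightarrow> 'a) \<Rightarrow> 'a \<Rightarrow> 'a" where
  "op_sqrt T = (THE S. positive_op S \<and> S \<circ> S = T)"


section \<open>Operator-valued holomorphic and meromorphic functions\<close>

text \<open>Holomorphy is understood with respect to the operator norm.\<close>

definition op_differentiable_at ::
    "(complex \<Rightarrow> 'g::complex_inner \<Rightarrow> 'g) \<Rightarrow> complex \<Rightarrow> bool" where
  "op_differentiable_at F z \<longleftrightarrow>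
     (\<exists>F'. bounded_clinear F' \<and>
        ((\<lambda>w. onorm (\<lambda>x. (1 / (w - z)) *\<^sub>C (F w x - F z x) - F' x)) \<longlongrightarrow> 0) (at z))"

definition op_holomorphic_at ::
    "(complex \<Rightarrow> 'g::complex_inner \<Rightarrow> 'g) \<Rightarrow> complex \<Rightarrow> bool" where
  "op_holomorphic_at F z \<longleftrightarrow>
     (\<forall>\<^sub>F w in nhds z. bounded_clinear (F w) \<and> op_differentiable_at F w)"

text \<open>The value of a function at one of its poles is arbitrary. Every point at which the
  function is not holomorphic has to be a genuine pole, so removable singularities
  (with a wrong value) are not allowed.\<close>

definition op_meromorphic_on ::
    "(complex \<Rightarrow> 'g::complex_inner \<Rightarrow> 'g) \<Rightarrow> complex set \<Rightarrow> bool" where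
  "op_meromorphic_on Q S \<longleftrightarrow>
     (\<forall>z\<in>S. op_holomorphic_at Q z \<or>
        (\<exists>F n. n > 0 \<and> op_holomorphic_at F z \<and> (\<exists>x. F z x \<noteq> 0) \<and>
           (\<forall>\<^sub>F w in at z. \<forall>x. F w x = (w - z) ^ n *\<^sub>C Q w x)))"

text \<open>The functions \<open>Q\<close> below live on the nonreal numbers; their values (as total functions)
  on the real line are never used. \<open>continues_at Q z F\<close> says that \<open>F\<close> is a holomorphic
  continuation of \<open>Q\<close> to a neighbourhood of \<open>z\<close>. For nonreal \<open>z\<close> this means that \<open>Q\<close> itself
  is holomorphic at \<open>z\<close> and that \<open>F\<close> coincides with \<open>Q\<close> near \<open>z\<close>.\<close>

definition continues_at ::
    "(complex \<Rightarrow> 'g::complex_inner \<Rightarrow> 'g) \<Rightarrow> complex \<Rightarrow> (complex \<Rightarrow> 'g \<Rightarrow> 'g) \<Rightarrow> bool" where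
  "continues_at Q z F \<longleftrightarrow>
     op_holomorphic_at F z \<and> (\<forall>\<^sub>F w in nhds z. w \<notin> \<real> \<longrightarrow> F w = Q w)"

definition hol_domain :: "(complex \<Rightarrow> 'g::complex_inner \<Rightarrow> 'g) \<Rightarrow> complex set" where
  "hol_domain Q =
     {z. z \<notin> \<real> \<and> op_holomorphic_at Q z} \<union> {z. z \<in> \<real> \<and> (\<exists>F. continues_at Q z F)}"

definition hol_value :: "(complex \<Rightarrow> 'g::complex_inner \<Rightarrow> 'g) \<Rightarrow> complex \<Rightarrow> 'g \<Rightarrow> 'g" where
  "hol_value Q z = (if z \<in> \<real> then (SOME F. continues_at Q z F) z else Q z)"


section \<open>Herglotz-Nevanlinna functions\<close>

definition nevanlinna_kernel ::
    "(complex \<Rightarrow> 'g::complex_inner \<Rightarrow> 'g) \<Rightarrow> complex \<Rightarrow> complex \<Rightarrow> 'g \<Rightarrow> 'g" where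
  "nevanlinna_kernel Q z w = (\<lambda>x. (1 / (z - cnj w)) *\<^sub>C (Q z x - cadjoint (Q w) x))"

definition kernel_nonnegative :: "(complex \<Rightarrow> 'g::complex_inner \<Rightarrow> 'g) \<Rightarrow> bool" where
  "kernel_nonnegative Q \<longleftrightarrow>
     (\<forall>(m::nat) (z :: nat \<Rightarrow> complex) (\<xi> :: nat \<Rightarrow> 'g).
        (\<forall>i<m. z i \<in> hol_domain Q \<and> Im (z i) > 0) \<longrightarrow>
        \<not> (\<exists>r<0. eigenvalue
               (Matrix.mat m m (\<lambda>(i, j). cinner (nevanlinna_kernel Q (z i) (z j) (\<xi> i)) (\<xi> j)))
               (complex_of_real r)))"

definition nevanlinna :: "(complex \<Rightarrow> 'g::complex_inner \<Rightarrow> 'g) set" (\<open>\<N>\<^sub>0\<close>) where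
  "\<N>\<^sub>0 = {Q. op_meromorphic_on Q (- \<real>) \<and>
            (\<forall>z \<in> hol_domain Q - \<real>. cadjoint (Q z) = Q (cnj z)) \<and>
            kernel_nonnegative Q}"


section \<open>Operator measures and the integral representation\<close>

text \<open>In general (for instance for \<open>Q z = \<i>\<close> in the upper half-plane) the measure of
  the whole line is not a bounded operator, so the operators \<open>\<Sigma> B\<close> are only meaningful for
  bounded Borel sets \<open>B\<close>. Countable additivity is in the strong operator topology.\<close>

definition positive_op_measure :: "(real set \<Rightarrow> 'g::complex_inner \<Rightarrow> 'g) \<Rightarrow> bool" where
  "positive_op_measure \<Sigma> \<longleftrightarrow>
     (\<forall>B \<in> sets borel. bounded B \<longrightarrow> positive_op (\<Sigma> B)) \<and>
     (\<forall>B :: nat \<Rightarrow> real set.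
        range B \<subseteq> sets borel \<and> disjoint_family B \<and> bounded (\<Union>n. B n) \<longrightarrow>
        (\<forall>x. (\<lambda>n. \<Sigma> (B n) x) sums \<Sigma> (\<Union>n. B n) x))"

text \<open>The scalar Borel measure \<open>(\<Sigma>(\<cdot>)x, x)\<close>, extended from bounded sets to all Borel sets.\<close>

definition scalar_measure ::
    "(real set \<Rightarrow> 'g::complex_inner \<Rightarrow> 'g) \<Rightarrow> 'g \<Rightarrow> real measure" where
  "scalar_measure \<Sigma> x = measure_of UNIV (sets borel)
     (\<lambda>B. SUP n::nat. ennreal (Re (cinner (\<Sigma> (B \<inter> {- real n..real n}) x) x)))"

text \<open>\<open>J\<close> is the weak integral of \<open>h\<close> with respect to \<open>\<Sigma>\<close>. By polarisation, the
  quadratic form determines \<open>J\<close>.\<close>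

definition has_op_integral ::
    "(real set \<Rightarrow> 'g::complex_inner \<Rightarrow> 'g) \<Rightarrow> (real \<Rightarrow> complex) \<Rightarrow> ('g \<Rightarrow> 'g) \<Rightarrow> bool" where
  "has_op_integral \<Sigma> h J \<longleftrightarrow> bounded_clinear J \<and>
     (\<forall>x. integrable (scalar_measure \<Sigma> x) h \<and>
          cinner (J x) x = (\<integral>t. h t \<partial>scalar_measure \<Sigma> x))"

definition integral_representation ::
    "(complex \<Rightarrow> 'g::complex_inner \<Rightarrow> 'g) \<Rightarrow> ('g \<Rightarrow> 'g) \<Rightarrow> ('g \<Rightarrow> 'g) \<Rightarrow>
      (real set \<Rightarrow> 'g \<Rightarrow> 'g) \<Rightarrow> bool" where
  "integral_representation Q C D \<Sigma> \<longleftrightarrow>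
     bounded_clinear C \<and> positive_op D \<and> positive_op_measure \<Sigma> \<and>
     (\<forall>z. z \<notin> \<real> \<longrightarrow>
        (\<exists>J. has_op_integral \<Sigma>
               (\<lambda>t. 1 / (of_real t - z) - of_real t / (1 + (of_real t)\<^sup>2)) J \<and>
             (\<forall>x. Q z x = C x + z *\<^sub>C D x + J x)))"


section \<open>Linear relations\<close>

definition op_graph :: "('a \<Rightarrow> 'b) \<Rightarrow> ('a \<times> 'b) set" where
  "op_graph T = {(x, T x) | x. True}"

definition rel_add :: "('a \<times> 'b::plus) set \<Rightarrow> ('a \<times> 'b) set \<Rightarrow> ('a \<times> 'b) set" where
  "rel_add R S = {(x, y + y') | x y y'. (x, y) \<in> R \<and> (x, y') \<in> S}"

definition rel_scale :: "complex \<Rightarrow> ('a \<times> 'b::complex_vector) set \<Rightarrow> ('a \<times> 'b) set" where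
  "rel_scale c R = {(x, c *\<^sub>C y) | x y. (x, y) \<in> R}"

definition rel_adjoint ::
    "('a::complex_inner \<times> 'b::complex_inner) set \<Rightarrow> ('b \<times> 'a) set" where
  "rel_adjoint R = {(y, x). \<forall>(u, v) \<in> R. cinner x u = cinner y v}"

definition self_adjoint_rel :: "('h::complex_inner \<times> 'h) set \<Rightarrow> bool" where
  "self_adjoint_rel A \<longleftrightarrow> csubspace A \<and> rel_adjoint A = A"

definition rel_resolvent :: "('h::complex_vector \<times> 'h) set \<Rightarrow> complex \<Rightarrow> ('h \<times> 'h) set" where
  "rel_resolvent A z = (rel_add A (rel_scale (- z) Id))\<inverse>"

definition resolvent_set :: "('h::complex_inner \<times> 'h) set \<Rightarrow> complex set" where
  "resolvent_set A = {z. \<exists>T. bounded_clinear T \<and> rel_resolvent A z = op_graph T}"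

definition is_direct_sum ::
    "'a::complex_vector set \<Rightarrow> 'a set \<Rightarrow> 'a set \<Rightarrow> bool" where
  "is_direct_sum V S T \<longleftrightarrow>
     csubspace S \<and> csubspace T \<and> S \<inter> T = {0} \<and> V = {s + t | s t. s \<in> S \<and> t \<in> T}"


section \<open>Minimal realisations and generalised values\<close>

text \<open>The relation \<open>(I + (z - z0)(A - z)\<inverse>)\<gamma>\<close>. Note that \<open>R O S\<close> applies
  \<open>R\<close> first.\<close>

definition gamma_rel ::
    "('h::complex_inner \<times> 'h) set \<Rightarrow> ('g::complex_inner \<Rightarrow> 'h) \<Rightarrow> complex \<Rightarrow> complex \<Rightarrow>
      ('g \<times> 'h) set" where
  "gamma_rel A \<gamma> z0 z =
     op_graph \<gamma> O rel_add Id (rel_scale (z - z0) (rel_resolvent A z))"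

text \<open>The relation \<open>Q(z0)* + (z - cnj z0) \<gamma>* (I + (z - z0)(A - z)\<inverse>)\<gamma>\<close>.\<close>

definition generalised_value ::
    "(complex \<Rightarrow> 'g::complex_inner \<Rightarrow> 'g) \<Rightarrow> ('h::complex_inner \<times> 'h) set \<Rightarrow> ('g \<Rightarrow> 'h) \<Rightarrow>
      complex \<Rightarrow> complex \<Rightarrow> ('g \<times> 'g) set" where
  "generalised_value Q A \<gamma> z0 z =
     rel_add (op_graph (cadjoint (Q z0)))
       (rel_scale (z - cnj z0) (gamma_rel A \<gamma> z0 z O op_graph (cadjoint \<gamma>)))"

definition minimal_realisation ::
    "(complex \<Rightarrow> 'g::chilbert_space \<Rightarrow> 'g) \<Rightarrow> ('h::chilbert_space \<times> 'h) set \<Rightarrow> ('g \<Rightarrow> 'h) \<Rightarrow>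
      complex \<Rightarrow> bool" where
  "minimal_realisation Q A \<gamma> z0 \<longleftrightarrow>
     self_adjoint_rel A \<and> bounded_clinear \<gamma> \<and>
     z0 \<in> hol_domain Q \<inter> resolvent_set A \<and> Im z0 > 0 \<and>
     (\<forall>z \<in> hol_domain Q \<inter> resolvent_set A.
        op_graph (hol_value Q z) = generalised_value Q A \<gamma> z0 z) \<and>
     closure (cspan {y. \<exists>z \<in> resolvent_set A. \<exists>x. (x, y) \<in> gamma_rel A \<gamma> z0 z}) = UNIV"


section \<open>Nontangential limits and the operator part\<close>

definition stolz_sector :: "real \<Rightarrow> real \<Rightarrow> complex set" where
  "stolz_sector \<omega> \<theta> =
     {of_real \<omega> + of_real r * cis \<phi> | r \<phi>. r > 0 \<and> \<bar>\<phi> - pi / 2\<bar> \<le> pi / 2 - \<theta>}"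

definition has_nontangential_limit ::
    "(complex \<Rightarrow> 'a::topological_space) \<Rightarrow> real \<Rightarrow> 'a \<Rightarrow> bool" where
  "has_nontangential_limit f \<omega> l \<longleftrightarrow>
     (\<forall>\<theta> \<in> {0<..<pi / 2}. (f \<longlongrightarrow> l) (at (of_real \<omega>) within stolz_sector \<omega> \<theta>))"

text \<open>The integrand is \<open>ennreal\<close>-valued, hence \<open>\<infinity>\<close> (and not \<open>0\<close>) at \<open>t = \<omega>\<close>:
  an atom of \<open>(\<Sigma>(\<cdot>)f, f)\<close> at \<open>\<omega>\<close> makes the integral infinite.\<close>

definition value_domain :: "(real set \<Rightarrow> 'g::complex_inner \<Rightarrow> 'g) \<Rightarrow> real \<Rightarrow> 'g set" where
  "value_domain \<Sigma> \<omega> =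
     {f. (\<integral>\<^sup>+ t. 1 / ennreal ((t - \<omega>)\<^sup>2) \<partial>scalar_measure \<Sigma> f) < \<infinity>}"

definition op_part ::
    "(complex \<Rightarrow> 'g::complex_inner \<Rightarrow> 'g) \<Rightarrow> (real set \<Rightarrow> 'g \<Rightarrow> 'g) \<Rightarrow> real \<Rightarrow> ('g \<times> 'g) set" where
  "op_part Q \<Sigma> \<omega> =
     {(f, l) | f l. f \<in> value_domain \<Sigma> \<omega> \<and> has_nontangential_limit (\<lambda>z. Q z f) \<omega> l}"

end

theory Submission
  imports Defs
begin

text \<open>Put \<open>R(z) = (A - z)\<inverse>\<close>, \<open>K = ker (A - \<omega>)\<close>, and let \<open>P\<close> be the orthogonal projection onto \<open>K\<close>.
  Taking imaginary parts in the realisation and in the integral representation at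
  \<open>z = \<omega> + i s\<close> gives
  \<open>\<parallel>\<gamma> f + (z - z0) R(z) \<gamma> f\<parallel>\<^sup>2 = (D f, f) + \<integral> 1 / ((t - \<omega>)\<^sup>2 + s\<^sup>2) d(\<Sigma>(t) f, f)\<close>.
  As \<open>s \<rightarrow> 0\<close>, the right-hand side stays bounded iff \<open>f\<close> lies in the domain of the operator part,
  and the left-hand side stays bounded iff \<open>\<gamma> f\<close> is in the range of \<open>A - \<omega>\<close>; no spectral theorem
  is needed, because bounded resolvents along the vertical line form a Cauchy family. For such
  \<open>f = f0\<close> with \<open>\<gamma> f0 = (A - \<omega>) k\<close> one has \<open>R(\<lambda>) \<gamma> f0 \<rightarrow> k - P k\<close> nontangentially, which yields the
  limit of \<open>Q(\<lambda>) f0\<close>. Multiplying the identity by \<open>s\<^sup>2\<close> instead gives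
  \<open>(\<Sigma>({\<omega>}) f, f) = |\<omega> - z0|\<^sup>2 \<parallel>P \<gamma> f\<parallel>\<^sup>2\<close>, so the multivalued part \<open>\<gamma>\<^sup>* K\<close> and
  \<open>ran \<Sigma>({\<omega>})\<^sup>1\<^sup>/\<^sup>2\<close> coincide by Douglas' range argument.\<close>

section \<open>Complex Hilbert spaces\<close>

text \<open>The bridge between \<open>A\<close> and \<open>\<Sigma>\<close> is a scalar identity,
  and two gaps have to be closed before it holds. The realisation formula is assumed only where
  \<open>Q\<close> is holomorphic, while meromorphy a priori allows nonreal poles, so these are
  excluded first. And \<open>C\<close> is merely bounded, so the symmetry of \<open>Q\<close> must
  show that its quadratic form is real. The term with \<open>D\<close> is harmless: it is constant
  in the first limit and killed by \<open>s^2\<close> in the second.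

  At the real point the preimage \<open>k\<close> of \<open>\<gamma> f\<close> is determined only up
  to \<open>K\<close>. The preimage orthogonal to \<open>K\<close> is the one that the resolvents
  select in the limit; it makes the value single-valued. The remaining freedom in \<open>K\<close>
  enters the value with the factor \<open>|\<omega> - z0|^2\<close>, nonzero because
  \<open>z0\<close> is not real.

  Since \<open>op_sqrt\<close> is a definite description, existence and uniqueness of the positive
  root must both be shown. The binomial series serves both ends: it produces a root, and whatever
  commutes with the operator commutes with this root.\<close>

lemma cinner_add_right: "cinner x (y + z) = cinner x y + cinner x (z::'a::complex_inner)"
  by (metis cinner_add_left cinner_commute complex_cnj_add)

lemma cinner_scaleC_right: "cinner x (c *\<^sub>C y) = cnj c * cinner x (y::'a::complex_inner)"
  by (metis cinner_commute cinner_scaleC_left complex_cnj_mult)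

lemma scaleC_minus_one: "(- 1) *\<^sub>C x = - (x::'a::complex_vector)"
  using complex_vector.scale_minus_left[of 1 x] by (simp add: scaleC_one)

lemma cinner_minus_left [simp]: "cinner (- x) y = - cinner x (y::'a::complex_inner)"
  using cinner_scaleC_left[of "-1" x y] by (simp add: scaleC_minus_one)

lemma cinner_minus_right [simp]: "cinner x (- y) = - cinner x (y::'a::complex_inner)"
  using cinner_scaleC_right[of x "-1" y] by (simp add: scaleC_minus_one)

lemma cinner_diff_left: "cinner (x - z) y = cinner x y - cinner z (y::'a::complex_inner)"
  using cinner_add_left[of x "- z" y] by simp

lemma cinner_diff_right: "cinner x (y - z) = cinner x y - cinner x (z::'a::complex_inner)"
  using cinner_add_right[of x y "- z"] by simp

lemma cinner_zero_left [simp]: "cinner 0 (y::'a::complex_inner) = 0"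
  using cinner_diff_left[of y y y] by simp

lemma cinner_zero_right [simp]: "cinner (y::'a::complex_inner) 0 = 0"
  using cinner_diff_right[of y y y] by simp

lemmas cinner_simps = cinner_add_left cinner_add_right cinner_diff_left cinner_diff_right
  cinner_scaleC_left cinner_scaleC_right

lemma cinner_self: "cinner x x = of_real ((norm (x::'a::complex_inner))\<^sup>2)"
proof -
  have "Im (cinner x x) = 0"
    using arg_cong[OF cinner_commute[of x x], of Im] by simp
  then show ?thesis
    by (simp add: complex_eq_iff inner_eq_Re_cinner[symmetric] power2_norm_eq_inner)
qed

lemma norm_scaleC [simp]: "norm (c *\<^sub>C x) = cmod c * norm (x::'a::complex_inner)"
proof -
  have "complex_of_real ((norm (c *\<^sub>C x))\<^sup>2) = (c * cnj c) * cinner x x"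
    unfolding cinner_self[symmetric] by (simp add: cinner_simps)
  also have "\<dots> = of_real ((cmod c * norm x)\<^sup>2)"
    unfolding complex_norm_square[symmetric] cinner_self by (simp add: power_mult_distrib)
  finally show ?thesis by (simp only: of_real_eq_iff power2_eq_iff_nonneg norm_ge_zero mult_nonneg_nonneg)
qed

lemma norm_cinner_le: "cmod (cinner x y) \<le> norm x * norm (y::'a::complex_inner)"
proof (cases "cinner x y = 0")
  case False
  \<comment> \<open>The phase that rotates \<open>cinner x y\<close> onto its modulus, so that the
    real Cauchy-Schwarz inequality applies.\<close>
  define c where "c = cnj (cinner x y) / cmod (cinner x y)"
  have c1: "cmod c = 1" using False by (simp add: c_def norm_divide)
  have "cinner (c *\<^sub>C x) y = of_real (cmod (cinner x y))"
    using False by (simp add: c_def cinner_scaleC_left complex_norm_square[symmetric] power2_eq_square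
        mult.commute divide_simps)
  then have "cmod (cinner x y) = inner (c *\<^sub>C x) y" by (simp add: inner_eq_Re_cinner)
  also have "\<dots> \<le> norm (c *\<^sub>C x) * norm y" by (rule norm_cauchy_schwarz)
  finally show ?thesis by (simp add: c1)
qed simp

lemma bounded_bilinear_cinner: "bounded_bilinear (cinner :: 'a::complex_inner \<Rightarrow> 'a \<Rightarrow> complex)"
  by (standard; (rule exI[of _ 1])?)
    (auto simp: cinner_simps scaleR_scaleC norm_cinner_le scaleC_complex_def)

lemma bounded_bilinear_scaleC: "bounded_bilinear (scaleC :: complex \<Rightarrow> 'a::complex_inner \<Rightarrow> 'a)"
  by (standard; (rule exI[of _ 1])?)
    (auto simp: scaleC_add_left scaleC_add_right scaleR_scaleC scaleC_scaleC scaleC_complex_def mult.commute)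

lemmas tendsto_cinner [tendsto_intros] = bounded_bilinear.tendsto[OF bounded_bilinear_cinner]
lemmas tendsto_scaleC [tendsto_intros] = bounded_bilinear.tendsto[OF bounded_bilinear_scaleC]

lemma cinner_eqI:
  assumes "\<And>z. cinner x z = cinner y (z::'a::complex_inner)"
  shows "x = y"
proof -
  have "cinner (x - y) (x - y) = 0" using assms by (simp add: cinner_diff_left)
  then show ?thesis by (simp add: cinner_self)
qed

text \<open>Evaluating at \<open>\<i> *\<^sub>C x\<close> turns imaginary parts into real ones. This
  carries representations by the real inner product over to the complex one.\<close>

lemma Re_cinner_eq_imp:
  fixes f g :: "'a::complex_vector \<Rightarrow> complex"
  assumes "\<And>x. x \<in> V \<Longrightarrow> Re (f x) = Re (g x)"
    and "csubspace V"
    and "\<And>c x. f (c *\<^sub>C x) = c * f x" "\<And>c x. g (c *\<^sub>C x) = c * g x" and "x \<in> V"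
  shows "f x = g x"
proof -
  have "\<i> *\<^sub>C x \<in> V" using assms(2,5) by (simp add: complex_vector.subspace_scale)
  from assms(1)[OF this] have "Im (f x) = Im (g x)" by (simp add: assms(3,4))
  then show ?thesis using assms(1,5) by (simp add: complex_eq_iff)
qed

lemma csubspace_imp_subspace: "csubspace V \<Longrightarrow> subspace (V :: 'a::complex_vector set)"
  unfolding complex_vector.subspace_def subspace_def by (auto simp: scaleR_scaleC)

text \<open>Minimise \<open>\<parallel>B f\<parallel>\<^sup>2 - 2 \<phi> f\<close>: by the parallelogram law the images of a minimising
  sequence converge. This single statement yields the Riesz representation theorem, orthogonal
  projections and Douglas' range inclusion.\<close>

lemma variational_representation:
  fixes B :: "'a::real_vector \<Rightarrow> 'b::{real_inner,complete_space}" and \<phi> :: "'a \<Rightarrow> real"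
  assumes B: "linear B" and \<phi>: "linear \<phi>" and V: "subspace V"
    and bound: "\<And>f. f \<in> V \<Longrightarrow> \<phi> f \<le> M * norm (B f)"
  obtains k where "k \<in> closure (B ` V)" "\<And>f. f \<in> V \<Longrightarrow> inner (B f) k = \<phi> f"
proof -
  interpret B: linear B by fact
  interpret \<phi>: linear \<phi> by fact
  define J where "J f = (norm (B f))\<^sup>2 - 2 * \<phi> f" for f
  define m where "m = Inf (J ` V)"
  have lower: "- (M\<^sup>2) \<le> J f" if "f \<in> V" for f
  proof -
    have "0 \<le> (norm (B f) - M)\<^sup>2" by simp
    then show ?thesis using bound[OF that] by (simp add: J_def power2_eq_square algebra_simps)
  qed
  then have bdd: "bdd_below (J ` V)" by (intro bdd_belowI[of _ "- (M\<^sup>2)"]) auto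
  have V0: "0 \<in> V" using V by (simp add: subspace_def)
  have mle: "m \<le> J f" if "f \<in> V" for f
    unfolding m_def using bdd that by (intro cInf_lower) auto
  have "\<exists>f\<in>V. J f < m + 1 / real (Suc n)" for n
    using cInf_lessD[of "J ` V" "m + 1 / real (Suc n)"] V0 by (auto simp: m_def)
  then obtain f where fV: "\<And>n. f n \<in> V" and fJ: "\<And>n. J (f n) < m + 1 / real (Suc n)" by metis
  have par: "(norm (B x - B y))\<^sup>2 \<le> 2 * (J x - m) + 2 * (J y - m)" if "x \<in> V" "y \<in> V" for x y
  proof -
    have "(1/2) *\<^sub>R (x + y) \<in> V" using V that by (simp add: subspace_add subspace_scale)
    from mle[OF this] have "4 * m \<le> (norm (B x + B y))\<^sup>2 - 4 * \<phi> (x + y)"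
      by (simp add: J_def B.add B.scale \<phi>.scale power_mult_distrib power_divide)
    moreover have "(norm (B x - B y))\<^sup>2 + (norm (B x + B y))\<^sup>2 = 2 * (norm (B x))\<^sup>2 + 2 * (norm (B y))\<^sup>2"
      by (simp add: power2_norm_eq_inner inner_simps inner_commute)
    ultimately show ?thesis by (simp add: J_def \<phi>.add)
  qed
  have "Cauchy (\<lambda>n. B (f n))"
  proof (rule metric_CauchyI)
    fix e :: real assume e: "e > 0"
    then obtain N where N: "1 / real (Suc N) < e\<^sup>2 / 4"
      using reals_Archimedean[of "e\<^sup>2/4"] by (auto simp: inverse_eq_divide)
    show "\<exists>N. \<forall>m\<ge>N. \<forall>n\<ge>N. dist (B (f m)) (B (f n)) < e"
    proof (intro exI[of _ N] allI impI)
      fix p q assume pq: "p \<ge> N" "q \<ge> N"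
      have *: "J (f n) - m < e\<^sup>2 / 4" if "n \<ge> N" for n
      proof -
        have "1 / real (Suc n) \<le> 1 / real (Suc N)" using that by (simp add: field_simps)
        then show ?thesis using fJ[of n] N by linarith
      qed
      have "(norm (B (f p) - B (f q)))\<^sup>2 < e\<^sup>2"
        using par[OF fV fV, of p q] *[OF pq(1)] *[OF pq(2)] by simp
      then show "dist (B (f p)) (B (f q)) < e"
        using e by (simp add: dist_norm power_less_imp_less_base)
    qed
  qed
  then obtain k where k: "(\<lambda>n. B (f n)) \<longlonglongrightarrow> k"
    using Cauchy_convergent convergent_def by blast
  have kcl: "k \<in> closure (B ` V)"
    unfolding closure_sequential using k fV by (intro exI[of _ "\<lambda>n. B (f n)"]) auto
  have "inner (B g) k = \<phi> g" if g: "g \<in> V" for g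
  proof -
    define c where "c = inner (B g) k - \<phi> g"
    \<comment> \<open>First variation: moving the minimising sequence in the direction
      \<open>g\<close> cannot push \<open>J\<close> below \<open>m\<close>. The inequality survives
      the limit although only \<open>B (f n)\<close>, not \<open>f n\<close>, converges.\<close>
    have key: "0 \<le> 2 * t * c + t\<^sup>2 * (norm (B g))\<^sup>2" for t
    proof -
      have l: "(\<lambda>n. 1 / real (Suc n) + (2 * t * (inner (B g) (B (f n)) - \<phi> g) + t\<^sup>2 * (norm (B g))\<^sup>2))
          \<longlonglongrightarrow> 0 + (2 * t * (inner (B g) k - \<phi> g) + t\<^sup>2 * (norm (B g))\<^sup>2)"
        using k by (intro tendsto_intros LIMSEQ_inverse_real_of_nat[unfolded inverse_eq_divide])
      have "0 \<le> 1 / real (Suc n) + (2 * t * (inner (B g) (B (f n)) - \<phi> g) + t\<^sup>2 * (norm (B g))\<^sup>2)" for n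
      proof -
        have "f n + t *\<^sub>R g \<in> V" using V fV g by (simp add: subspace_add subspace_scale)
        from mle[OF this] have "m \<le> J (f n + t *\<^sub>R g)" .
        also have "\<dots> = J (f n) + (2 * t * (inner (B g) (B (f n)) - \<phi> g) + t\<^sup>2 * (norm (B g))\<^sup>2)"
        proof -
          have "(norm (B (f n) + t *\<^sub>R B g))\<^sup>2
              = (norm (B (f n)))\<^sup>2 + 2 * t * inner (B g) (B (f n)) + t\<^sup>2 * (norm (B g))\<^sup>2"
            unfolding power2_norm_eq_inner
            by (simp add: inner_simps inner_commute power2_eq_square algebra_simps)
          then show ?thesis
            by (simp add: J_def B.add B.scale \<phi>.add \<phi>.scale algebra_simps)
        qed
        finally show ?thesis using fJ[of n] by linarith
      qed
      then show ?thesis using LIMSEQ_le_const[OF l] by (auto simp: c_def)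
    qed
    have "c = 0"
    proof (rule ccontr)
      assume "c \<noteq> 0"
      \<comment> \<open>The added 1 keeps \<open>N\<close> positive when \<open>B g = 0\<close>, so
        \<open>t = - c / N\<close> is always a legitimate choice.\<close>
      define N where "N = (norm (B g))\<^sup>2 + 1"
      have N: "N > 0" by (simp add: N_def add_nonneg_pos)
      have "0 \<le> 2 * (- c / N) * c + (- c / N)\<^sup>2 * (norm (B g))\<^sup>2" by (rule key)
      also have "\<dots> \<le> 2 * (- c / N) * c + (- c / N)\<^sup>2 * N"
        by (intro add_left_mono mult_left_mono) (auto simp: N_def)
      also have "\<dots> = - (c\<^sup>2 / N)" using N by (simp add: power2_eq_square field_simps)
      finally show False using \<open>c \<noteq> 0\<close> N by (simp add: field_simps not_le)
    qed
    then show ?thesis by (simp add: c_def)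
  qed
  with kcl that show ?thesis by blast
qed

section \<open>Bounded complex-linear operators, Riesz representation and adjoints\<close>

lemma bounded_clinear_linear: "bounded_clinear T \<Longrightarrow> linear T"
  by (simp add: bounded_clinear_def bounded_linear.linear)

lemma bounded_clinear_scaleC: "bounded_clinear T \<Longrightarrow> T (c *\<^sub>C x) = c *\<^sub>C T x"
  by (simp add: bounded_clinear_def)

lemma bounded_clinear_add: "bounded_clinear T \<Longrightarrow> T (x + y) = T x + T y"
  by (simp add: bounded_clinear_linear linear_add)

lemma bounded_clinear_diff: "bounded_clinear T \<Longrightarrow> T (x - y) = T x - T y"
  by (simp add: bounded_clinear_linear linear_diff)

lemma bounded_clinear_0: "bounded_clinear T \<Longrightarrow> T 0 = 0"
  by (simp add: bounded_clinear_linear linear_0)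

lemma bounded_clinear_tendsto:
  "bounded_clinear T \<Longrightarrow> (f \<longlongrightarrow> l) F \<Longrightarrow> ((\<lambda>x. T (f x)) \<longlongrightarrow> T l) F"
  by (simp add: bounded_clinear_def bounded_linear.tendsto)

lemma bounded_clinear_norm_le: "bounded_clinear T \<Longrightarrow> norm (T x) \<le> onorm T * norm x"
  by (simp add: bounded_clinear_def onorm)

lemma onorm_nonneg: "bounded_clinear T \<Longrightarrow> 0 \<le> onorm T"
  by (simp add: bounded_clinear_def onorm_pos_le)

lemma bounded_clinearI:
  fixes T :: "'a::complex_inner \<Rightarrow> 'b::complex_inner"
  assumes "\<And>x y. T (x + y) = T x + T y" "\<And>c x. T (c *\<^sub>C x) = c *\<^sub>C T x"
    "\<And>x. norm (T x) \<le> norm x * K"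
  shows "bounded_clinear T"
  unfolding bounded_clinear_def using assms
  by (auto intro!: bounded_linear_intro[of T K] simp: scaleR_scaleC)

text \<open>The real statement for \<open>Re (\<phi> f)\<close> suffices because both sides are
  complex-homogeneous. Below, \<open>B\<close> is the identity for adjoints, the map
  \<open>(a, b)\<close> to \<open>b - z a\<close> for orthogonal decompositions, and a square root
  or a projected \<open>\<gamma>\<close> for the comparison of ranges.\<close>

lemma cinner_representation:
  fixes B :: "'a::complex_vector \<Rightarrow> 'b::chilbert_space" and \<phi> :: "'a \<Rightarrow> complex"
  assumes B: "linear B" "\<And>c x. B (c *\<^sub>C x) = c *\<^sub>C B x"
    and \<phi>: "linear \<phi>" "\<And>c x. \<phi> (c *\<^sub>C x) = c * \<phi> x"
    and V: "csubspace V"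
    and bound: "\<And>f. f \<in> V \<Longrightarrow> cmod (\<phi> f) \<le> M * norm (B f)"
  obtains k where "k \<in> closure (B ` V)" "\<And>f. f \<in> V \<Longrightarrow> cinner (B f) k = \<phi> f"
proof -
  have lin: "linear (\<lambda>f. Re (\<phi> f))"
    using \<phi>(1) by (intro linearI) (auto simp: linear_add linear_scale)
  have "Re (\<phi> f) \<le> M * norm (B f)" if "f \<in> V" for f
    using bound[OF that] complex_Re_le_cmod[of "\<phi> f"] by linarith
  then obtain k where k: "k \<in> closure (B ` V)" "\<And>f. f \<in> V \<Longrightarrow> inner (B f) k = Re (\<phi> f)"
    using variational_representation[OF B(1) lin csubspace_imp_subspace[OF V]] by metis
  show thesis
  proof (rule that[OF k(1)])
    fix f assume "f \<in> V"
    then show "cinner (B f) k = \<phi> f"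
      by (intro Re_cinner_eq_imp[of V "\<lambda>f. cinner (B f) k" \<phi> f])
        (auto simp: inner_eq_Re_cinner[symmetric] k(2) V B(2) \<phi>(2) cinner_scaleC_left)
  qed
qed

text \<open>\<open>cadjoint\<close> is a choice, so a witness has to exist. It comes from the Riesz
  theorem for \<open>f\<close> mapped to \<open>(T f, y)\<close>, which is
  \<open>cinner_representation\<close> with \<open>B = id\<close>.\<close>

lemma cadjoint_works:
  fixes T :: "'a::chilbert_space \<Rightarrow> 'b::complex_inner"
  assumes T: "bounded_clinear T"
  shows "cinner (T x) y = cinner x (cadjoint T y)"
proof -
  have "\<exists>s. \<forall>x. cinner (T x) y = cinner x s" for y
  proof -
    have "cmod (cinner (T f) y) \<le> (onorm T * norm y) * norm f" for f
    proof -
      have "cmod (cinner (T f) y) \<le> norm (T f) * norm y" by (rule norm_cinner_le)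
      also have "\<dots> \<le> (onorm T * norm f) * norm y"
        by (intro mult_right_mono bounded_clinear_norm_le T) auto
      finally show ?thesis by (simp add: mult_ac)
    qed
    moreover have "linear (\<lambda>f. cinner (T f) y)"
      by (intro linearI)
        (auto simp: bounded_clinear_add[OF T] bounded_clinear_scaleC[OF T] cinner_simps
          scaleR_scaleC scaleC_complex_def)
    ultimately obtain k where "\<And>f. f \<in> UNIV \<Longrightarrow> cinner (id f) k = cinner (T f) y"
      by (rule_tac cinner_representation[of id "\<lambda>f. cinner (T f) y" UNIV "onorm T * norm y"])
        (auto simp: linear_id bounded_clinear_scaleC[OF T] cinner_simps)
    then show ?thesis by (metis UNIV_I id_apply)
  qed
  then have "\<exists>S. \<forall>x y. cinner (T x) y = cinner x (S y)" by metis
  then show ?thesis unfolding cadjoint_def by (rule someI2_ex) blast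
qed

lemma cadjoint_bounded_clinear:
  fixes T :: "'a::chilbert_space \<Rightarrow> 'b::complex_inner"
  assumes T: "bounded_clinear T"
  shows "bounded_clinear (cadjoint T)"
proof (rule bounded_clinearI[where K = "onorm T"])
  note w = cadjoint_works[OF T, symmetric]
  have w': "cinner (cadjoint T y) x = cinner y (T x)" for x y
    by (metis cinner_commute w)
  show "cadjoint T (x + y) = cadjoint T x + cadjoint T y" for x y
    by (rule cinner_eqI) (simp add: cinner_simps w')
  show "cadjoint T (c *\<^sub>C x) = c *\<^sub>C cadjoint T x" for c x
    by (rule cinner_eqI) (simp add: cinner_simps w')
  show "norm (cadjoint T x) \<le> norm x * onorm T" for x
  proof (cases "cadjoint T x = 0")
    case False
    have "(norm (cadjoint T x))\<^sup>2 = cmod (cinner (cadjoint T x) (cadjoint T x))"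
      by (simp add: cinner_self norm_power)
    also have "\<dots> \<le> norm x * norm (T (cadjoint T x))" by (simp add: w' norm_cinner_le)
    also have "\<dots> \<le> norm x * (onorm T * norm (cadjoint T x))"
      by (intro mult_left_mono bounded_clinear_norm_le T) auto
    finally show ?thesis using False by (simp add: power2_eq_square)
  qed (simp add: onorm_nonneg T)
qed


section \<open>Resolvents of self-adjoint relations\<close>

lemma sa_csubspace: "self_adjoint_rel A \<Longrightarrow> csubspace A"
  by (simp add: self_adjoint_rel_def)

lemma sa_add: "self_adjoint_rel A \<Longrightarrow> (a, b) \<in> A \<Longrightarrow> (c, d) \<in> A \<Longrightarrow> (a + c, b + d) \<in> A"
  using complex_vector.subspace_add[OF sa_csubspace, of A "(a, b)" "(c, d)"] by simp

lemma sa_diff: "self_adjoint_rel A \<Longrightarrow> (a, b) \<in> A \<Longrightarrow> (c, d) \<in> A \<Longrightarrow> (a - c, b - d) \<in> A"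
  using complex_vector.subspace_diff[OF sa_csubspace, of A "(a, b)" "(c, d)"] by simp

lemma sa_scale: "self_adjoint_rel A \<Longrightarrow> (a, b) \<in> A \<Longrightarrow> (c *\<^sub>C a, c *\<^sub>C b) \<in> A"
  using complex_vector.subspace_scale[OF sa_csubspace, of A "(a, b)" c] by (simp add: scaleC_prod_def)

lemma sa_zero: "self_adjoint_rel A \<Longrightarrow> (0, 0) \<in> A"
  using complex_vector.subspace_0[OF sa_csubspace, of A] by (simp add: zero_prod_def)

lemma sa_symmetric:
  "self_adjoint_rel A \<Longrightarrow> (a, b) \<in> A \<Longrightarrow> (u, v) \<in> A \<Longrightarrow> cinner b u = cinner a v"
proof -
  assume "self_adjoint_rel A" "(a, b) \<in> A" and uv: "(u, v) \<in> A"
  then have "(a, b) \<in> rel_adjoint A" by (simp add: self_adjoint_rel_def)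
  with uv show ?thesis by (auto simp: rel_adjoint_def)
qed

lemma sa_memI:
  "self_adjoint_rel A \<Longrightarrow> (\<And>u v. (u, v) \<in> A \<Longrightarrow> cinner b u = cinner a v) \<Longrightarrow> (a, b) \<in> A"
  unfolding self_adjoint_rel_def rel_adjoint_def by auto

text \<open>Membership in an adjoint relation is a family of equations between inner products; these
  survive limits, and \<open>A\<close> is its own adjoint.\<close>

lemma sa_closed:
  assumes A: "self_adjoint_rel A" and "F \<noteq> bot" and "(a \<longlongrightarrow> a') F" "(b \<longlongrightarrow> b') F"
    and ev: "\<forall>\<^sub>F x in F. (a x, b x) \<in> A"
  shows "(a', b') \<in> A"
proof (rule sa_memI[OF A])
  fix u v assume uv: "(u, v) \<in> A"
  have b: "((\<lambda>x. cinner (b x) u) \<longlongrightarrow> cinner b' u) F"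
    by (rule tendsto_cinner[OF assms(4) tendsto_const])
  have a: "((\<lambda>x. cinner (a x) v) \<longlongrightarrow> cinner a' v) F"
    by (rule tendsto_cinner[OF assms(3) tendsto_const])
  from ev have "\<forall>\<^sub>F x in F. cinner (a x) v = cinner (b x) u"
    by eventually_elim (rule sa_symmetric[OF A _ uv, symmetric])
  from Lim_transform_eventually[OF a this] show "cinner b' u = cinner a' v"
    by (rule tendsto_unique[OF \<open>F \<noteq> bot\<close> b])
qed

text \<open>The orthogonal complement of \<open>ran (A - z)\<close> is
  \<open>ker (A - cnj z)\<close>, because \<open>A\<close> equals its adjoint. The \<open>k\<close>
  of the proof represents \<open>y\<close> on that range, hence is the projection of
  \<open>y\<close> onto its closure, and \<open>p = y - k\<close>.\<close>

lemma sa_decomposition: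
  fixes A :: "('h::chilbert_space \<times> 'h) set"
  assumes A: "self_adjoint_rel A"
  obtains p where "(p, cnj z *\<^sub>C p) \<in> A" "y - p \<in> closure {b - z *\<^sub>C a | a b. (a, b) \<in> A}"
proof -
  define B where "B x = snd x - z *\<^sub>C fst x" for x :: "'h \<times> 'h"
  have B: "linear B" "\<And>c x. B (c *\<^sub>C x) = c *\<^sub>C B x"
    by (auto intro!: linearI simp: B_def scaleC_prod_def scaleC_add_right scaleR_scaleC scaleC_scaleC
        complex_vector.scale_right_diff_distrib mult.commute)
  have lin: "linear (\<lambda>x. cinner (B x) y)"
    by (intro linearI) (auto simp: linear_add[OF B(1)] scaleR_scaleC B(2) cinner_simps scaleC_complex_def)
  have scale: "cinner (B (c *\<^sub>C x)) y = c * cinner (B x) y" for c x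
    by (simp add: B(2) cinner_scaleC_left)
  have bound: "cmod (cinner (B f) y) \<le> norm y * norm (B f)" for f
    using norm_cinner_le[of "B f" y] by (simp add: mult.commute)
  obtain k where k: "k \<in> closure (B ` A)" "\<And>f. f \<in> A \<Longrightarrow> cinner (B f) k = cinner (B f) y"
    using cinner_representation[OF B lin scale sa_csubspace[OF A] bound] by metis
  have "B ` A = {b - z *\<^sub>C a | a b. (a, b) \<in> A}"
    by (simp add: B_def image_def Bex_def split_paired_Ex conj_commute)
  moreover have "(y - k, cnj z *\<^sub>C (y - k)) \<in> A"
  proof (rule sa_memI[OF A])
    fix u v assume "(u, v) \<in> A"
    from k(2)[OF this] have "cinner (v - z *\<^sub>C u) (y - k) = 0" by (simp add: B_def cinner_simps)
    then have "cinner v (y - k) = cinner (z *\<^sub>C u) (y - k)" by (simp add: cinner_diff_left)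
    then have "cinner (y - k) v = cinner (y - k) (z *\<^sub>C u)" by (metis cinner_commute)
    then show "cinner (cnj z *\<^sub>C (y - k)) u = cinner (y - k) v"
      by (simp add: cinner_scaleC_left cinner_scaleC_right)
  qed
  ultimately show thesis using that[of "y - k"] k(1) by simp
qed

text \<open>Symmetry makes \<open>(k, g + z k)\<close> a real number; expand it. The hypothesis
  means that \<open>k\<close> is a value of \<open>(A - z)\<inverse>\<close> at \<open>g\<close>,
  and this membership form is used for resolvents throughout.\<close>

lemma sa_Im_cinner:
  assumes A: "self_adjoint_rel A" and k: "(k, g + z *\<^sub>C k) \<in> A"
  shows "Im (cinner k g) = Im z * (norm k)\<^sup>2"
proof -
  have "cinner (g + z *\<^sub>C k) k = cinner k (g + z *\<^sub>C k)" by (rule sa_symmetric[OF A k k])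
  then have "Im (cinner k (g + z *\<^sub>C k)) = 0"
    using arg_cong[OF cinner_commute[of k "g + z *\<^sub>C k"], of Im] by simp
  then show ?thesis by (simp add: cinner_simps cinner_self)
qed

lemma sa_resolvent_bound:
  assumes A: "self_adjoint_rel A" and k: "(k, g + z *\<^sub>C k) \<in> A"
  shows "\<bar>Im z\<bar> * norm k \<le> norm g"
proof (cases "k = 0")
  case False
  have "(\<bar>Im z\<bar> * norm k) * norm k = \<bar>Im (cinner k g)\<bar>"
    by (simp add: sa_Im_cinner[OF assms] abs_mult power2_eq_square)
  also have "\<dots> \<le> norm g * norm k"
    using abs_Im_le_cmod[of "cinner k g"] norm_cinner_le[of k g] by (simp add: mult.commute)
  finally show ?thesis using False by simp
qed simp

text \<open>The lower bound \<open>sa_resolvent_bound\<close> does everything: it makes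
  \<open>ker (A - cnj z)\<close> trivial, so the range of \<open>A - z\<close> is dense; it makes
  preimages of a convergent sequence Cauchy, so closedness of \<open>A\<close> makes the range
  closed; and it gives uniqueness.\<close>

lemma sa_resolvent_exists:
  fixes A :: "('h::chilbert_space \<times> 'h) set"
  assumes A: "self_adjoint_rel A" and z: "Im z \<noteq> 0"
  shows "\<exists>!k. (k, g + z *\<^sub>C k) \<in> A"
proof (rule ex_ex1I)
  obtain p where p: "(p, cnj z *\<^sub>C p) \<in> A" "g - p \<in> closure {b - z *\<^sub>C a | a b. (a, b) \<in> A}"
    by (rule sa_decomposition[OF A])
  have "p = 0" using sa_resolvent_bound[OF A, of p 0 "cnj z"] p(1) z by (simp add: mult_le_0_iff)
  then obtain r where r: "\<And>n. r n \<in> {b - z *\<^sub>C a | a b. (a, b) \<in> A}" "r \<longlonglongrightarrow> g"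
    using p(2) unfolding closure_sequential by auto
  have "\<exists>k. (k, r n + z *\<^sub>C k) \<in> A" for n
  proof -
    obtain a b where "(a, b) \<in> A" "r n = b - z *\<^sub>C a" using r(1)[of n] by auto
    then show ?thesis by (intro exI[of _ a]) simp
  qed
  then obtain k where k: "\<And>n. (k n, r n + z *\<^sub>C k n) \<in> A" by metis
  have d: "\<bar>Im z\<bar> * dist (k m) (k n) \<le> dist (r m) (r n)" for m n
  proof -
    have "(k m - k n, (r m - r n) + z *\<^sub>C (k m - k n)) \<in> A"
      using sa_diff[OF A k k, of m n] by (simp add: complex_vector.scale_right_diff_distrib algebra_simps)
    from sa_resolvent_bound[OF A this] show ?thesis by (simp add: dist_norm)
  qed
  have "Cauchy k"
  proof (rule metric_CauchyI)
    fix e :: real assume "e > 0"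
    then have "\<bar>Im z\<bar> * e > 0" using z by simp
    then obtain N where N: "\<And>m n. m \<ge> N \<Longrightarrow> n \<ge> N \<Longrightarrow> dist (r m) (r n) < \<bar>Im z\<bar> * e"
      using metric_CauchyD[OF LIMSEQ_imp_Cauchy[OF r(2)], of "\<bar>Im z\<bar> * e"] by auto
    have "\<forall>m\<ge>N. \<forall>n\<ge>N. dist (k m) (k n) < e"
    proof (intro allI impI)
      fix m n assume that: "m \<ge> N" "n \<ge> N"
      have "\<bar>Im z\<bar> * dist (k m) (k n) < \<bar>Im z\<bar> * e" using d[of m n] N[OF that] by linarith
      then show "dist (k m) (k n) < e" using z by simp
    qed
    then show "\<exists>N. \<forall>m\<ge>N. \<forall>n\<ge>N. dist (k m) (k n) < e" by (rule exI)
  qed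
  then obtain k' where k': "k \<longlonglongrightarrow> k'" using Cauchy_convergent unfolding convergent_def by blast
  have "(k', g + z *\<^sub>C k') \<in> A"
  proof (rule sa_closed[OF A sequentially_bot k'])
    show "(\<lambda>n. r n + z *\<^sub>C k n) \<longlonglongrightarrow> g + z *\<^sub>C k'"
      by (intro tendsto_add tendsto_scaleC tendsto_const k' r(2))
  qed (simp add: k)
  then show "\<exists>k. (k, g + z *\<^sub>C k) \<in> A" by blast
next
  fix k k' assume "(k, g + z *\<^sub>C k) \<in> A" "(k', g + z *\<^sub>C k') \<in> A"
  from sa_diff[OF A this] have "(k - k', 0 + z *\<^sub>C (k - k')) \<in> A"
    by (simp add: complex_vector.scale_right_diff_distrib)
  from sa_resolvent_bound[OF A this] have "\<bar>Im z\<bar> * norm (k - k') \<le> 0" by (simp only: norm_zero)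
  then have "norm (k - k') = 0" using z by (simp only: mult_le_0_iff) auto
  then show "k = k'" by simp
qed

text \<open>A total function in place of the relation \<open>rel_resolvent A z\<close>; it is used
  at nonreal \<open>z\<close>, where the description is proper.\<close>

definition resolvent :: "('h::complex_inner \<times> 'h) set \<Rightarrow> complex \<Rightarrow> 'h \<Rightarrow> 'h" where
  "resolvent A z g = (THE k. (k, g + z *\<^sub>C k) \<in> A)"

lemma resolvent_iff:
  fixes A :: "('h::chilbert_space \<times> 'h) set"
  assumes "self_adjoint_rel A" and "Im z \<noteq> 0"
  shows "(k, g + z *\<^sub>C k) \<in> A \<longleftrightarrow> k = resolvent A z g"
proof
  assume "(k, g + z *\<^sub>C k) \<in> A"
  then show "k = resolvent A z g"
    unfolding resolvent_def by (rule the1_equality[OF sa_resolvent_exists[OF assms], symmetric])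
next
  assume "k = resolvent A z g"
  then show "(k, g + z *\<^sub>C k) \<in> A"
    using theI'[OF sa_resolvent_exists[OF assms, of g]] by (simp only: resolvent_def)
qed

lemma resolvent_mem:
  fixes A :: "('h::chilbert_space \<times> 'h) set"
  assumes "self_adjoint_rel A" and "Im z \<noteq> 0"
  shows "(resolvent A z g, g + z *\<^sub>C resolvent A z g) \<in> A"
  by (rule resolvent_iff[OF assms, THEN iffD2, OF refl])

lemma norm_resolvent_le:
  fixes A :: "('h::chilbert_space \<times> 'h) set"
  assumes "self_adjoint_rel A" and "Im z \<noteq> 0"
  shows "\<bar>Im z\<bar> * norm (resolvent A z g) \<le> norm g"
  by (rule sa_resolvent_bound[OF assms(1) resolvent_mem[OF assms]])

lemma bounded_clinear_resolvent:
  fixes A :: "('h::chilbert_space \<times> 'h) set"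
  assumes A: "self_adjoint_rel A" and z: "Im z \<noteq> 0"
  shows "bounded_clinear (resolvent A z)"
proof (rule bounded_clinearI[where K = "1 / \<bar>Im z\<bar>"])
  note m = resolvent_mem[OF A z] and iff = resolvent_iff[OF A z]
  show "resolvent A z (x + y) = resolvent A z x + resolvent A z y" for x y
    by (rule iff[THEN iffD1, symmetric])
      (use sa_add[OF A m m, of x y] in \<open>simp add: scaleC_add_right algebra_simps\<close>)
  show "resolvent A z (c *\<^sub>C x) = c *\<^sub>C resolvent A z x" for c x
    by (rule iff[THEN iffD1, symmetric])
      (use sa_scale[OF A m, of c x] in \<open>simp add: scaleC_add_right scaleC_scaleC mult.commute\<close>)
  show "norm (resolvent A z x) \<le> norm x * (1 / \<bar>Im z\<bar>)" for x
    using norm_resolvent_le[OF assms, of x] z by (simp add: field_simps)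
qed

lemma rel_resolvent_iff:
  "(g, k) \<in> rel_resolvent A z \<longleftrightarrow> (k, g + z *\<^sub>C k) \<in> (A :: ('h::complex_inner \<times> 'h) set)"
proof -
  have "(k, g + z *\<^sub>C k) \<in> A" if "(k, y) \<in> A" "g = y + (- z) *\<^sub>C k" for y
    using that by (simp add: complex_vector.scale_minus_left)
  moreover have "\<exists>y. (k, y) \<in> A \<and> g = y + (- z) *\<^sub>C k" if "(k, g + z *\<^sub>C k) \<in> A"
    using that by (intro exI[of _ "g + z *\<^sub>C k"]) (simp add: complex_vector.scale_minus_left)
  ultimately show ?thesis
    by (auto simp: rel_resolvent_def rel_add_def rel_scale_def)
qed

lemma nonreal_resolvent_set:
  fixes A :: "('h::chilbert_space \<times> 'h) set"
  assumes A: "self_adjoint_rel A" and z: "Im z \<noteq> 0"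
  shows "z \<in> resolvent_set A"
proof -
  have "rel_resolvent A z = op_graph (resolvent A z)"
    by (auto simp: op_graph_def rel_resolvent_iff resolvent_iff[OF A z])
  then show ?thesis using bounded_clinear_resolvent[OF A z] unfolding resolvent_set_def by blast
qed

text \<open>Unfolds the relational compositions into a single witness \<open>k\<close>, a value of
  \<open>(A - z)\<inverse>\<close> at \<open>\<gamma> f\<close>. At nonreal \<open>z\<close> it is
  the resolvent; at real \<open>z\<close> there may be none or many.\<close>

lemma generalised_value_iff:
  fixes A :: "('h::complex_inner \<times> 'h) set" and \<gamma> :: "'g::complex_inner \<Rightarrow> 'h"
  shows "(f, y) \<in> generalised_value Q A \<gamma> z0 z \<longleftrightarrow>
    (\<exists>k. (k, \<gamma> f + z *\<^sub>C k) \<in> A \<and>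
         y = cadjoint (Q z0) f + (z - cnj z0) *\<^sub>C cadjoint \<gamma> (\<gamma> f + (z - z0) *\<^sub>C k))"
proof -
  have "(f, h) \<in> gamma_rel A \<gamma> z0 z \<longleftrightarrow> (\<exists>k. (k, \<gamma> f + z *\<^sub>C k) \<in> A \<and> h = \<gamma> f + (z - z0) *\<^sub>C k)" for h
    unfolding gamma_rel_def
    by (auto simp: rel_add_def rel_scale_def op_graph_def rel_resolvent_iff relcomp_unfold)
  moreover have "(f, y) \<in> generalised_value Q A \<gamma> z0 z \<longleftrightarrow> (\<exists>h. (f, h) \<in> gamma_rel A \<gamma> z0 z \<and>
      y = cadjoint (Q z0) f + (z - cnj z0) *\<^sub>C cadjoint \<gamma> h)"
    by (auto simp: generalised_value_def rel_add_def rel_scale_def op_graph_def relcomp_unfold)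
  ultimately show ?thesis by auto
qed

section \<open>Projection onto an eigenspace and resolvents near a real point\<close>

definition eigenprojection :: "('h::complex_inner \<times> 'h) set \<Rightarrow> real \<Rightarrow> 'h \<Rightarrow> 'h" where
  "eigenprojection A w y = (SOME p. (p, complex_of_real w *\<^sub>C p) \<in> A \<and>
     y - p \<in> closure {b - complex_of_real w *\<^sub>C a | a b. (a, b) \<in> A})"

lemma
  fixes A :: "('h::chilbert_space \<times> 'h) set"
  assumes A: "self_adjoint_rel A"
  shows eigenprojection_mem: "(eigenprojection A w y, complex_of_real w *\<^sub>C eigenprojection A w y) \<in> A"
    and eigenprojection_diff: "y - eigenprojection A w y
      \<in> closure {b - complex_of_real w *\<^sub>C a | a b. (a, b) \<in> A}"
proof -
  obtain p where p: "(p, complex_of_real w *\<^sub>C p) \<in> A"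
      "y - p \<in> closure {b - complex_of_real w *\<^sub>C a | a b. (a, b) \<in> A}"
    using sa_decomposition[OF A, where z = "complex_of_real w" and y = y] by auto
  have "(eigenprojection A w y, complex_of_real w *\<^sub>C eigenprojection A w y) \<in> A \<and>
      y - eigenprojection A w y \<in> closure {b - complex_of_real w *\<^sub>C a | a b. (a, b) \<in> A}"
    unfolding eigenprojection_def by (rule someI[of _ p]) (use p in blast)
  then show "(eigenprojection A w y, complex_of_real w *\<^sub>C eigenprojection A w y) \<in> A"
    "y - eigenprojection A w y \<in> closure {b - complex_of_real w *\<^sub>C a | a b. (a, b) \<in> A}" by auto
qed

lemma eigenvector_orthogonal_range:
  fixes A :: "('h::chilbert_space \<times> 'h) set"
  assumes A: "self_adjoint_rel A" and k: "(k, complex_of_real w *\<^sub>C k) \<in> A"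
    and q: "q \<in> closure {b - complex_of_real w *\<^sub>C a | a b. (a, b) \<in> A}"
  shows "cinner q k = 0"
proof -
  obtain r where r: "\<And>n. r n \<in> {b - complex_of_real w *\<^sub>C a | a b. (a, b) \<in> A}" "r \<longlonglongrightarrow> q"
    using q unfolding closure_sequential by auto
  have "cinner (r n) k = 0" for n
  proof -
    obtain a b where ab: "(a, b) \<in> A" "r n = b - complex_of_real w *\<^sub>C a" using r(1)[of n] by auto
    show ?thesis using sa_symmetric[OF A ab(1) k] by (simp add: ab(2) cinner_simps)
  qed
  moreover have "(\<lambda>n. cinner (r n) k) \<longlonglongrightarrow> cinner q k" by (intro tendsto_intros r(2))
  ultimately show ?thesis by (simp add: LIMSEQ_const_iff)
qed

lemma cinner_eigenprojection:
  fixes A :: "('h::chilbert_space \<times> 'h) set"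
  assumes A: "self_adjoint_rel A" and k: "(k, complex_of_real w *\<^sub>C k) \<in> A"
  shows "cinner (eigenprojection A w y) k = cinner y k"
  using eigenvector_orthogonal_range[OF A k eigenprojection_diff[OF A, of y]] by (simp add: cinner_simps)

text \<open>Two candidates differ by an eigenvector orthogonal to itself. This removes the choice
  from \<open>eigenprojection\<close> and reduces its linearity to checking the
  characterisation.\<close>

lemma eigenprojection_unique:
  fixes A :: "('h::chilbert_space \<times> 'h) set"
  assumes A: "self_adjoint_rel A" and p: "(p, complex_of_real w *\<^sub>C p) \<in> A"
    and orth: "\<And>k. (k, complex_of_real w *\<^sub>C k) \<in> A \<Longrightarrow> cinner p k = cinner y k"
  shows "eigenprojection A w y = p"
proof -
  let ?d = "eigenprojection A w y - p"
  have d: "(?d, complex_of_real w *\<^sub>C ?d) \<in> A"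
    using sa_diff[OF A eigenprojection_mem[OF A] p]
    by (simp add: complex_vector.scale_right_diff_distrib)
  have "cinner ?d ?d = 0"
    using orth[OF d] cinner_eigenprojection[OF A d, of y] cinner_diff_left[of _ p ?d] by simp
  then show ?thesis by (simp add: cinner_self)
qed

lemma bounded_clinear_eigenprojection:
  fixes A :: "('h::chilbert_space \<times> 'h) set"
  assumes A: "self_adjoint_rel A"
  shows "bounded_clinear (eigenprojection A w)"
proof (rule bounded_clinearI[where K = 1])
  note m = eigenprojection_mem[OF A, of w] and c = cinner_eigenprojection[OF A]
  show "eigenprojection A w (x + y) = eigenprojection A w x + eigenprojection A w y" for x y
    by (rule eigenprojection_unique[OF A])
      (use sa_add[OF A m m, of x y] in \<open>auto simp: scaleC_add_right cinner_add_left c\<close>)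
  show "eigenprojection A w (t *\<^sub>C x) = t *\<^sub>C eigenprojection A w x" for t x
    by (rule eigenprojection_unique[OF A])
      (use sa_scale[OF A m, of t x] in \<open>auto simp: scaleC_scaleC mult.commute cinner_scaleC_left c\<close>)
  show "norm (eigenprojection A w x) \<le> norm x * 1" for x
  proof (cases "eigenprojection A w x = 0")
    case False
    have "(norm (eigenprojection A w x))\<^sup>2 = cmod (cinner x (eigenprojection A w x))"
      unfolding c[OF m, of x, symmetric] by (simp add: cinner_self norm_power)
    also have "\<dots> \<le> norm x * norm (eigenprojection A w x)" by (rule norm_cinner_le)
    finally show ?thesis using False by (simp add: power2_eq_square)
  qed simp
qed

text \<open>Within the Stolz angle \<open>|\<lambda> - w| \<le> M |Im \<lambda>|\<close> the operators \<open>(w - \<lambda>)(A - \<lambda>)\<inverse>\<close> are uniformly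
  bounded by \<open>M\<close>, so their convergence only needs to be checked on the eigenspace and on the range
  of \<open>A - w\<close>.\<close>

lemma resolvent_tendsto_eigenprojection:
  fixes A :: "('h::chilbert_space \<times> 'h) set"
  assumes A: "self_adjoint_rel A" and F: "filterlim (\<lambda>x. x) (nhds (complex_of_real w)) F"
    and ev: "\<forall>\<^sub>F l in F. Im l \<noteq> 0 \<and> cmod (of_real w - l) \<le> M * \<bar>Im l\<bar>"
  shows "((\<lambda>l. (of_real w - l) *\<^sub>C resolvent A l y) \<longlongrightarrow> eigenprojection A w y) F"
proof (rule tendstoI)
  fix e :: real assume e: "e > 0"
  define p where "p = eigenprojection A w y"
  \<comment> \<open>One constant for two roles: it bounds \<open>1 + \<bar>M\<bar>\<close>, which
    arises from the range part, and it is positive, hence a safe divisor for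
    \<open>e\<close>.\<close>
  define M' where "M' = \<bar>M\<bar> + 1"
  have M': "M' > 0" by (simp add: M'_def)
  have "e / (2 * M') > 0" using e M' by simp
  then obtain a b where ab: "(a, b) \<in> A" and close: "dist (b - of_real w *\<^sub>C a) (y - p) < e / (2 * M')"
    using eigenprojection_diff[OF A, of y w] unfolding closure_approachable p_def by blast
  define q where "q = b - of_real w *\<^sub>C a"
  have pA: "(p, of_real w *\<^sub>C p) \<in> A" unfolding p_def by (rule eigenprojection_mem[OF A])
  have "((\<lambda>l. cmod (of_real w - l) * (M' * norm a)) \<longlongrightarrow> cmod (of_real w - of_real w) * (M' * norm a)) F"
    using F by (intro tendsto_intros)
  then have "\<forall>\<^sub>F l in F. cmod (of_real w - l) * (M' * norm a) < e / 2"
    by (rule order_tendstoD) (use e in auto)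
  with ev show "\<forall>\<^sub>F l in F. dist ((of_real w - l) *\<^sub>C resolvent A l y) (eigenprojection A w y) < e"
  proof eventually_elim
    case (elim l)
    then have l: "Im l \<noteq> 0" and lM: "cmod (of_real w - l) \<le> M * \<bar>Im l\<bar>"
      and small: "cmod (of_real w - l) * (M' * norm a) < e / 2" by auto
    note R = bounded_clinear_resolvent[OF A l]
    let ?R = "resolvent A l" and ?c = "of_real w - l"
    have bound: "norm (?c *\<^sub>C ?R x) \<le> \<bar>M\<bar> * norm x" for x
    proof -
      have "norm (?c *\<^sub>C ?R x) \<le> (\<bar>M\<bar> * \<bar>Im l\<bar>) * norm (?R x)"
      proof -
        have "M * \<bar>Im l\<bar> \<le> \<bar>M\<bar> * \<bar>Im l\<bar>" by (intro mult_right_mono) auto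
        with lM have "cmod ?c \<le> \<bar>M\<bar> * \<bar>Im l\<bar>" by linarith
        then show ?thesis by (simp add: mult_right_mono)
      qed
      also have "\<dots> \<le> \<bar>M\<bar> * norm x"
        using norm_resolvent_le[OF A l, of x] by (simp add: mult.assoc mult_left_mono)
      finally show ?thesis .
    qed
    \<comment> \<open>On eigenvectors the scaled resolvent is the identity.\<close>
    have 1: "?R (?c *\<^sub>C p) = p"
      by (rule resolvent_iff[OF A l, THEN iffD1, symmetric])
        (use pA in \<open>simp add: complex_vector.scale_left_diff_distrib\<close>)
    \<comment> \<open>On the range of \<open>A - w\<close> the resolvent itself stays bounded, so
      the extra factor \<open>?c\<close> sends this part to 0.\<close>
    have 2: "?R q = a - ?c *\<^sub>C ?R a"
    proof -
      have "?R (q + ?c *\<^sub>C a) = a"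
        by (rule resolvent_iff[OF A l, THEN iffD1, symmetric])
          (use ab in \<open>simp add: q_def complex_vector.scale_left_diff_distrib\<close>)
      then have "?R q + ?c *\<^sub>C ?R a = a"
        by (simp only: bounded_clinear_add[OF R] bounded_clinear_scaleC[OF R])
      then show ?thesis by (simp only: eq_diff_eq)
    qed
    have "y = p + q + (y - p - q)" by simp
    then have "?c *\<^sub>C ?R y = ?c *\<^sub>C ?R p + ?c *\<^sub>C ?R q + ?c *\<^sub>C ?R (y - p - q)"
      by (metis bounded_clinear_add[OF R] scaleC_add_right)
    also have "?c *\<^sub>C ?R p = p" using 1 by (simp add: bounded_clinear_scaleC[OF R])
    finally have "dist (?c *\<^sub>C ?R y) p = norm (?c *\<^sub>C ?R q + ?c *\<^sub>C ?R (y - p - q))"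
      by (simp add: dist_norm)
    also have "\<dots> \<le> norm (?c *\<^sub>C ?R q) + norm (?c *\<^sub>C ?R (y - p - q))" by (rule norm_triangle_ineq)
    also have "norm (?c *\<^sub>C ?R q) \<le> cmod ?c * (M' * norm a)"
    proof -
      have "norm (a - ?c *\<^sub>C ?R a) \<le> norm a + \<bar>M\<bar> * norm a"
        using norm_triangle_ineq4[of a "?c *\<^sub>C ?R a"] bound[of a] by linarith
      then have "norm (?R q) \<le> M' * norm a" by (simp add: 2 M'_def algebra_simps)
      then show ?thesis by (simp add: mult_left_mono)
    qed
    also have "norm (?c *\<^sub>C ?R (y - p - q)) \<le> M' * (e / (2 * M'))"
    proof -
      have "norm (y - p - q) \<le> e / (2 * M')"
        using close by (simp add: dist_norm q_def norm_minus_commute)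
      then have "\<bar>M\<bar> * norm (y - p - q) \<le> M' * (e / (2 * M'))"
        by (intro mult_mono) (auto simp: M'_def)
      then show ?thesis using bound[of "y - p - q"] by linarith
    qed
    also have "M' * (e / (2 * M')) = e / 2" using M' by simp
    finally show ?case using small by (simp add: p_def)
  qed
qed

text \<open>The resolvent identity between \<open>l\<close> and the real point \<open>w\<close>. It
  needs only one preimage \<open>k\<close> of \<open>y\<close> under \<open>A - w\<close>, not
  invertibility.\<close>

lemma resolvent_on_range:
  fixes A :: "('h::chilbert_space \<times> 'h) set"
  assumes A: "self_adjoint_rel A" and l: "Im l \<noteq> 0" and k: "(k, y + of_real w *\<^sub>C k) \<in> A"
  shows "resolvent A l y = k - (of_real w - l) *\<^sub>C resolvent A l k"
proof -
  note R = bounded_clinear_resolvent[OF A l]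
  have "resolvent A l (y + (of_real w - l) *\<^sub>C k) = k"
    by (rule resolvent_iff[OF A l, THEN iffD1, symmetric])
      (use k in \<open>simp add: complex_vector.scale_left_diff_distrib algebra_simps\<close>)
  then have "resolvent A l y + (of_real w - l) *\<^sub>C resolvent A l k = k"
    by (simp only: bounded_clinear_add[OF R] bounded_clinear_scaleC[OF R])
  then show ?thesis by (simp only: eq_diff_eq)
qed

text \<open>The limit does not depend on the preimage \<open>k\<close>: two preimages differ by an
  eigenvector, which the projection removes.\<close>

lemma resolvent_on_range_tendsto:
  fixes A :: "('h::chilbert_space \<times> 'h) set"
  assumes A: "self_adjoint_rel A" and F: "filterlim (\<lambda>x. x) (nhds (complex_of_real w)) F"
    and ev: "\<forall>\<^sub>F l in F. Im l \<noteq> 0 \<and> cmod (of_real w - l) \<le> M * \<bar>Im l\<bar>"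
    and k: "(k, y + of_real w *\<^sub>C k) \<in> A"
  shows "((\<lambda>l. resolvent A l y) \<longlongrightarrow> k - eigenprojection A w k) F"
proof -
  have "((\<lambda>l. k - (of_real w - l) *\<^sub>C resolvent A l k) \<longlongrightarrow> k - eigenprojection A w k) F"
    by (intro tendsto_intros resolvent_tendsto_eigenprojection[OF A F ev])
  moreover from ev have "\<forall>\<^sub>F l in F. k - (of_real w - l) *\<^sub>C resolvent A l k = resolvent A l y"
    by eventually_elim (simp add: resolvent_on_range[OF A _ k])
  ultimately show ?thesis by (rule Lim_transform_eventually)
qed

text \<open>For \<open>u = (A - w - i s)\<inverse> y\<close> and \<open>u' = (A - w - i s')\<inverse> y\<close> one has
  \<open>(s + s') \<parallel>u - u'\<parallel>\<^sup>2 = (s - s') (\<parallel>u'\<parallel>\<^sup>2 - \<parallel>u\<parallel>\<^sup>2)\<close>, so a bounded family of resolvents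
  is monotone in norm and therefore Cauchy.\<close>

lemma resolvent_difference_norm:
  fixes A :: "('h::chilbert_space \<times> 'h) set"
  assumes A: "self_adjoint_rel A"
    and u: "(u, y + Complex w s *\<^sub>C u) \<in> A" and u': "(u', y + Complex w s' *\<^sub>C u') \<in> A"
  shows "(s + s') * (norm (u - u'))\<^sup>2 = (s - s') * ((norm u')\<^sup>2 - (norm u)\<^sup>2)"
proof -
  have a: "Im (cinner u y) = s * (norm u)\<^sup>2" using sa_Im_cinner[OF A u] by simp
  have b: "Im (cinner u' y) = s' * (norm u')\<^sup>2" using sa_Im_cinner[OF A u'] by simp
  have "cinner (y + Complex w s *\<^sub>C u) u' = cinner u (y + Complex w s' *\<^sub>C u')"
    by (rule sa_symmetric[OF A u u'])
  then have "cnj (cinner u' y) + Complex w s * cinner u u' = cinner u y + cnj (Complex w s') * cinner u u'"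
    by (simp add: cinner_simps cinner_commute[symmetric])
  from arg_cong[OF this, of Im]
  have "(s + s') * Re (cinner u u') = Im (cinner u y) + Im (cinner u' y)"
    by (simp add: algebra_simps)
  then have I: "(s + s') * inner u u' = s * (norm u)\<^sup>2 + s' * (norm u')\<^sup>2"
    by (simp add: a b inner_eq_Re_cinner)
  have N: "(norm (u - u'))\<^sup>2 = (norm u)\<^sup>2 + (norm u')\<^sup>2 - 2 * inner u u'"
    by (simp add: power2_norm_eq_inner inner_simps inner_commute)
  have "(s + s') * (norm (u - u'))\<^sup>2
      = (s + s') * ((norm u)\<^sup>2 + (norm u')\<^sup>2) - 2 * ((s + s') * inner u u')"
    unfolding N by (simp add: algebra_simps)
  then show ?thesis unfolding I by (simp add: algebra_simps)
qed

lemma range_if_bounded_resolvent: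
  fixes A :: "('h::chilbert_space \<times> 'h) set"
  assumes A: "self_adjoint_rel A"
    and bound: "\<And>n. norm (resolvent A (Complex w (1 / real (Suc n))) y) \<le> M"
  obtains k where "(k, y + of_real w *\<^sub>C k) \<in> A"
proof -
  define s where "s n = 1 / real (Suc n)" for n
  define u where "u n = resolvent A (Complex w (s n)) y" for n
  have s0: "s n > 0" for n by (simp add: s_def)
  have uA: "(u n, y + Complex w (s n) *\<^sub>C u n) \<in> A" for n
    unfolding u_def using s0[of n] by (intro resolvent_mem[OF A]) simp
  have le: "(norm (u m - u n))\<^sup>2 \<le> (norm (u n))\<^sup>2 - (norm (u m))\<^sup>2" if "m \<le> n" for m n
  proof -
    have mono: "s n \<le> s m" using that by (simp add: s_def field_simps)
    have eq: "(s m + s n) * (norm (u m - u n))\<^sup>2 = (s m - s n) * ((norm (u n))\<^sup>2 - (norm (u m))\<^sup>2)"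
      by (rule resolvent_difference_norm[OF A uA uA])
    show ?thesis
    proof (cases "s m = s n")
      case True
      with that have "m = n" by (simp add: s_def)
      then show ?thesis by simp
    next
      case False
      with mono have pos: "s m - s n > 0" by simp
      have "0 \<le> (s m + s n) * (norm (u m - u n))\<^sup>2"
        using s0[of m] s0[of n] by (intro mult_nonneg_nonneg) auto
      then have d0: "0 \<le> (norm (u n))\<^sup>2 - (norm (u m))\<^sup>2"
        using eq pos by (simp add: zero_le_mult_iff)
      \<comment> \<open>The factor \<open>s m - s n\<close> of the identity is enlarged to
        \<open>s m + s n\<close>, which then cancels.\<close>
      have "(s m + s n) * (norm (u m - u n))\<^sup>2 \<le> (s m + s n) * ((norm (u n))\<^sup>2 - (norm (u m))\<^sup>2)"
        unfolding eq using d0 s0[of n] by (intro mult_right_mono) auto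
      then show ?thesis using s0[of m] s0[of n] by simp
    qed
  qed
  have "incseq (\<lambda>n. (norm (u n))\<^sup>2)"
  proof (rule incseq_SucI)
    fix n show "(norm (u n))\<^sup>2 \<le> (norm (u (Suc n)))\<^sup>2"
      using le[of n "Suc n"] zero_le_power2[of "norm (u n - u (Suc n))"] by linarith
  qed
  moreover have "(norm (u n))\<^sup>2 \<le> M\<^sup>2" for n
    using bound[of n] by (intro power_mono) (auto simp: u_def s_def)
  ultimately have "convergent (\<lambda>n. (norm (u n))\<^sup>2)" by (meson convergent_def incseq_convergent)
  then have C: "Cauchy (\<lambda>n. (norm (u n))\<^sup>2)" by (rule convergent_Cauchy)
  have "Cauchy u"
  proof (rule metric_CauchyI)
    fix e :: real assume e: "e > 0"
    then obtain N where N: "\<And>m n. m \<ge> N \<Longrightarrow> n \<ge> N \<Longrightarrow> dist ((norm (u m))\<^sup>2) ((norm (u n))\<^sup>2) < e\<^sup>2"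
      using metric_CauchyD[OF C, of "e\<^sup>2"] by auto
    have *: "dist (u m) (u n) < e" if "m \<ge> N" "n \<ge> N" "m \<le> n" for m n
    proof -
      have "(norm (u m - u n))\<^sup>2 < e\<^sup>2" using le[OF that(3)] N[OF that(1,2)] by (simp add: dist_real_def)
      then show ?thesis using e by (simp add: dist_norm power_less_imp_less_base)
    qed
    have "dist (u m) (u n) < e" if "m \<ge> N" "n \<ge> N" for m n
      using *[of m n] *[of n m] that by (cases "m \<le> n") (auto simp: dist_commute)
    then show "\<exists>N. \<forall>m\<ge>N. \<forall>n\<ge>N. dist (u m) (u n) < e" by blast
  qed
  then obtain k where k: "u \<longlonglongrightarrow> k" using Cauchy_convergent unfolding convergent_def by blast
  have "(\<lambda>n. complex_of_real w + \<i> * complex_of_real (s n)) \<longlonglongrightarrow> complex_of_real w + \<i> * complex_of_real 0"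
    unfolding s_def by (intro tendsto_intros LIMSEQ_inverse_real_of_nat[unfolded inverse_eq_divide])
  then have "(\<lambda>n. Complex w (s n)) \<longlonglongrightarrow> complex_of_real w" by (simp add: Complex_eq)
  then have "(\<lambda>n. y + Complex w (s n) *\<^sub>C u n) \<longlonglongrightarrow> y + of_real w *\<^sub>C k"
    by (intro tendsto_add tendsto_scaleC tendsto_const k)
  from sa_closed[OF A sequentially_bot k this] uA show thesis using that by simp
qed


section \<open>Positive operators and their square roots\<close>

instance chilbert_space \<subseteq> banach ..

lemma positive_op_clinear: "positive_op T \<Longrightarrow> bounded_clinear T"
  by (simp add: positive_op_def)

lemma positive_op_Im: "positive_op T \<Longrightarrow> Im (cinner (T x) x) = 0"
  by (simp add: positive_op_def complex_is_Real_iff[symmetric] nonneg_Reals_subset_Reals[THEN subsetD])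

lemma positive_op_nonneg: "positive_op T \<Longrightarrow> 0 \<le> inner (T x) x"
  by (auto simp: positive_op_def inner_eq_Re_cinner complex_nonneg_Reals_iff)

lemma positive_op_cinner_eq: "positive_op T \<Longrightarrow> cinner (T x) x = of_real (inner (T x) x)"
  using positive_op_Im[of T x] by (simp add: complex_eq_iff inner_eq_Re_cinner)

text \<open>Polarisation: reality of the quadratic form at \<open>x + y\<close> and
  \<open>x + \<i> y\<close> fixes the imaginary and real parts of the sesquilinear form.\<close>

lemma positive_op_hermitian:
  assumes T: "positive_op T"
  shows "cinner (T x) y = cinner x (T y)"
proof -
  note L = positive_op_clinear[OF T]
  have 1: "Im (cinner (T x) y) + Im (cinner (T y) x) = 0"
    using positive_op_Im[OF T, of "x + y"] positive_op_Im[OF T, of x] positive_op_Im[OF T, of y]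
    by (simp add: bounded_clinear_add[OF L] cinner_simps)
  have 2: "Re (cinner (T y) x) = Re (cinner (T x) y)"
    using positive_op_Im[OF T, of "x + \<i> *\<^sub>C y"] positive_op_Im[OF T, of x]
      positive_op_Im[OF T, of y]
    by (simp add: bounded_clinear_add[OF L] bounded_clinear_scaleC[OF L] cinner_simps)
  have "cinner (T x) y = cnj (cinner (T y) x)" using 1 2 by (simp add: complex_eq_iff)
  then show ?thesis by (metis cinner_commute)
qed

lemma positive_op_inner_commute: "positive_op T \<Longrightarrow> inner (T x) y = inner (T y) x"
  by (metis positive_op_hermitian inner_eq_Re_cinner inner_commute)

lemma positive_op_Cauchy_Schwarz:
  assumes T: "positive_op T"
  shows "(inner (T x) y)\<^sup>2 \<le> inner (T x) x * inner (T y) y"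
proof -
  note lin = bounded_clinear_linear[OF positive_op_clinear[OF T]]
  define a b c where "a = inner (T x) x" and "b = inner (T x) y" and "c = inner (T y) y"
  have key: "0 \<le> a + 2 * t * b + t\<^sup>2 * c" for t
    using positive_op_nonneg[OF T, of "x + t *\<^sub>R y"] positive_op_inner_commute[OF T, of y x]
    by (simp add: linear_add[OF lin] linear_scale[OF lin] inner_simps a_def b_def c_def
        power2_eq_square algebra_simps)
  have "b\<^sup>2 \<le> a * c"
  proof (cases "c = 0")
    case True
    have "b = 0"
    proof (rule ccontr)
      assume b: "b \<noteq> 0"
      \<comment> \<open>For \<open>c = 0\<close> the polynomial is affine in \<open>t\<close>, and
        this \<open>t\<close> would give it the value \<open>- 1\<close>.\<close>
      have "0 \<le> a + 2 * (- (a + 1) / (2 * b)) * b" using key[of "- (a + 1) / (2 * b)"] True by simp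
      also have "2 * (- (a + 1) / (2 * b)) * b = - (a + 1)" using b by (simp add: field_simps)
      finally show False by simp
    qed
    then show ?thesis using True by simp
  next
    case False
    then have c: "c > 0" using positive_op_nonneg[OF T, of y] by (simp add: c_def)
    have "0 \<le> a + 2 * (- b / c) * b + (- b / c)\<^sup>2 * c" by (rule key)
    also have "\<dots> = a - b\<^sup>2 / c" using c by (simp add: power2_eq_square field_simps)
    finally show ?thesis using c by (simp add: field_simps)
  qed
  then show ?thesis by (simp add: a_def b_def c_def)
qed

lemma positive_op_eq_0:
  assumes T: "positive_op T" and "cinner (T x) x = 0"
  shows "T x = 0"
proof -
  have "(inner (T x) (T x))\<^sup>2 \<le> 0"
    using positive_op_Cauchy_Schwarz[OF T, of x "T x"] assms(2) by (simp add: inner_eq_Re_cinner)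
  then show ?thesis by simp
qed

text \<open>Cauchy-Schwarz for the form \<open>(T x, y)\<close> at \<open>y = T x\<close>: a bound
  on the quadratic form controls the norm.\<close>

lemma positive_op_contraction:
  assumes T: "positive_op T" and le: "\<And>x. inner (T x) x \<le> (norm x)\<^sup>2"
  shows "norm (T x) \<le> norm x"
proof (cases "T x = 0")
  case False
  have "(inner (T x) (T x))\<^sup>2 \<le> inner (T x) x * inner (T (T x)) (T x)"
    by (rule positive_op_Cauchy_Schwarz[OF T])
  also have "\<dots> \<le> (norm x)\<^sup>2 * (norm (T x))\<^sup>2"
    by (intro mult_mono le positive_op_nonneg[OF T]) auto
  finally have "(norm (T x))\<^sup>2 * (norm (T x))\<^sup>2 \<le> (norm x)\<^sup>2 * (norm (T x))\<^sup>2"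
    by (simp add: power2_norm_eq_inner power2_eq_square[of "inner (T x) (T x)"])
  then have "(norm (T x))\<^sup>2 \<le> (norm x)\<^sup>2"
    using False by (simp only: mult_le_cancel_right) auto
  then show ?thesis by (simp add: power2_le_iff_abs_le)
qed simp

text \<open>The coefficients of the binomial series of \<open>sqrt (1 - x)\<close>.\<close>

definition sqrt_coeff :: "nat \<Rightarrow> real" where
  "sqrt_coeff n = (1/2 gchoose n) * (- 1) ^ n"

lemma sqrt_coeff_0 [simp]: "sqrt_coeff 0 = 1"
  by (simp add: sqrt_coeff_def)

text \<open>The quotient of neighbouring coefficients is positive from \<open>n = 1\<close> on for
  \<open>a = 1/2\<close> and for every \<open>n\<close> when \<open>a = - 1/2\<close>; the next two
  sign statements rest on these cases.\<close>

lemma gchoose_Suc_sign: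
  "(a gchoose Suc n) * (- 1) ^ Suc n = (a gchoose n) * (- 1) ^ n * ((real n - a) / real (Suc n))"
proof -
  have "(a gchoose Suc n) * real (Suc n) = (a gchoose n) * (a - real n)"
    using gbinomial_mult_1[of a n] by (simp add: algebra_simps)
  then have "a gchoose Suc n = (a gchoose n) * ((a - real n) / real (Suc n))"
    by (simp add: field_simps del: of_nat_Suc)
  then have "(a gchoose Suc n) * (- 1) ^ Suc n
      = ((a gchoose n) * (- 1) ^ n) * (- ((a - real n) / real (Suc n)))"
    by (simp only: power_Suc) (simp add: mult_ac)
  then show ?thesis by (simp only: minus_divide_left minus_diff_eq)
qed

lemma sqrt_coeff_nonpos: "sqrt_coeff (Suc n) \<le> 0"
proof (induction n)
  case 0
  show ?case by (simp add: sqrt_coeff_def)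
next
  case (Suc n)
  have "sqrt_coeff (Suc (Suc n)) = sqrt_coeff (Suc n) * ((real (Suc n) - 1/2) / real (Suc (Suc n)))"
    unfolding sqrt_coeff_def by (rule gchoose_Suc_sign)
  then show ?case using Suc
    by (simp only:) (rule mult_nonpos_nonneg, auto)
qed

text \<open>Partial sums of the coefficients of \<open>(1 - x)^(1/2)\<close> are the coefficients of
  \<open>(1 - x)^(-1/2)\<close>, which are all nonnegative.\<close>

lemma sqrt_coeff_sum_nonneg: "0 \<le> (\<Sum>k\<le>m. sqrt_coeff k)"
proof -
  have "0 \<le> ((- 1/2 :: real) gchoose m) * (- 1) ^ m" for m
  proof (induction m)
    case (Suc m)
    then show ?case unfolding gchoose_Suc_sign by (rule mult_nonneg_nonneg) auto
  qed simp
  then show ?thesis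
    unfolding sqrt_coeff_def gbinomial_sum_lower_neg by (simp add: mult.commute)
qed

text \<open>All coefficients after the first are nonpositive, so their moduli add up to 1 minus a
  nonnegative partial sum. The sharp constant 1 is what makes \<open>sqrt_series\<close>
  positive.\<close>

lemma sqrt_coeff_abs_sum_le: "(\<Sum>k=1..<n. \<bar>sqrt_coeff k\<bar>) \<le> 1"
proof (cases n)
  case (Suc m)
  have "(\<Sum>k=1..<n. \<bar>sqrt_coeff k\<bar>) = (\<Sum>k=1..<n. - sqrt_coeff k)"
  proof (intro sum.cong refl)
    fix k assume "k \<in> {1..<n}"
    then obtain j where "k = Suc j" by (cases k) auto
    then show "\<bar>sqrt_coeff k\<bar> = - sqrt_coeff k" using sqrt_coeff_nonpos[of j] by simp
  qed
  also have "\<dots> = 1 - (\<Sum>k\<le>m. sqrt_coeff k)"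
    by (simp add: Suc sum_negf sum.atMost_shift atLeastLessThanSuc_atLeastAtMost
        sum.atLeast1_atMost_eq lessThan_Suc_atMost)
  also have "\<dots> \<le> 1" using sqrt_coeff_sum_nonneg[of m] by simp
  finally show ?thesis .
qed simp

lemma sqrt_coeff_summable: "summable (\<lambda>n. \<bar>sqrt_coeff n\<bar>)"
proof (rule summableI_nonneg_bounded[where x = 2])
  fix n show "(\<Sum>k<n. \<bar>sqrt_coeff k\<bar>) \<le> 2"
  proof (cases n)
    case (Suc m)
    have "(\<Sum>k<n. \<bar>sqrt_coeff k\<bar>) = 1 + (\<Sum>k=1..<n. \<bar>sqrt_coeff k\<bar>)"
      unfolding lessThan_atLeast0 using Suc by (subst sum.atLeast_Suc_lessThan) auto
    then show ?thesis using sqrt_coeff_abs_sum_le[of n] by simp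
  qed simp
qed simp

text \<open>Vandermonde with \<open>1/2 + 1/2 = 1\<close>: the squared series is
  \<open>1 - x\<close>.\<close>

lemma sqrt_coeff_convolution:
  "(\<Sum>i\<le>n. sqrt_coeff i * sqrt_coeff (n - i)) = (if n = 0 then 1 else if n = 1 then - 1 else 0)"
proof -
  have "(\<Sum>i\<le>n. sqrt_coeff i * sqrt_coeff (n - i))
      = (\<Sum>i\<le>n. (- 1) ^ n * ((1/2 gchoose i) * (1/2 gchoose (n - i))))"
    by (intro sum.cong refl) (simp add: sqrt_coeff_def power_add[symmetric] algebra_simps)
  also have "\<dots> = (- 1) ^ n * ((1/2 + 1/2 :: real) gchoose n)"
    unfolding sum_distrib_left[symmetric] gbinomial_Vandermonde[symmetric] atMost_atLeast0 ..
  also have "(1/2 + 1/2 :: real) gchoose n = real (1 choose n)"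
    by (simp add: binomial_gbinomial)
  also have "(- 1) ^ n * real (1 choose n) = (if n = 0 then 1 else if n = 1 then - 1 else 0)"
    by (cases n; cases "n - 1") (auto simp: binomial_eq_0)
  finally show ?thesis .
qed

section \<open>The root of \<open>I - X\<close> for a positive contraction \<open>X\<close>\<close>

definition sqrt_series :: "('a::chilbert_space \<Rightarrow> 'a) \<Rightarrow> 'a \<Rightarrow> 'a" where
  "sqrt_series X y = (\<Sum>n. sqrt_coeff n *\<^sub>R (X ^^ n) y)"

context
  fixes X :: "'a::chilbert_space \<Rightarrow> 'a"
  assumes X: "positive_op X" and contr: "\<And>x. norm (X x) \<le> norm x"
begin

lemma norm_funpow_le: "norm ((X ^^ n) y) \<le> norm y"
  by (induction n) (auto intro: order_trans[OF contr])

lemma funpow_clinear: "bounded_clinear (X ^^ n)"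
proof (rule bounded_clinearI[where K = 1])
  note L = positive_op_clinear[OF X]
  show "(X ^^ n) (x + y) = (X ^^ n) x + (X ^^ n) y" for x y
    by (induction n) (auto simp: bounded_clinear_add[OF L])
  show "(X ^^ n) (c *\<^sub>C x) = c *\<^sub>C (X ^^ n) x" for c x
    by (induction n) (auto simp: bounded_clinear_scaleC[OF L])
qed (simp add: norm_funpow_le)

lemma funpow_hermitian: "cinner ((X ^^ n) x) y = cinner x ((X ^^ n) y)"
  by (induction n arbitrary: x y) (simp_all add: positive_op_hermitian[OF X] funpow_swap1)

lemma sqrt_series_abs_summable: "summable (\<lambda>n. norm (sqrt_coeff n *\<^sub>R (X ^^ n) y))"
  by (rule summable_comparison_test'[OF summable_mult2[OF sqrt_coeff_summable, of "norm y"], of 0])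
    (auto intro: mult_left_mono norm_funpow_le)

lemma sqrt_series_sums: "(\<lambda>n. sqrt_coeff n *\<^sub>R (X ^^ n) y) sums sqrt_series X y"
  unfolding sqrt_series_def
  by (rule summable_sums[OF summable_norm_cancel[OF sqrt_series_abs_summable]])

lemma norm_sqrt_series_le: "norm (sqrt_series X y) \<le> norm y * (\<Sum>n. \<bar>sqrt_coeff n\<bar>)"
proof -
  have "norm (sqrt_series X y) \<le> (\<Sum>n. norm (sqrt_coeff n *\<^sub>R (X ^^ n) y))"
    unfolding sqrt_series_def by (rule summable_norm[OF sqrt_series_abs_summable])
  also have "\<dots> \<le> (\<Sum>n. \<bar>sqrt_coeff n\<bar> * norm y)"
    by (intro suminf_le sqrt_series_abs_summable summable_mult2 sqrt_coeff_summable)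
      (auto intro: mult_left_mono norm_funpow_le)
  also have "\<dots> = norm y * (\<Sum>n. \<bar>sqrt_coeff n\<bar>)"
    using suminf_mult2[OF sqrt_coeff_summable, of "norm y"] by (simp add: mult.commute)
  finally show ?thesis .
qed

lemma sqrt_series_clinear: "bounded_clinear (sqrt_series X)"
proof (rule bounded_clinearI)
  show "sqrt_series X (x + y) = sqrt_series X x + sqrt_series X y" for x y
  proof (rule sums_unique2[OF sqrt_series_sums])
    show "(\<lambda>n. sqrt_coeff n *\<^sub>R (X ^^ n) (x + y)) sums (sqrt_series X x + sqrt_series X y)"
      using sums_add[OF sqrt_series_sums[of x] sqrt_series_sums[of y]]
      by (simp add: bounded_clinear_add[OF funpow_clinear] scaleR_add_right)
  qed
  show "sqrt_series X (c *\<^sub>C x) = c *\<^sub>C sqrt_series X x" for c x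
  proof (rule sums_unique2[OF sqrt_series_sums])
    show "(\<lambda>n. sqrt_coeff n *\<^sub>R (X ^^ n) (c *\<^sub>C x)) sums (c *\<^sub>C sqrt_series X x)"
      using bounded_linear.sums[OF bounded_bilinear.bounded_linear_right[OF bounded_bilinear_scaleC]
          sqrt_series_sums[of x], of c]
      by (simp add: bounded_clinear_scaleC[OF funpow_clinear] scaleR_scaleC scaleC_scaleC mult.commute)
  qed
qed (rule norm_sqrt_series_le)

text \<open>Serves uniqueness: another root of an operator commutes with the operator, hence with
  the root built from the series.\<close>

lemma sqrt_series_commute:
  assumes P: "bounded_clinear P" and comm: "\<And>x. P (X x) = X (P x)"
  shows "P (sqrt_series X y) = sqrt_series X (P y)"
proof -
  have pow: "P ((X ^^ n) x) = (X ^^ n) (P x)" for n x by (induction n) (auto simp: comm)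
  have "(\<lambda>n. P (sqrt_coeff n *\<^sub>R (X ^^ n) y)) sums P (sqrt_series X y)"
    using P sqrt_series_sums by (auto simp: bounded_clinear_def intro: bounded_linear.sums)
  then have "(\<lambda>n. sqrt_coeff n *\<^sub>R (X ^^ n) (P y)) sums P (sqrt_series X y)"
    by (simp add: linear_scale[OF bounded_clinear_linear[OF P]] pow)
  then show ?thesis using sqrt_series_sums sums_unique2 by blast
qed

text \<open>The term \<open>n = 0\<close> contributes \<open>(norm y)^2\<close>; by
  \<open>sqrt_coeff_abs_sum_le\<close> all later terms together take away at most that much.\<close>

lemma sqrt_series_positive: "positive_op (sqrt_series X)"
  unfolding positive_op_def
proof (intro conjI allI sqrt_series_clinear)
  fix y
  define P where "P N = (\<Sum>n<N. sqrt_coeff n *\<^sub>R (X ^^ n) y)" for N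
  have lim: "(\<lambda>N. cinner (P N) y) \<longlonglongrightarrow> cinner (sqrt_series X y) y"
    using sqrt_series_sums[of y] unfolding sums_def P_def
    by (rule tendsto_cinner[OF _ tendsto_const])
  have P_eq: "cinner (P N) y = (\<Sum>n<N. of_real (sqrt_coeff n) * cinner ((X ^^ n) y) y)" for N
    unfolding P_def by (induction N) (auto simp: cinner_add_left scaleR_scaleC cinner_scaleC_left)
  have Im0: "Im (cinner ((X ^^ n) y) y) = 0" for n
    using arg_cong[OF funpow_hermitian[of n y y], of Im]
      arg_cong[OF cinner_commute[of y "(X ^^ n) y"], of Im] by simp
  have "cinner (P N) y \<in> \<real>\<^sub>\<ge>\<^sub>0" for N
  proof (cases N)
    case (Suc M)
    have "Re (cinner (P N) y) = (norm y)\<^sup>2 + (\<Sum>n=1..<N. sqrt_coeff n * Re (cinner ((X ^^ n) y) y))"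
      unfolding P_eq lessThan_atLeast0 using Suc
      by (subst sum.atLeast_Suc_lessThan) (auto simp: cinner_self)
    moreover have "- (\<Sum>n=1..<N. sqrt_coeff n * Re (cinner ((X ^^ n) y) y))
        \<le> (\<Sum>n=1..<N. \<bar>sqrt_coeff n\<bar> * (norm y)\<^sup>2)"
      unfolding sum_negf[symmetric]
    proof (intro sum_mono)
      fix n
      have "\<bar>Re (cinner ((X ^^ n) y) y)\<bar> \<le> norm y * norm y"
        using order_trans[OF abs_Re_le_cmod norm_cinner_le] mult_right_mono[OF norm_funpow_le norm_ge_zero]
        by (rule order_trans)
      then have "\<bar>sqrt_coeff n\<bar> * \<bar>Re (cinner ((X ^^ n) y) y)\<bar> \<le> \<bar>sqrt_coeff n\<bar> * (norm y)\<^sup>2"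
        by (intro mult_left_mono) (auto simp: power2_eq_square)
      then show "- (sqrt_coeff n * Re (cinner ((X ^^ n) y) y)) \<le> \<bar>sqrt_coeff n\<bar> * (norm y)\<^sup>2"
        unfolding abs_mult[symmetric] by linarith
    qed
    moreover have "(\<Sum>n=1..<N. \<bar>sqrt_coeff n\<bar> * (norm y)\<^sup>2) \<le> 1 * (norm y)\<^sup>2"
      unfolding sum_distrib_right[symmetric]
      by (intro mult_right_mono sqrt_coeff_abs_sum_le) auto
    ultimately have "0 \<le> Re (cinner (P N) y)" by linarith
    moreover have "Im (cinner (P N) y) = 0" unfolding P_eq by (simp add: Im0)
    ultimately show ?thesis by (simp add: complex_nonneg_Reals_iff)
  qed (simp add: P_def)
  then show "cinner (sqrt_series X y) y \<in> \<real>\<^sub>\<ge>\<^sub>0"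
    by (rule closed_sequentially[OF closed_nonneg_Reals_complex _ lim])
qed

text \<open>The double series over \<open>(n, m)\<close> is absolutely summable, so it may be
  regrouped along the diagonals \<open>k = n + m\<close>, where the coefficients form the
  convolution.\<close>

lemma sqrt_series_square: "sqrt_series X (sqrt_series X y) = y - X y"
proof -
  define c where "c = sqrt_coeff"
  define v where "v n = (X ^^ n) y" for n
  have cs: "(\<lambda>n. \<bar>c n\<bar>) summable_on UNIV"
    using norm_summable_imp_summable_on[of "\<lambda>n. \<bar>c n\<bar>"] sqrt_coeff_summable by (simp add: c_def)
  have infsum_series: "sqrt_series X z = (\<Sum>\<^sub>\<infinity>n. c n *\<^sub>R (X ^^ n) z)" for z
    using norm_summable_imp_has_sum[OF sqrt_series_abs_summable sqrt_series_sums, of z]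
    by (simp add: c_def infsumI)
  have "(\<lambda>(n, m). \<bar>c n\<bar> * \<bar>c m\<bar>) summable_on UNIV \<times> UNIV"
  proof (rule summable_on_SigmaI[where g = "\<lambda>n. \<bar>c n\<bar> * (\<Sum>\<^sub>\<infinity>m. \<bar>c m\<bar>)"])
    show "((\<lambda>m. case (n, m) of (n, m) \<Rightarrow> \<bar>c n\<bar> * \<bar>c m\<bar>) has_sum \<bar>c n\<bar> * (\<Sum>\<^sub>\<infinity>m. \<bar>c m\<bar>)) UNIV" for n
      by (simp add: has_sum_cmult_right has_sum_infsum[OF cs])
    show "(\<lambda>n. \<bar>c n\<bar> * (\<Sum>\<^sub>\<infinity>m. \<bar>c m\<bar>)) summable_on UNIV"
      by (intro summable_on_cmult_left cs)
  qed auto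
  from summable_on_cmult_left[OF this, of "norm y"]
  have "(\<lambda>p. norm ((c (fst p) * c (snd p)) *\<^sub>R v (fst p + snd p))) summable_on UNIV \<times> UNIV"
    by (rule summable_on_comparison_test)
      (auto simp: abs_mult v_def intro!: mult_left_mono norm_funpow_le)
  then have S: "(\<lambda>(n, m). (c n * c m) *\<^sub>R v (n + m)) summable_on UNIV \<times> UNIV"
    by (simp add: abs_summable_summable case_prod_beta)
  have bij: "bij_betw (\<lambda>(k, n). (n, k - n)) (SIGMA k:UNIV. {..k}) (UNIV \<times> UNIV :: (nat \<times> nat) set)"
    by (rule bij_betw_byWitness[where f' = "\<lambda>(n, m). (n + m, n)"]) auto
  have S': "(\<lambda>(k, n). (c n * c (k - n)) *\<^sub>R v k) summable_on (SIGMA k:UNIV. {..k})"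
    using summable_on_reindex_bij_betw[OF bij, of "\<lambda>(n, m). (c n * c m) *\<^sub>R v (n + m)"] S
    by (subst summable_on_cong[where g = "\<lambda>x. case (case x of (k, n) \<Rightarrow> (n, k - n)) of
          (n, m) \<Rightarrow> (c n * c m) *\<^sub>R v (n + m)"]) auto
  have "sqrt_series X (sqrt_series X y) = (\<Sum>\<^sub>\<infinity>n. \<Sum>\<^sub>\<infinity>m. (c n * c m) *\<^sub>R v (n + m))"
    unfolding infsum_series[of "sqrt_series X y"]
  proof (intro infsum_cong)
    fix n
    have bl: "bounded_linear (\<lambda>z. c n *\<^sub>R (X ^^ n) z)"
      using funpow_clinear[of n] by (auto simp: bounded_clinear_def intro: bounded_linear_const_scaleR)
    have "(\<lambda>m. c m *\<^sub>R (X ^^ m) y) summable_on UNIV"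
      using norm_summable_imp_summable_on[OF sqrt_series_abs_summable[of y]] by (simp add: c_def)
    from has_sum_bounded_linear[OF bl has_sum_infsum[OF this], THEN infsumI, symmetric]
    show "c n *\<^sub>R (X ^^ n) (sqrt_series X y) = (\<Sum>\<^sub>\<infinity>m. (c n * c m) *\<^sub>R v (n + m))"
      unfolding infsum_series[of y]
      by (simp add: v_def funpow_add linear_scale[OF bounded_clinear_linear[OF funpow_clinear]])
  qed
  also have "\<dots> = infsum (\<lambda>(n, m). (c n * c m) *\<^sub>R v (n + m)) (UNIV \<times> UNIV)"
    by (rule infsum_Sigma'_banach[OF S])
  also have "\<dots> = infsum (\<lambda>(k, n). (c n * c (k - n)) *\<^sub>R v k) (SIGMA k:UNIV. {..k})"
    by (subst infsum_reindex_bij_betw[OF bij, symmetric]) (auto intro!: infsum_cong)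
  also have "\<dots> = (\<Sum>\<^sub>\<infinity>k. \<Sum>\<^sub>\<infinity>n\<in>{..k}. (c n * c (k - n)) *\<^sub>R v k)"
    by (rule infsum_Sigma'_banach[OF S', symmetric])
  also have "\<dots> = (\<Sum>\<^sub>\<infinity>k. (if k = 0 then 1 else if k = 1 then - 1 else 0) *\<^sub>R v k)"
  proof (intro infsum_cong)
    fix k
    have "(\<Sum>\<^sub>\<infinity>n\<in>{..k}. (c n * c (k - n)) *\<^sub>R v k) = (\<Sum>n\<le>k. c n * c (k - n)) *\<^sub>R v k"
      by (simp add: scaleR_sum_left)
    then show "(\<Sum>\<^sub>\<infinity>n\<in>{..k}. (c n * c (k - n)) *\<^sub>R v k)
        = (if k = 0 then 1 else if k = 1 then - 1 else 0) *\<^sub>R v k"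
      unfolding c_def sqrt_coeff_convolution .
  qed
  also have "\<dots> = infsum (\<lambda>k. (if k = 0 then 1 else if k = 1 then - 1 else 0) *\<^sub>R v k) {0, 1}"
    by (rule infsum_cong_neutral) auto
  also have "\<dots> = y - X y" by (simp add: v_def)
  finally show ?thesis .
qed

end

text \<open>Scaling makes \<open>X = I - T / c\<close> a positive contraction, so
  \<open>sqrt c\<close> times its series squares to \<open>T\<close>. Every other root commutes with
  this one.\<close>

lemma positive_sqrt_unique_exists:
  fixes T :: "'a::chilbert_space \<Rightarrow> 'a"
  assumes T: "positive_op T"
  shows "\<exists>!S. positive_op S \<and> S \<circ> S = T"
proof -
  note L = positive_op_clinear[OF T]
  \<comment> \<open>The added 1 keeps \<open>c\<close> positive when \<open>T = 0\<close>.\<close>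
  define c where "c = onorm T + 1"
  have c: "c > 0" using onorm_nonneg[OF L] by (simp add: c_def)
  define X where "X x = x - (1 / c) *\<^sub>R T x" for x
  have Tc: "inner (T x) x \<le> c * (norm x)\<^sup>2" for x
  proof -
    have "inner (T x) x \<le> norm (T x) * norm x" by (rule norm_cauchy_schwarz)
    also have "\<dots> \<le> (onorm T * norm x) * norm x"
      by (intro mult_right_mono bounded_clinear_norm_le L) auto
    also have "\<dots> \<le> c * (norm x)\<^sup>2"
      by (simp add: c_def power2_eq_square algebra_simps)
    finally show ?thesis .
  qed
  have Xi: "cinner (X x) x = of_real ((norm x)\<^sup>2 - inner (T x) x / c)" for x
    by (simp add: X_def cinner_diff_left scaleR_scaleC cinner_scaleC_left cinner_self
        positive_op_cinner_eq[OF T])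
  have X: "positive_op X"
    unfolding positive_op_def
  proof (intro conjI allI)
    show "bounded_clinear X"
    proof (rule bounded_clinearI[where K = "1 + onorm T / c"])
      show "X (x + y) = X x + X y" for x y
        by (simp add: X_def bounded_clinear_add[OF L] scaleR_add_right)
      show "X (t *\<^sub>C x) = t *\<^sub>C X x" for t x
        by (simp add: X_def bounded_clinear_scaleC[OF L] scaleR_scaleC scaleC_scaleC
            complex_vector.scale_right_diff_distrib mult.commute)
      show "norm (X x) \<le> norm x * (1 + onorm T / c)" for x
      proof -
        have "norm (X x) \<le> norm x + norm (T x) / c"
          using norm_triangle_ineq4[of x "(1 / c) *\<^sub>R T x"] c by (simp add: X_def)
        also have "\<dots> \<le> norm x + onorm T * norm x / c"
          using c by (intro add_left_mono divide_right_mono bounded_clinear_norm_le L) auto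
        finally show ?thesis by (simp add: algebra_simps)
      qed
    qed
    show "cinner (X x) x \<in> \<real>\<^sub>\<ge>\<^sub>0" for x
    proof -
      have "0 \<le> (norm x)\<^sup>2 - inner (T x) x / c" using Tc[of x] c by (simp add: field_simps)
      then show ?thesis unfolding Xi by (simp only: complex_nonneg_Reals_iff Re_complex_of_real Im_complex_of_real)
    qed
  qed
  have contr: "norm (X x) \<le> norm x" for x
  proof (rule positive_op_contraction[OF X])
    show "inner (X x) x \<le> (norm x)\<^sup>2" for x
      using arg_cong[OF Xi[of x], of Re] positive_op_nonneg[OF T, of x] c
      by (simp add: inner_eq_Re_cinner)
  qed
  define S where "S x = sqrt c *\<^sub>R sqrt_series X x" for x
  note SP = sqrt_series_positive[OF X contr]
  have SL: "bounded_clinear S"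
  proof (rule bounded_clinearI[where K = "sqrt c * onorm (sqrt_series X)"])
    note LL = positive_op_clinear[OF SP]
    show "S (x + y) = S x + S y" for x y
      by (simp add: S_def bounded_clinear_add[OF LL] scaleR_add_right)
    show "S (t *\<^sub>C x) = t *\<^sub>C S x" for t x
      by (simp add: S_def bounded_clinear_scaleC[OF LL] scaleR_scaleC scaleC_scaleC mult.commute)
    show "norm (S x) \<le> norm x * (sqrt c * onorm (sqrt_series X))" for x
      using mult_left_mono[OF bounded_clinear_norm_le[OF LL, of x], of "sqrt c"] c
      by (simp add: S_def mult_ac)
  qed
  have S: "positive_op S"
    unfolding positive_op_def
  proof (intro conjI allI SL)
    show "cinner (S x) x \<in> \<real>\<^sub>\<ge>\<^sub>0" for x
      using positive_op_nonneg[OF SP, of x] c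
      by (simp add: S_def scaleR_scaleC cinner_scaleC_left positive_op_cinner_eq[OF SP]
          complex_nonneg_Reals_iff)
  qed
  have SS: "S (S x) = T x" for x
  proof -
    have "S (S x) = c *\<^sub>R sqrt_series X (sqrt_series X x)"
      using c by (simp add: S_def linear_scale[OF bounded_clinear_linear[OF positive_op_clinear[OF SP]]])
    also have "\<dots> = T x" using c by (simp add: sqrt_series_square[OF X contr] X_def)
    finally show ?thesis .
  qed
  show ?thesis
  proof (rule ex1I[of _ S])
    show "positive_op S \<and> S \<circ> S = T" using S SS by auto
  next
    fix R assume "positive_op R \<and> R \<circ> R = T"
    then have R: "positive_op R" and RR: "\<And>x. R (R x) = T x" by (auto simp: fun_eq_iff)
    note RL = positive_op_clinear[OF R]
    have "R (X x) = X (R x)" for x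
      by (simp add: X_def bounded_clinear_diff[OF RL] linear_scale[OF bounded_clinear_linear[OF RL]]
          RR[symmetric])
    then have "R (sqrt_series X x) = sqrt_series X (R x)" for x
      by (intro sqrt_series_commute[OF X contr RL])
    then have comm: "R (S x) = S (R x)" for x
      by (simp add: S_def linear_scale[OF bounded_clinear_linear[OF RL]])
    have "R y = S y" for y
    proof -
      \<comment> \<open>By commutation \<open>(S + R) (R - S) = R^2 - S^2 = 0\<close>, so two
        nonnegative forms at \<open>z\<close> add up to 0 and both operators annihilate
        \<open>z\<close>. By symmetry \<open>z\<close> is then orthogonal to
        \<open>R y - S y\<close>, that is, to itself.\<close>
      define z where "z = R y - S y"
      have z0: "S z + R z = 0"
        by (simp add: z_def bounded_clinear_diff[OF RL] bounded_clinear_diff[OF SL] RR SS comm)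
      then have "cinner (S z) z + cinner (R z) z = 0" by (simp add: cinner_add_left[symmetric])
      then have "inner (S z) z + inner (R z) z = 0"
        by (simp add: inner_eq_Re_cinner complex_eq_iff)
      then have "inner (S z) z = 0" "inner (R z) z = 0"
        using positive_op_nonneg[OF S, of z] positive_op_nonneg[OF R, of z] by auto
      then have "S z = 0" "R z = 0"
        using positive_op_eq_0[OF S, of z] positive_op_cinner_eq[OF S, of z]
          positive_op_eq_0[OF R, of z] positive_op_cinner_eq[OF R, of z] by simp_all
      then have "cinner z z = 0"
        using positive_op_hermitian[OF R, of z y] positive_op_hermitian[OF S, of z y]
        by (simp add: z_def cinner_diff_right cinner_diff_left[symmetric])
      then show ?thesis by (simp add: cinner_self z_def)
    qed
    then show "R = S" by (rule ext)
  qed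
qed

lemma
  fixes T :: "'a::chilbert_space \<Rightarrow> 'a"
  assumes T: "positive_op T"
  shows op_sqrt_positive: "positive_op (op_sqrt T)"
    and op_sqrt_square: "op_sqrt T (op_sqrt T x) = T x"
  using theI'[OF positive_sqrt_unique_exists[OF T]] by (auto simp: op_sqrt_def fun_eq_iff)

lemma norm_op_sqrt:
  fixes T :: "'a::chilbert_space \<Rightarrow> 'a"
  assumes T: "positive_op T"
  shows "(norm (op_sqrt T x))\<^sup>2 = Re (cinner (T x) x)"
  using arg_cong[OF positive_op_hermitian[OF op_sqrt_positive[OF T], of "op_sqrt T x" x], of Re]
  by (simp add: op_sqrt_square[OF T] cinner_self)


section \<open>Operator measures and the integral representation\<close>

context
  fixes \<Sigma> :: "real set \<Rightarrow> 'g::chilbert_space \<Rightarrow> 'g"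
  assumes \<Sigma>: "positive_op_measure \<Sigma>"
begin

lemma op_measure_positive: "B \<in> sets borel \<Longrightarrow> bounded B \<Longrightarrow> positive_op (\<Sigma> B)"
  using \<Sigma> by (simp add: positive_op_measure_def)

lemma op_measure_sums:
  fixes B :: "nat \<Rightarrow> real set"
  shows "range B \<subseteq> sets borel \<Longrightarrow> disjoint_family B \<Longrightarrow> bounded (\<Union>n. B n) \<Longrightarrow>
    (\<lambda>n. \<Sigma> (B n) x) sums \<Sigma> (\<Union>n. B n) x"
  using \<Sigma> unfolding positive_op_measure_def by blast

text \<open>Additivity over a sequence of empty sets gives a constant convergent series.\<close>

lemma op_measure_empty: "\<Sigma> {} x = 0"
proof -
  have "(\<lambda>n::nat. \<Sigma> {} x) sums \<Sigma> (\<Union>n::nat. {}) x"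
    by (rule op_measure_sums) (auto simp: disjoint_family_on_def)
  then have "summable (\<lambda>n::nat. \<Sigma> {} x)" by (rule sums_summable)
  then show ?thesis by (simp add: summable_const_iff)
qed

text \<open>\<open>\<Sigma>\<close> is meaningful on bounded sets only, so measure properties are
  checked on each truncation and then passed to the supremum in
  \<open>scalar_measure\<close>.\<close>

definition truncated_measure :: "'g \<Rightarrow> nat \<Rightarrow> real set \<Rightarrow> ennreal" where
  "truncated_measure x n B = ennreal (Re (cinner (\<Sigma> (B \<inter> {- real n..real n}) x) x))"

lemma truncated_measure_positive: "positive (sets borel) (truncated_measure x n)"
  by (simp add: positive_def truncated_measure_def op_measure_empty)

lemma truncated_measure_countably_additive: "countably_additive (sets borel) (truncated_measure x n)"
proof (rule countably_additiveI)
  fix B :: "nat \<Rightarrow> real set"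
  assume B: "range B \<subseteq> sets borel" "disjoint_family B"
  let ?B = "\<lambda>k. B k \<inter> {- real n..real n}"
  have bdd: "bounded (S \<inter> {- real n..real n})" for S
    by (rule bounded_subset[OF bounded_closed_interval[of "- real n" "real n"]]) auto
  have eq: "(\<Union>k. ?B k) = (\<Union>k. B k) \<inter> {- real n..real n}" by auto
  have "(\<lambda>k. \<Sigma> (?B k) x) sums \<Sigma> (\<Union>k. ?B k) x"
  proof (rule op_measure_sums)
    show "range ?B \<subseteq> sets borel" using B(1) by auto
    show "disjoint_family ?B" using B(2) by (auto simp: disjoint_family_on_def)
    show "bounded (\<Union>k. ?B k)" unfolding eq by (rule bdd)
  qed
  from bounded_linear.sums[OF bounded_linear_Re
      bounded_linear.sums[OF bounded_bilinear.bounded_linear_left[OF bounded_bilinear_cinner] this, of x]]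
  have s: "(\<lambda>k. Re (cinner (\<Sigma> (?B k) x) x)) sums Re (cinner (\<Sigma> ((\<Union>k. B k) \<inter> {- real n..real n}) x) x)"
    unfolding eq .
  have nn: "0 \<le> Re (cinner (\<Sigma> (?B k) x) x)" for k
  proof -
    have "?B k \<in> sets borel" using B(1) by auto
    from positive_op_nonneg[OF op_measure_positive[OF this bdd], of x]
    show ?thesis by (simp add: inner_eq_Re_cinner)
  qed
  show "(\<Sum>k. truncated_measure x n (B k)) = truncated_measure x n (\<Union>k. B k)"
    unfolding truncated_measure_def by (rule suminf_ennreal_eq[OF nn s])
qed

lemma truncated_measure_mono:
  assumes "B \<in> sets borel"
  shows "truncated_measure x n B \<le> truncated_measure x (Suc n) B"
proof -
  have "additive (sets borel) (truncated_measure x (Suc n))"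
    by (rule sets.countably_additive_additive[OF truncated_measure_positive
          truncated_measure_countably_additive])
  then have inc: "increasing (sets borel) (truncated_measure x (Suc n))"
    by (rule sets.additive_increasing[OF truncated_measure_positive])
  have "B \<inter> {- real n..real n} \<inter> {- real (Suc n)..real (Suc n)} = B \<inter> {- real n..real n}" by auto
  then have "truncated_measure x n B = truncated_measure x (Suc n) (B \<inter> {- real n..real n})"
    by (simp only: truncated_measure_def)
  also have "\<dots> \<le> truncated_measure x (Suc n) B"
    using assms by (intro increasingD[OF inc]) auto
  finally show ?thesis .
qed

lemma sets_scalar_measure [measurable_cong, simp]: "sets (scalar_measure \<Sigma> x) = sets borel"
  unfolding scalar_measure_def using sets.sigma_sets_eq[of borel] by (simp add: sets_measure_of_conv)

lemma space_scalar_measure [simp]: "space (scalar_measure \<Sigma> x) = UNIV"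
  by (simp add: scalar_measure_def space_measure_of_conv)

text \<open>\<open>measure_of\<close> falls back to the zero measure unless its set function is a
  measure, so countable additivity must be verified. Monotonicity in \<open>n\<close> lets the
  supremum pass through the series.\<close>

lemma emeasure_scalar_measure:
  assumes "B \<in> sets borel"
  shows "emeasure (scalar_measure \<Sigma> x) B = (SUP n. truncated_measure x n B)"
proof (rule emeasure_measure_of)
  show "scalar_measure \<Sigma> x = measure_of UNIV (sets borel) (\<lambda>B. SUP n. truncated_measure x n B)"
    by (simp add: scalar_measure_def truncated_measure_def)
  show "positive (sets (scalar_measure \<Sigma> x)) (\<lambda>B. SUP n. truncated_measure x n B)"
    using truncated_measure_positive by (simp add: positive_def)
  show "countably_additive (sets (scalar_measure \<Sigma> x)) (\<lambda>B. SUP n. truncated_measure x n B)"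
  proof (rule countably_additiveI)
    fix B :: "nat \<Rightarrow> real set"
    assume B: "range B \<subseteq> sets (scalar_measure \<Sigma> x)" "disjoint_family B"
    then have Bs: "range B \<subseteq> sets borel" by simp
    then have "(\<Sum>k. SUP n. truncated_measure x n (B k)) = (SUP n. \<Sum>k. truncated_measure x n (B k))"
      by (intro ennreal_suminf_SUP_eq incseq_SucI truncated_measure_mono) auto
    also have "\<dots> = (SUP n. truncated_measure x n (\<Union>k. B k))"
    proof (rule SUP_cong[OF refl])
      fix n
      show "(\<Sum>k. truncated_measure x n (B k)) = truncated_measure x n (\<Union>k. B k)"
        using truncated_measure_countably_additive Bs B(2) sets.countable_UN[of B UNIV borel]
        unfolding countably_additive_def by auto
    qed
    finally show "(\<Sum>k. SUP n. truncated_measure x n (B k)) = (SUP n. truncated_measure x n (\<Union>k. B k))" .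
  qed
qed (use assms in auto)

lemma emeasure_scalar_measure_singleton:
  "emeasure (scalar_measure \<Sigma> x) {w} = ennreal (Re (cinner (\<Sigma> {w} x) x))"
proof -
  obtain N where N: "\<bar>w\<bar> \<le> real N" using real_arch_simple by blast
  have le: "truncated_measure x n {w} \<le> ennreal (Re (cinner (\<Sigma> {w} x) x))" for n
  proof (cases "w \<in> {- real n..real n}")
    case True
    then have "{w} \<inter> {- real n..real n} = {w}" by auto
    then show ?thesis by (simp add: truncated_measure_def)
  next
    case False
    then have "{w} \<inter> {- real n..real n} = {}" by auto
    then show ?thesis by (simp add: truncated_measure_def op_measure_empty)
  qed
  have "{w} \<inter> {- real N..real N} = {w}" using N by auto
  then have "truncated_measure x N {w} = ennreal (Re (cinner (\<Sigma> {w} x) x))"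
    by (simp add: truncated_measure_def)
  then have "(SUP n. truncated_measure x n {w}) = ennreal (Re (cinner (\<Sigma> {w} x) x))"
    by (intro antisym SUP_least le) (metis SUP_upper UNIV_I)
  then show ?thesis by (simp add: emeasure_scalar_measure)
qed

lemma measure_scalar_measure_singleton:
  "measure (scalar_measure \<Sigma> x) {w} = Re (cinner (\<Sigma> {w} x) x)"
proof -
  have "0 \<le> inner (\<Sigma> {w} x) x"
    by (rule positive_op_nonneg[OF op_measure_positive]) auto
  then show ?thesis
    by (simp add: measure_def emeasure_scalar_measure_singleton inner_eq_Re_cinner)
qed

end

section \<open>The integrand of the representation: bounds and imaginary parts\<close>

definition nevanlinna_integrand :: "complex \<Rightarrow> real \<Rightarrow> complex" where
  "nevanlinna_integrand z t = 1 / (of_real t - z) - of_real t / (1 + (of_real t)\<^sup>2)"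

lemma of_real_minus_nonreal: "Im z \<noteq> 0 \<Longrightarrow> complex_of_real t - z \<noteq> 0"
  by (auto simp: complex_eq_iff)

lemma one_plus_of_real_square: "1 + (complex_of_real t)\<^sup>2 = of_real (1 + t\<^sup>2)"
  by simp

lemma nevanlinna_integrand_bound:
  assumes z: "Im z \<noteq> 0"
  shows "cmod (nevanlinna_integrand z t) \<le> (cmod z + (1 + (cmod z)\<^sup>2) / \<bar>Im z\<bar>) * (1 / (1 + t\<^sup>2))"
proof -
  have p: "1 + t\<^sup>2 > 0" by (simp add: add_pos_nonneg)
  then have p': "1 + (complex_of_real t)\<^sup>2 \<noteq> 0"
    unfolding one_plus_of_real_square of_real_eq_0_iff by simp
  note nz = of_real_minus_nonreal[OF z, of t]
  \<comment> \<open>Splitting off \<open>1 / (1 + t^2)\<close> leaves a factor bounded in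
    \<open>t\<close>, since \<open>t - z\<close> has modulus at least
    \<open>\<bar>Im z\<bar>\<close>.\<close>
  have "nevanlinna_integrand z t = (z + (1 + z\<^sup>2) / (of_real t - z)) / (1 + (of_real t)\<^sup>2)"
    unfolding nevanlinna_integrand_def using p' nz by (simp add: field_simps power2_eq_square)
  also have "cmod \<dots> = cmod (z + (1 + z\<^sup>2) / (of_real t - z)) * (1 / (1 + t\<^sup>2))"
    unfolding one_plus_of_real_square norm_divide norm_of_real using p by simp
  also have "\<dots> \<le> (cmod z + (1 + (cmod z)\<^sup>2) / \<bar>Im z\<bar>) * (1 / (1 + t\<^sup>2))"
  proof (rule mult_right_mono)
    have "cmod ((1 + z\<^sup>2) / (of_real t - z)) \<le> (1 + (cmod z)\<^sup>2) / \<bar>Im z\<bar>"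
      unfolding norm_divide
    proof (rule frac_le)
      show "cmod (1 + z\<^sup>2) \<le> 1 + (cmod z)\<^sup>2"
        using norm_triangle_ineq[of 1 "z\<^sup>2"] by (simp add: norm_power)
      show "\<bar>Im z\<bar> \<le> cmod (of_real t - z)" using abs_Im_le_cmod[of "of_real t - z"] by simp
    qed (use z in auto)
    then show "cmod (z + (1 + z\<^sup>2) / (of_real t - z)) \<le> cmod z + (1 + (cmod z)\<^sup>2) / \<bar>Im z\<bar>"
      using norm_triangle_ineq[of z "(1 + z\<^sup>2) / (of_real t - z)"] by linarith
  qed (use p in auto)
  finally show ?thesis .
qed

lemma Im_nevanlinna_integrand:
  "Im (nevanlinna_integrand (Complex w s) t) = s * (1 / ((t - w)\<^sup>2 + s\<^sup>2))"
proof -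
  have "Im (complex_of_real t / (1 + (of_real t)\<^sup>2)) = 0"
    unfolding one_plus_of_real_square of_real_divide[symmetric] by (rule Im_complex_of_real)
  moreover have "Im (1 / (complex_of_real t - Complex w s)) = s * (1 / ((t - w)\<^sup>2 + s\<^sup>2))"
    by (simp add: Im_divide)
  ultimately show ?thesis by (simp add: nevanlinna_integrand_def)
qed

lemma nevanlinna_integrand_cnj: "nevanlinna_integrand (cnj z) t = cnj (nevanlinna_integrand z t)"
  by (simp add: nevanlinna_integrand_def)

context
  fixes Q :: "complex \<Rightarrow> 'g::chilbert_space \<Rightarrow> 'g" and C D \<Sigma>
  assumes rep: "integral_representation Q C D \<Sigma>"
begin

lemma rep_measure: "positive_op_measure \<Sigma>"
  using rep by (simp add: integral_representation_def)

lemma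
  assumes z: "Im z \<noteq> 0"
  shows rep_bounded_clinear: "bounded_clinear (Q z)"
    and rep_integrable: "integrable (scalar_measure \<Sigma> x) (nevanlinna_integrand z)"
    and rep_cinner: "cinner (Q z x) x
      = cinner (C x) x + z * cinner (D x) x + (\<integral>t. nevanlinna_integrand z t \<partial>scalar_measure \<Sigma> x)"
proof -
  have "z \<notin> \<real>" using z by (simp add: complex_is_Real_iff)
  then obtain J where J: "has_op_integral \<Sigma> (nevanlinna_integrand z) J"
      and Q: "\<And>x. Q z x = C x + z *\<^sub>C D x + J x"
    using rep unfolding integral_representation_def nevanlinna_integrand_def by blast
  have CD: "bounded_clinear C" "bounded_clinear D"
    using rep by (auto simp: integral_representation_def positive_op_def)
  have JL: "bounded_clinear J" using J by (simp add: has_op_integral_def)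
  show "integrable (scalar_measure \<Sigma> x) (nevanlinna_integrand z)"
    using J by (auto simp: has_op_integral_def)
  show "cinner (Q z x) x
      = cinner (C x) x + z * cinner (D x) x + (\<integral>t. nevanlinna_integrand z t \<partial>scalar_measure \<Sigma> x)"
    using J by (simp add: Q cinner_simps has_op_integral_def)
  show "bounded_clinear (Q z)"
  proof (rule bounded_clinearI)
    show "Q z (x + y) = Q z x + Q z y" for x y
      by (simp add: Q bounded_clinear_add[OF CD(1)] bounded_clinear_add[OF CD(2)]
          bounded_clinear_add[OF JL] scaleC_add_right algebra_simps)
    show "Q z (c *\<^sub>C x) = c *\<^sub>C Q z x" for c x
      by (simp add: Q bounded_clinear_scaleC[OF CD(1)] bounded_clinear_scaleC[OF CD(2)]
          bounded_clinear_scaleC[OF JL] scaleC_add_right scaleC_scaleC mult.commute)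
    show "norm (Q z x) \<le> norm x * (onorm C + cmod z * onorm D + onorm J)" for x
    proof -
      have "norm (Q z x) \<le> norm (C x) + cmod z * norm (D x) + norm (J x)"
        unfolding Q using norm_triangle_ineq[of "C x + z *\<^sub>C D x" "J x"]
          norm_triangle_ineq[of "C x" "z *\<^sub>C D x"] by simp
      also have "\<dots> \<le> onorm C * norm x + cmod z * (onorm D * norm x) + onorm J * norm x"
        by (intro add_mono mult_left_mono bounded_clinear_norm_le CD JL) auto
      finally show ?thesis by (simp add: algebra_simps)
    qed
  qed
qed

text \<open>The measure may have infinite mass; integrability is inherited from the imaginary part
  of the integrand at \<open>Complex w s\<close>.\<close>

lemma Poisson_integrable:
  assumes s: "s \<noteq> 0"
  shows "integrable (scalar_measure \<Sigma> x) (\<lambda>t. 1 / ((t - w)\<^sup>2 + s\<^sup>2))"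
proof -
  have "integrable (scalar_measure \<Sigma> x) (\<lambda>t. (1 / s) * Im (nevanlinna_integrand (Complex w s) t))"
    using rep_integrable[of "Complex w s" x] s by simp
  then show ?thesis using s by (simp add: Im_nevanlinna_integrand)
qed

text \<open>\<open>D\<close> has a real form and contributes through \<open>z\<close> only.
  \<open>C\<close> is just bounded, so its imaginary part stays until
  \<open>nevanlinna_constant_symmetric\<close> removes it.\<close>

lemma rep_Im:
  assumes s: "s \<noteq> 0"
  shows "Im (cinner (Q (Complex w s) x) x) = Im (cinner (C x) x)
    + s * (Re (cinner (D x) x) + (\<integral>t. 1 / ((t - w)\<^sup>2 + s\<^sup>2) \<partial>scalar_measure \<Sigma> x))"
proof -
  have D: "positive_op D" using rep by (simp add: integral_representation_def)
  have i: "integrable (scalar_measure \<Sigma> x) (nevanlinna_integrand (Complex w s))"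
    using s by (intro rep_integrable) simp
  have "Im (\<integral>t. nevanlinna_integrand (Complex w s) t \<partial>scalar_measure \<Sigma> x)
      = (\<integral>t. s * (1 / ((t - w)\<^sup>2 + s\<^sup>2)) \<partial>scalar_measure \<Sigma> x)"
    using integral_Im[OF i] unfolding Im_nevanlinna_integrand by simp
  also have "\<dots> = s * (\<integral>t. 1 / ((t - w)\<^sup>2 + s\<^sup>2) \<partial>scalar_measure \<Sigma> x)"
    by (rule integral_mult_right_zero)
  finally show ?thesis
    using s positive_op_Im[OF D, of x] by (simp add: rep_cinner algebra_simps)
qed

text \<open>At a pole of the norm meromorphic function \<open>Q\<close> the values \<open>(Q \<lambda> x, x)\<close> would be unbounded
  for some \<open>x\<close>, while the integral representation bounds them locally.\<close>

lemma rep_locally_bounded: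
  assumes z: "Im z \<noteq> 0"
  obtains K where "\<forall>\<^sub>F w in nhds z. Im w \<noteq> 0 \<and> cmod (cinner (Q w x) x) \<le> K"
proof -
  define k where "k w = cmod w + (1 + (cmod w)\<^sup>2) / \<bar>Im w\<bar>" for w
  have int: "integrable (scalar_measure \<Sigma> x) (\<lambda>t. 1 / (1 + t\<^sup>2))"
    using Poisson_integrable[of 1 x 0] by (simp add: add.commute)
  define I where "I = (\<integral>t. 1 / (1 + t\<^sup>2) \<partial>scalar_measure \<Sigma> x)"
  define b where "b w = cmod (cinner (C x) x) + cmod w * cmod (cinner (D x) x) + k w * I" for w
  have le: "cmod (cinner (Q w x) x) \<le> b w" if w: "Im w \<noteq> 0" for w
  proof -
    have "cmod (\<integral>t. nevanlinna_integrand w t \<partial>scalar_measure \<Sigma> x)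
        \<le> (\<integral>t. k w * (1 / (1 + t\<^sup>2)) \<partial>scalar_measure \<Sigma> x)"
      by (rule Bochner_Integration.integral_norm_bound_integral)
        (use rep_integrable[OF w, of x] integrable_mult_right[OF int, of "k w"]
          nevanlinna_integrand_bound[OF w, folded k_def] in auto)
    also have "\<dots> = k w * I" unfolding I_def by (rule integral_mult_right_zero)
    finally have 1: "cmod (\<integral>t. nevanlinna_integrand w t \<partial>scalar_measure \<Sigma> x) \<le> k w * I" .
    have "cmod (cinner (Q w x) x) \<le> cmod (cinner (C x) x) + cmod (w * cinner (D x) x)
        + cmod (\<integral>t. nevanlinna_integrand w t \<partial>scalar_measure \<Sigma> x)"
      unfolding rep_cinner[OF w] by (rule norm_triangle_le, rule add_right_mono, rule norm_triangle_ineq)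
    with 1 show ?thesis by (simp add: b_def norm_mult)
  qed
  have Im: "((\<lambda>w. \<bar>Im w\<bar>) \<longlongrightarrow> \<bar>Im z\<bar>) (nhds z)" by (intro tendsto_intros filterlim_ident)
  have "(b \<longlongrightarrow> b z) (nhds z)"
    unfolding b_def k_def using z by (intro tendsto_intros filterlim_ident) auto
  then have "\<forall>\<^sub>F w in nhds z. b w < b z + 1" by (rule order_tendstoD) simp
  moreover have "\<forall>\<^sub>F w in nhds z. 0 < \<bar>Im w\<bar>" using z by (intro order_tendstoD(1)[OF Im]) simp
  ultimately have "\<forall>\<^sub>F w in nhds z. Im w \<noteq> 0 \<and> cmod (cinner (Q w x) x) \<le> b z + 1"
  proof eventually_elim
    case (elim w)
    then have "Im w \<noteq> 0" by simp
    with le[OF this] elim show ?case by simp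
  qed
  then show thesis by (rule that)
qed

end

section \<open>Holomorphy at all nonreal points and symmetry of the constant\<close>

lemma eventually_nhds_imp_at_neq: "eventually P (nhds z) \<Longrightarrow> eventually P (at z)"
  by (simp add: eventually_at_filter eventually_mono)

lemma op_differentiable_tendsto:
  assumes diff: "op_differentiable_at F z"
    and ev: "\<forall>\<^sub>F w in nhds z. bounded_clinear (F w)"
  shows "((\<lambda>w. F w x) \<longlongrightarrow> F z x) (at z)"
proof -
  obtain F' where F': "bounded_clinear F'"
    and lim: "((\<lambda>w. onorm (\<lambda>x. (1 / (w - z)) *\<^sub>C (F w x - F z x) - F' x)) \<longlongrightarrow> 0) (at z)"
    using diff by (auto simp: op_differentiable_at_def)
  \<comment> \<open>The remainder of the difference quotient:
    \<open>F w = F z + (w - z) (E w + F')\<close>, with \<open>E w\<close> tending to 0 in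
    norm.\<close>
  define E where "E w = (\<lambda>x. (1 / (w - z)) *\<^sub>C (F w x - F z x) - F' x)" for w
  have Fz: "bounded_clinear (F z)" using ev by (rule eventually_nhds_x_imp_x)
  have "\<forall>\<^sub>F w in at z. norm (E w x) \<le> onorm (E w) * norm x"
    using eventually_nhds_imp_at_neq[OF ev]
  proof (rule eventually_mono)
    show "bounded_clinear (F w) \<Longrightarrow> norm (E w x) \<le> onorm (E w) * norm x" for w
    proof (rule onorm)
      assume Fw: "bounded_clinear (F w)"
      have "bounded_linear (\<lambda>x. F w x - F z x)"
        using Fw Fz by (auto simp: bounded_clinear_def intro: bounded_linear_sub)
      from bounded_linear_compose[OF bounded_bilinear.bounded_linear_right[OF bounded_bilinear_scaleC] this]
      show "bounded_linear (E w)"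
        unfolding E_def using F' by (intro bounded_linear_sub) (auto simp: bounded_clinear_def)
    qed
  qed
  moreover have "((\<lambda>w. onorm (E w) * norm x) \<longlongrightarrow> 0 * norm x) (at z)"
    using lim unfolding E_def by (intro tendsto_intros)
  ultimately have E0: "((\<lambda>w. E w x) \<longlongrightarrow> 0) (at z)"
    by (intro Lim_null_comparison[of "\<lambda>w. E w x" "\<lambda>w. onorm (E w) * norm x"]) auto
  have "((\<lambda>w. F z x + (w - z) *\<^sub>C (E w x + F' x)) \<longlongrightarrow> F z x + (z - z) *\<^sub>C (0 + F' x)) (at z)"
    by (intro tendsto_add tendsto_scaleC tendsto_diff tendsto_const E0 tendsto_ident_at)
  moreover have "\<forall>\<^sub>F w in at z. F z x + (w - z) *\<^sub>C (E w x + F' x) = F w x"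
    unfolding eventually_at_filter by (simp add: E_def scaleC_scaleC scaleC_one)
  ultimately show ?thesis using Lim_transform_eventually by fastforce
qed

text \<open>Makes the realisation formula available on the whole vertical line. At a pole the
  nonzero leading operator \<open>F z\<close> would have vanishing quadratic form, because
  \<open>(w - z)^n\<close> beats the local bound on the form of \<open>Q\<close>.\<close>

lemma nevanlinna_nonreal_hol_domain:
  fixes Q :: "complex \<Rightarrow> 'g::chilbert_space \<Rightarrow> 'g"
  assumes Q: "Q \<in> \<N>\<^sub>0" and rep: "integral_representation Q C D \<Sigma>" and z: "Im z \<noteq> 0"
  shows "z \<in> hol_domain Q"
proof -
  have zR: "z \<notin> \<real>" using z by (simp add: complex_is_Real_iff)
  have "op_holomorphic_at Q z"
  proof (rule ccontr)
    assume "\<not> op_holomorphic_at Q z"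
    then obtain F n where n: "n > 0" and F: "op_holomorphic_at F z" and "\<exists>x. F z x \<noteq> 0"
      and FQ: "\<forall>\<^sub>F w in at z. \<forall>x. F w x = (w - z) ^ n *\<^sub>C Q w x"
      using Q zR unfolding nevanlinna_def op_meromorphic_on_def by blast
    have diff: "op_differentiable_at F z" and Fz: "bounded_clinear (F z)"
      using eventually_nhds_x_imp_x[OF F[unfolded op_holomorphic_at_def]] by auto
    have evF: "\<forall>\<^sub>F w in nhds z. bounded_clinear (F w)"
      using F unfolding op_holomorphic_at_def by (rule eventually_mono) simp
    have zero: "cinner (F z x) x = 0" for x
    proof -
      obtain K where K: "\<forall>\<^sub>F w in nhds z. Im w \<noteq> 0 \<and> cmod (cinner (Q w x) x) \<le> K"
        using rep_locally_bounded[OF rep z] by blast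
      have "\<forall>\<^sub>F w in at z. norm (cinner (F w x) x) \<le> cmod (w - z) ^ n * K"
        using FQ eventually_nhds_imp_at_neq[OF K]
      proof eventually_elim
        case (elim w)
        then show ?case by (simp add: cinner_scaleC_left norm_mult norm_power mult_left_mono)
      qed
      moreover have "((\<lambda>w. cmod (w - z) ^ n * K) \<longlongrightarrow> 0) (at z)"
      proof -
        have "((\<lambda>w. cmod (w - z) ^ n * K) \<longlongrightarrow> cmod (z - z) ^ n * K) (at z)"
          by (intro tendsto_intros)
        then show ?thesis using n by (simp add: power_0_left)
      qed
      ultimately have "((\<lambda>w. cinner (F w x) x) \<longlongrightarrow> 0) (at z)"
        by (rule Lim_null_comparison)
      moreover have "((\<lambda>w. cinner (F w x) x) \<longlongrightarrow> cinner (F z x) x) (at z)"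
        by (intro tendsto_cinner tendsto_const op_differentiable_tendsto diff evF)
      ultimately show ?thesis using tendsto_unique[OF at_neq_bot] by blast
    qed
    \<comment> \<open>A vanishing form is a nonnegative one, so the result on zeros of positive
      forms yields \<open>F z = 0\<close>.\<close>
    then have "positive_op (F z)" using Fz by (simp add: positive_op_def)
    from positive_op_eq_0[OF this zero] \<open>\<exists>x. F z x \<noteq> 0\<close> show False by simp
  qed
  with zR show ?thesis by (simp add: hol_domain_def)
qed

text \<open>Compare \<open>Q \<i>\<close> with the adjoint of \<open>Q (cnj \<i>)\<close>: the
  integrals agree because the integrand respects conjugation, the terms with \<open>D\<close> have
  equal imaginary parts, and only \<open>C\<close> against its conjugate remains.\<close>

lemma nevanlinna_constant_symmetric:
  fixes Q :: "complex \<Rightarrow> 'g::chilbert_space \<Rightarrow> 'g"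
  assumes Q: "Q \<in> \<N>\<^sub>0" and rep: "integral_representation Q C D \<Sigma>"
  shows "Im (cinner (C x) x) = 0"
proof -
  have i: "\<i> \<in> hol_domain Q - \<real>"
    using nevanlinna_nonreal_hol_domain[OF assms, of \<i>] by (simp add: complex_is_Real_iff)
  then have "cadjoint (Q \<i>) = Q (cnj \<i>)" using Q by (simp add: nevanlinna_def)
  then have "cinner (Q \<i> x) x = cinner x (Q (cnj \<i>) x)"
    using cadjoint_works[OF rep_bounded_clinear[OF rep, of \<i>], of x x] by simp
  also have "\<dots> = cnj (cinner (Q (cnj \<i>) x) x)" by (rule cinner_commute)
  finally have eq: "cinner (Q \<i> x) x = cnj (cinner (Q (cnj \<i>) x) x)" .
  have "nevanlinna_integrand (cnj \<i>) = (\<lambda>t. cnj (nevanlinna_integrand \<i> t))"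
    by (rule ext) (rule nevanlinna_integrand_cnj)
  then have "cinner (Q (cnj \<i>) x) x = cinner (C x) x + cnj \<i> * cinner (D x) x
      + cnj (\<integral>t. nevanlinna_integrand \<i> t \<partial>scalar_measure \<Sigma> x)"
    using rep_cinner[OF rep, of "cnj \<i>" x] by (simp only: integral_cnj) simp
  then have "cinner (C x) x + \<i> * cinner (D x) x = cnj (cinner (C x) x + (cnj \<i>) * cinner (D x) x)"
    using eq rep_cinner[OF rep, of \<i> x] by simp
  from arg_cong[OF this, of Im] show ?thesis by simp
qed

section \<open>Poisson integrals at a real point: boundedness and atoms\<close>

context
  fixes Q :: "complex \<Rightarrow> 'g::chilbert_space \<Rightarrow> 'g" and C D \<Sigma>
  assumes rep: "integral_representation Q C D \<Sigma>"
begin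

lemma Poisson_integral_bounded:
  assumes f: "f \<in> value_domain \<Sigma> w"
  obtains K where "\<And>s. s \<noteq> 0 \<Longrightarrow> (\<integral>t. 1 / ((t - w)\<^sup>2 + s\<^sup>2) \<partial>scalar_measure \<Sigma> f) \<le> K"
proof -
  define N where "N = (\<integral>\<^sup>+ t. 1 / ennreal ((t - w)\<^sup>2) \<partial>scalar_measure \<Sigma> f)"
  have N: "N < \<infinity>" using f by (simp add: value_domain_def N_def)
  have "(\<integral>t. 1 / ((t - w)\<^sup>2 + s\<^sup>2) \<partial>scalar_measure \<Sigma> f) \<le> enn2real N" if s: "s \<noteq> 0" for s
  proof -
    have "ennreal (\<integral>t. 1 / ((t - w)\<^sup>2 + s\<^sup>2) \<partial>scalar_measure \<Sigma> f)
        = (\<integral>\<^sup>+ t. ennreal (1 / ((t - w)\<^sup>2 + s\<^sup>2)) \<partial>scalar_measure \<Sigma> f)"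
      by (rule nn_integral_eq_integral[symmetric, OF Poisson_integrable[OF rep s]]) auto
    also have "\<dots> \<le> N"
      unfolding N_def
    proof (rule nn_integral_mono)
      fix t
      show "ennreal (1 / ((t - w)\<^sup>2 + s\<^sup>2)) \<le> 1 / ennreal ((t - w)\<^sup>2)"
      \<comment> \<open>At \<open>t = w\<close> the right-hand side is infinite in
        \<open>ennreal\<close>, so the domination has no exceptional point.\<close>
      proof (cases "t = w")
        case False
        then have "ennreal (1 / ((t - w)\<^sup>2 + s\<^sup>2)) \<le> ennreal (1 / (t - w)\<^sup>2)"
          by (intro ennreal_leI divide_left_mono) (auto intro!: mult_pos_pos add_pos_nonneg)
        also have "\<dots> = 1 / ennreal ((t - w)\<^sup>2)"
          using False divide_ennreal[of 1 "(t - w)\<^sup>2"] by simp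
        finally show ?thesis .
      qed simp
    qed
    finally have "enn2real (ennreal (\<integral>t. 1 / ((t - w)\<^sup>2 + s\<^sup>2) \<partial>scalar_measure \<Sigma> f)) \<le> enn2real N"
      using N by (intro enn2real_mono) auto
    then show ?thesis by (simp add: integral_nonneg_AE)
  qed
  then show thesis by (rule that)
qed

text \<open>Fatou's lemma along \<open>s = 1 / (n + 1)\<close>. At \<open>t = w\<close> the kernels
  tend to infinity, in agreement with the \<open>ennreal\<close> integrand, so boundedness also
  excludes an atom at \<open>w\<close>.\<close>

lemma value_domain_if_bounded:
  assumes bound: "\<And>n. (\<integral>t. 1 / ((t - w)\<^sup>2 + (1 / real (Suc n))\<^sup>2) \<partial>scalar_measure \<Sigma> f) \<le> K"
  shows "f \<in> value_domain \<Sigma> w"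
proof -
  let ?M = "scalar_measure \<Sigma> f"
  define p where "p n t = 1 / ((t - w)\<^sup>2 + (1 / real (Suc n))\<^sup>2)" for n t
  have pn: "(\<integral>\<^sup>+ t. ennreal (p n t) \<partial>?M) \<le> ennreal K" for n
  proof -
    have "(\<integral>\<^sup>+ t. ennreal (p n t) \<partial>?M) = ennreal (\<integral>t. p n t \<partial>?M)"
      unfolding p_def by (rule nn_integral_eq_integral[OF Poisson_integrable[OF rep]]) auto
    also have "\<dots> \<le> ennreal K" using bound[of n] by (intro ennreal_leI) (simp add: p_def)
    finally show ?thesis .
  qed
  have inv: "(\<lambda>n. 1 / real (Suc n)) \<longlonglongrightarrow> 0"
    using LIMSEQ_inverse_real_of_nat by (simp add: inverse_eq_divide)
  have "(\<lambda>n. ennreal (p n t)) \<longlonglongrightarrow> 1 / ennreal ((t - w)\<^sup>2)" for t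
  proof (cases "t = w")
    case True
    have "filterlim (\<lambda>n. (real (Suc n))\<^sup>2) at_top sequentially"
      by (rule filterlim_pow_at_top[OF _ filterlim_compose[OF filterlim_real_sequentially filterlim_Suc]]) simp
    then have "(\<lambda>n. ennreal ((real (Suc n))\<^sup>2)) \<longlonglongrightarrow> Orderings.top" by (simp only: ennreal_tendsto_top_eq_at_top)
    then show ?thesis using True by (simp add: p_def power_one_over)
  next
    case False
    have "(\<lambda>n. p n t) \<longlonglongrightarrow> 1 / ((t - w)\<^sup>2 + 0\<^sup>2)"
      unfolding p_def using False by (intro tendsto_intros inv) auto
    then have "(\<lambda>n. ennreal (p n t)) \<longlonglongrightarrow> ennreal (1 / (t - w)\<^sup>2)"
      by (intro tendsto_ennrealI) simp
    then show ?thesis using False divide_ennreal[of 1 "(t - w)\<^sup>2"] by simp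
  qed
  then have lim: "liminf (\<lambda>n. ennreal (p n t)) = 1 / ennreal ((t - w)\<^sup>2)" for t
    by (intro lim_imp_Liminf) auto
  have "(\<integral>\<^sup>+ t. 1 / ennreal ((t - w)\<^sup>2) \<partial>?M) = (\<integral>\<^sup>+ t. liminf (\<lambda>n. ennreal (p n t)) \<partial>?M)"
    by (simp add: lim)
  also have "\<dots> \<le> liminf (\<lambda>n. \<integral>\<^sup>+ t. ennreal (p n t) \<partial>?M)"
    by (rule nn_integral_liminf) (simp add: p_def measurable_cong_sets[OF sets_scalar_measure[OF rep_measure[OF rep]] refl])
  also have "\<dots> \<le> ennreal K"
    by (rule Liminf_le) (simp, rule eventuallyI, rule pn)
  also have "\<dots> < \<infinity>" by simp
  finally show ?thesis by (simp add: value_domain_def)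
qed

text \<open>Dominated convergence: \<open>s^2 / ((t - w)^2 + s^2)\<close> tends to the indicator of
  \<open>{w}\<close>, and for \<open>0 < s \<le> 1\<close> it lies below its value at
  \<open>s = 1\<close>.\<close>

lemma Poisson_integral_atom:
  "(\<lambda>n. (1 / real (Suc n))\<^sup>2 * (\<integral>t. 1 / ((t - w)\<^sup>2 + (1 / real (Suc n))\<^sup>2) \<partial>scalar_measure \<Sigma> f))
    \<longlonglongrightarrow> Re (cinner (\<Sigma> {w} f) f)"
proof -
  let ?M = "scalar_measure \<Sigma> f"
  define s where "s n = 1 / real (Suc n)" for n
  have s: "0 < s n" "s n \<le> 1" for n by (auto simp: s_def)
  have meas: "g \<in> borel_measurable borel \<Longrightarrow> g \<in> borel_measurable ?M" for g :: "real \<Rightarrow> real"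
    by (simp add: measurable_cong_sets[OF sets_scalar_measure[OF rep_measure[OF rep]] refl])
  have inv: "s \<longlonglongrightarrow> 0" unfolding s_def
    using LIMSEQ_inverse_real_of_nat by (simp add: inverse_eq_divide)
  have "(\<lambda>n. \<integral>t. (s n)\<^sup>2 * (1 / ((t - w)\<^sup>2 + (s n)\<^sup>2)) \<partial>?M) \<longlonglongrightarrow> (\<integral>t. indicator {w} t \<partial>?M)"
  proof (rule integral_dominated_convergence[where w = "\<lambda>t. 1 / ((t - w)\<^sup>2 + 1\<^sup>2)"])
    show "integrable ?M (\<lambda>t. 1 / ((t - w)\<^sup>2 + 1\<^sup>2))" by (rule Poisson_integrable[OF rep]) simp
    show "AE t in ?M. (\<lambda>n. (s n)\<^sup>2 * (1 / ((t - w)\<^sup>2 + (s n)\<^sup>2))) \<longlonglongrightarrow> indicator {w} t"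
    proof (rule AE_I2)
      fix t
      show "(\<lambda>n. (s n)\<^sup>2 * (1 / ((t - w)\<^sup>2 + (s n)\<^sup>2))) \<longlonglongrightarrow> indicator {w} t"
      proof (cases "t = w")
        case True
        have "s n \<noteq> 0" for n using s(1)[of n] by simp
        then show ?thesis using True by simp
      next
        case False
        have "(\<lambda>n. (s n)\<^sup>2 * (1 / ((t - w)\<^sup>2 + (s n)\<^sup>2))) \<longlonglongrightarrow> 0\<^sup>2 * (1 / ((t - w)\<^sup>2 + 0\<^sup>2))"
          using False by (intro tendsto_intros inv) auto
        then show ?thesis using False by simp
      qed
    qed
    show "AE t in ?M. norm ((s n)\<^sup>2 * (1 / ((t - w)\<^sup>2 + (s n)\<^sup>2))) \<le> 1 / ((t - w)\<^sup>2 + 1\<^sup>2)" for n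
    proof (rule AE_I2)
      fix t
      have p: "0 < (t - w)\<^sup>2 + (s n)\<^sup>2" using s(1)[of n] by (simp add: add_nonneg_pos)
      have q: "0 < (t - w)\<^sup>2 + 1" by (simp add: add_nonneg_pos)
      have "(s n)\<^sup>2 \<le> 1" using s[of n] by (simp add: power_le_one)
      then have "(s n)\<^sup>2 * (t - w)\<^sup>2 \<le> 1 * (t - w)\<^sup>2" by (intro mult_right_mono) auto
      then have "(s n)\<^sup>2 * ((t - w)\<^sup>2 + 1) \<le> 1 * ((t - w)\<^sup>2 + (s n)\<^sup>2)" by (simp add: algebra_simps)
      then have "(s n)\<^sup>2 / ((t - w)\<^sup>2 + (s n)\<^sup>2) \<le> 1 / ((t - w)\<^sup>2 + 1)"
        by (simp only: pos_divide_le_eq[OF p] times_divide_eq_left mult_1_left pos_le_divide_eq[OF q])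
      then show "norm ((s n)\<^sup>2 * (1 / ((t - w)\<^sup>2 + (s n)\<^sup>2))) \<le> 1 / ((t - w)\<^sup>2 + 1\<^sup>2)"
        using p by (simp add: abs_mult)
    qed
  qed (auto intro!: meas)
  also have "(\<integral>t. indicator {w} t \<partial>?M) = Re (cinner (\<Sigma> {w} f) f)"
    using measure_scalar_measure_singleton[OF rep_measure[OF rep]]
    by (simp add: space_scalar_measure[OF rep_measure[OF rep]])
  finally show ?thesis by (simp only: s_def integral_mult_right_zero)
qed

end


section \<open>The generalised value at a real point\<close>

text \<open>With \<open>l - w = r cis \<phi>\<close> the ratio in question is
  \<open>1 / sin \<phi>\<close>, and \<open>sin \<phi> \<ge> sin \<theta>\<close> in the sector.
  This supplies the constant \<open>M\<close> of the resolvent limits.\<close>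

lemma stolz_sector_bound:
  assumes \<theta>: "\<theta> \<in> {0<..<pi / 2}" and l: "l \<in> stolz_sector w \<theta>"
  shows "Im l \<noteq> 0 \<and> cmod (of_real w - l) \<le> (1 / sin \<theta>) * \<bar>Im l\<bar>"
proof -
  obtain r \<phi> where r: "r > 0" "\<bar>\<phi> - pi / 2\<bar> \<le> pi / 2 - \<theta>" and l_eq: "l = of_real w + of_real r * cis \<phi>"
    using l by (auto simp: stolz_sector_def)
  have "sin \<theta> = cos (pi / 2 - \<theta>)" by (simp add: cos_diff)
  also have "\<dots> \<le> cos \<bar>\<phi> - pi / 2\<bar>"
    using \<theta> r(2) by (intro cos_monotone_0_pi_le) auto
  also have "\<dots> = sin \<phi>" by (simp add: cos_diff)
  finally have sin: "sin \<theta> \<le> sin \<phi>" .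
  have pos: "0 < sin \<theta>" using \<theta> by (intro sin_gt_zero) auto
  have Im: "Im l = r * sin \<phi>" by (simp add: l_eq)
  have "cmod (of_real w - l) = r" using r(1) by (simp add: l_eq norm_mult)
  moreover have "r * sin \<theta> \<le> r * sin \<phi>" using r(1) sin by simp
  moreover have "Im l > 0" using r(1) sin pos by (simp add: Im)
  ultimately show ?thesis using pos r(1) by (auto simp: Im field_simps)
qed

text \<open>The vertical ray lies in every sector, so limits within a sector are unique.\<close>

lemma stolz_sector_limit_point: "\<theta> \<le> pi / 2 \<Longrightarrow> complex_of_real w islimpt stolz_sector w \<theta>"
  unfolding islimpt_approachable
proof (intro allI impI)
  fix e :: real assume \<theta>: "\<theta> \<le> pi / 2" and e: "e > 0"
  define l where "l = of_real w + of_real (e / 2) * cis (pi / 2)"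
  have "l \<in> stolz_sector w \<theta>"
    unfolding stolz_sector_def l_def
    by (intro CollectI exI[of _ "e / 2"] exI[of _ "pi / 2"]) (use e \<theta> in auto)
  moreover have "l \<noteq> of_real w" "dist l (of_real w) < e"
    using e by (auto simp: l_def dist_norm norm_mult)
  ultimately show "\<exists>l\<in>stolz_sector w \<theta>. l \<noteq> of_real w \<and> dist l (of_real w) < e" by blast
qed

lemma has_nontangential_limit_unique:
  fixes l :: "'a::t2_space"
  assumes "has_nontangential_limit f w l" "has_nontangential_limit f w l'"
  shows "l = l'"
proof -
  have "pi / 4 \<in> {0<..<pi / 2}" by auto
  then have "(f \<longlongrightarrow> l) (at (of_real w) within stolz_sector w (pi / 4))"
    "(f \<longlongrightarrow> l') (at (of_real w) within stolz_sector w (pi / 4))"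
    using assms unfolding has_nontangential_limit_def by blast+
  moreover have "at (complex_of_real w) within stolz_sector w (pi / 4) \<noteq> bot"
    using stolz_sector_limit_point[of "pi / 4" w] by (simp add: trivial_limit_within)
  ultimately show ?thesis using tendsto_unique by blast
qed

section \<open>Comparing the realisation with the integral representation\<close>

context
  fixes Q :: "complex \<Rightarrow> 'g::chilbert_space \<Rightarrow> 'g" and C D :: "'g \<Rightarrow> 'g" and \<Sigma>
    and A :: "('h::chilbert_space \<times> 'h) set" and \<gamma> :: "'g \<Rightarrow> 'h" and z0 :: complex
  assumes Q: "Q \<in> \<N>\<^sub>0" and rep: "integral_representation Q C D \<Sigma>"
    and mr: "minimal_realisation Q A \<gamma> z0"
begin

lemma sa: "self_adjoint_rel A" and \<gamma>: "bounded_clinear \<gamma>" and z0: "Im z0 > 0"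
  using mr by (auto simp: minimal_realisation_def)

lemma cinner_cadjoint_\<gamma>: "cinner (cadjoint \<gamma> y) f = cinner y (\<gamma> f)"
  using cadjoint_works[OF \<gamma>, of f y] by (metis cinner_commute)

lemma realisation_value:
  assumes z: "Im z \<noteq> 0"
  shows "Q z f = cadjoint (Q z0) f
    + (z - cnj z0) *\<^sub>C cadjoint \<gamma> (\<gamma> f + (z - z0) *\<^sub>C resolvent A z (\<gamma> f))"
proof -
  have zR: "z \<notin> \<real>" using z by (simp add: complex_is_Real_iff)
  have "z \<in> hol_domain Q \<inter> resolvent_set A"
    using nevanlinna_nonreal_hol_domain[OF Q rep z] nonreal_resolvent_set[OF sa z] by simp
  then have "op_graph (hol_value Q z) = generalised_value Q A \<gamma> z0 z"
    using mr by (simp add: minimal_realisation_def)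
  moreover have "(f, Q z f) \<in> op_graph (hol_value Q z)" using zR by (simp add: op_graph_def hol_value_def)
  ultimately have "(f, Q z f) \<in> generalised_value Q A \<gamma> z0 z" by simp
  then show ?thesis unfolding generalised_value_iff resolvent_iff[OF sa z] by blast
qed

text \<open>The kernel of \<open>Q\<close> on the diagonal is \<open>\<Gamma>(z)\<close> composed
  with its adjoint, where \<open>\<Gamma>(z) = (I + (z - z0) (A - z)\<inverse>) \<gamma>\<close>.
  The computation needs only \<open>Im (u, g) = s (norm u)^2\<close> and the imaginary part of
  \<open>L\<close>.\<close>

lemma realisation_Im:
  fixes f w s
  defines "z \<equiv> Complex w s"
  assumes s: "s > 0"
  shows "Im (cinner (Q z f) f) = s * (norm (\<gamma> f + (z - z0) *\<^sub>C resolvent A z (\<gamma> f)))\<^sup>2"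
proof -
  define g where "g = \<gamma> f"
  define u where "u = resolvent A z g"
  define a where "a = cinner u g"
  define G where "G = (norm g)\<^sup>2"
  define n where "n = (norm u)\<^sup>2"
  define L where "L = cinner (cadjoint (Q z0) f) f"
  have z: "Im z \<noteq> 0" "Im z = s" "Re z = w" using s by (auto simp: z_def)
  have Ima: "Im a = s * n"
    using sa_Im_cinner[OF sa resolvent_mem[OF sa z(1)], of g] by (simp add: a_def u_def n_def z)
  have val: "cinner (Q \<zeta> f) f
      = L + (\<zeta> - cnj z0) * (G + (\<zeta> - z0) * cinner (resolvent A \<zeta> g) g)" if "Im \<zeta> \<noteq> 0" for \<zeta>
    unfolding realisation_value[OF that]
    by (simp add: L_def cinner_simps cinner_cadjoint_\<gamma> g_def[symmetric] G_def cinner_self)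
  have "L = cnj (cinner (Q z0 f) f)"
    using cadjoint_works[OF rep_bounded_clinear[OF rep, of z0], of f f] z0 cinner_commute
    by (metis L_def less_irrefl)
  then have "Im L = - Im (cinner (Q z0 f) f)" by simp
  \<comment> \<open>At \<open>z0\<close> the realisation reduces to \<open>L\<close> plus
    \<open>2 \<i> Im z0\<close> times \<open>G\<close>, while \<open>L\<close> is the conjugate of
    that value.\<close>
  then have ImL: "Im L = - (Im z0 * G)" using val[of z0] z0 by simp
  have "Im (cinner (Q z f) f) = Im (L + (z - cnj z0) * (G + (z - z0) * a))"
    using val[OF z(1)] by (simp add: a_def u_def)
  also have "\<dots> = s * (G + 2 * Re ((z - z0) * a) + (cmod (z - z0))\<^sup>2 * n)"
    by (simp add: ImL Ima z cmod_power2) (simp add: algebra_simps power2_eq_square)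
  also have "G + 2 * Re ((z - z0) * a) + (cmod (z - z0))\<^sup>2 * n = (norm (g + (z - z0) *\<^sub>C u))\<^sup>2"
  proof -
    have "(norm (g + v))\<^sup>2 = (norm g)\<^sup>2 + 2 * inner v g + (norm v)\<^sup>2" for v
      by (simp add: power2_norm_eq_inner inner_simps inner_commute)
    then show ?thesis
      by (simp only: G_def n_def a_def inner_eq_Re_cinner cinner_scaleC_left norm_scaleC power_mult_distrib)
  qed
  finally show ?thesis by (simp add: g_def u_def)
qed

lemma realisation_norm:
  fixes f w s
  defines "z \<equiv> Complex w s"
  assumes s: "s > 0"
  shows "(norm (\<gamma> f + (z - z0) *\<^sub>C resolvent A z (\<gamma> f)))\<^sup>2
    = Re (cinner (D f) f) + (\<integral>t. 1 / ((t - w)\<^sup>2 + s\<^sup>2) \<partial>scalar_measure \<Sigma> f)"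
proof -
  have "s * (norm (\<gamma> f + (z - z0) *\<^sub>C resolvent A z (\<gamma> f)))\<^sup>2
    = s * (Re (cinner (D f) f) + (\<integral>t. 1 / ((t - w)\<^sup>2 + s\<^sup>2) \<partial>scalar_measure \<Sigma> f))"
    using rep_Im[OF rep, of s w f] nevanlinna_constant_symmetric[OF Q rep, of f]
      realisation_Im[OF s, of w f] s unfolding z_def by simp
  then show ?thesis using s by simp
qed

lemma value_domain_iff_range:
  "f \<in> value_domain \<Sigma> w \<longleftrightarrow> (\<exists>k. (k, \<gamma> f + of_real w *\<^sub>C k) \<in> A)"
proof
  assume "f \<in> value_domain \<Sigma> w"
  then obtain K where K: "\<And>s. s \<noteq> 0 \<Longrightarrow> (\<integral>t. 1 / ((t - w)\<^sup>2 + s\<^sup>2) \<partial>scalar_measure \<Sigma> f) \<le> K"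
    using Poisson_integral_bounded[OF rep] by blast
  define b where "b = sqrt (Re (cinner (D f) f) + K)"
  have "norm (resolvent A (Complex w s) (\<gamma> f)) \<le> 2 * (b + norm (\<gamma> f)) / Im z0" if s: "s > 0" for s
  proof -
    let ?z = "Complex w s"
    let ?u = "resolvent A ?z (\<gamma> f)"
    have b: "norm (\<gamma> f + (?z - z0) *\<^sub>C ?u) \<le> b"
      unfolding b_def using K[of s] s by (intro real_le_rsqrt) (simp add: realisation_norm)
    then have b0: "0 \<le> b" using norm_ge_zero order_trans by blast
    have "(Im z0 / 2) * norm ?u \<le> b + norm (\<gamma> f)"
    \<comment> \<open>\<open>?z\<close> may coincide with \<open>z0\<close>, where the norm identity
      says nothing about \<open>?u\<close>. For large \<open>s\<close> the general resolvent bound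
      takes over; for small \<open>s\<close> the distance to \<open>z0\<close> is at least
      \<open>Im z0 / 2\<close>.\<close>
    proof (cases "s \<ge> Im z0 / 2")
      case True
      then have "(Im z0 / 2) * norm ?u \<le> \<bar>Im ?z\<bar> * norm ?u" by (intro mult_right_mono) auto
      also have "\<dots> \<le> norm (\<gamma> f)" using s by (intro norm_resolvent_le[OF sa]) simp
      finally show ?thesis using b0 by simp
    next
      case False
      then have "Im z0 / 2 \<le> cmod (?z - z0)" using abs_Im_le_cmod[of "?z - z0"] by simp
      then have "(Im z0 / 2) * norm ?u \<le> norm ((?z - z0) *\<^sub>C ?u)"
        unfolding norm_scaleC by (rule mult_right_mono) simp
      also have "\<dots> \<le> norm (\<gamma> f + (?z - z0) *\<^sub>C ?u) + norm (\<gamma> f)"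
        using norm_triangle_ineq4[of "\<gamma> f + (?z - z0) *\<^sub>C ?u" "\<gamma> f"] by simp
      finally show ?thesis using b by simp
    qed
    then show ?thesis using z0 by (simp add: field_simps)
  qed
  then obtain k where "(k, \<gamma> f + of_real w *\<^sub>C k) \<in> A"
    using range_if_bounded_resolvent[OF sa, of w "\<gamma> f" "2 * (b + norm (\<gamma> f)) / Im z0"] by auto
  then show "\<exists>k. (k, \<gamma> f + of_real w *\<^sub>C k) \<in> A" by blast
next
  assume "\<exists>k. (k, \<gamma> f + of_real w *\<^sub>C k) \<in> A"
  then obtain k where k: "(k, \<gamma> f + of_real w *\<^sub>C k) \<in> A" by blast
  \<comment> \<open>\<open>\<bar>w\<bar> + 1\<close> bounds \<open>?z\<close> because
    \<open>s \<le> 1\<close>, and \<open>2 * norm k\<close> bounds the resolvent through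
    \<open>resolvent_on_range\<close>.\<close>
  define b where "b = norm (\<gamma> f) + (\<bar>w\<bar> + 1 + cmod z0) * (2 * norm k)"
  show "f \<in> value_domain \<Sigma> w"
  proof (rule value_domain_if_bounded[OF rep])
    fix n
    define s where "s = 1 / real (Suc n)"
    have s: "s > 0" "s \<le> 1" by (auto simp: s_def)
    let ?z = "Complex w s"
    let ?u = "resolvent A ?z (\<gamma> f)"
    have z: "Im ?z \<noteq> 0" using s by simp
    have diff: "of_real w - ?z = - (\<i> * of_real s)" by (simp add: complex_eq_iff)
    have "norm ((of_real w - ?z) *\<^sub>C resolvent A ?z k) = \<bar>Im ?z\<bar> * norm (resolvent A ?z k)"
      by (simp add: diff norm_mult)
    also have "\<dots> \<le> norm k" by (rule norm_resolvent_le[OF sa z])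
    finally have "norm ?u \<le> 2 * norm k"
      unfolding resolvent_on_range[OF sa z k]
      using norm_triangle_ineq4[of k "(of_real w - ?z) *\<^sub>C resolvent A ?z k"] by linarith
    moreover have "cmod (?z - z0) \<le> \<bar>w\<bar> + 1 + cmod z0"
      using norm_triangle_ineq4[of ?z z0] cmod_le[of ?z] s by simp
    ultimately have "cmod (?z - z0) * norm ?u \<le> (\<bar>w\<bar> + 1 + cmod z0) * (2 * norm k)"
      by (intro mult_mono) auto
    then have "norm (\<gamma> f + (?z - z0) *\<^sub>C ?u) \<le> b"
      using norm_triangle_ineq[of "\<gamma> f" "(?z - z0) *\<^sub>C ?u"] by (simp add: b_def)
    then have "(norm (\<gamma> f + (?z - z0) *\<^sub>C ?u))\<^sup>2 \<le> b\<^sup>2" by (intro power_mono) auto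
    moreover have "0 \<le> Re (cinner (D f) f)"
      using rep positive_op_nonneg[of D f] by (simp add: integral_representation_def inner_eq_Re_cinner)
    ultimately show "(\<integral>t. 1 / ((t - w)\<^sup>2 + (1 / real (Suc n))\<^sup>2) \<partial>scalar_measure \<Sigma> f) \<le> b\<^sup>2"
      using realisation_norm[OF s(1), of f w] unfolding s_def by simp
  qed
qed

text \<open>The element of the generalised value that belongs to the preimage \<open>k\<close> of
  \<open>\<gamma> f\<close>. It is linear in the pair \<open>(f, k)\<close>, so a splitting of
  \<open>k\<close> splits the value.\<close>

definition value_at :: "real \<Rightarrow> 'g \<Rightarrow> 'h \<Rightarrow> 'g" where
  "value_at w f k = cadjoint (Q z0) f
    + (of_real w - cnj z0) *\<^sub>C cadjoint \<gamma> (\<gamma> f + (of_real w - z0) *\<^sub>C k)"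

lemma value_nontangential_limit:
  assumes k: "(k, \<gamma> f + of_real w *\<^sub>C k) \<in> A"
  shows "has_nontangential_limit (\<lambda>z. Q z f) w (value_at w f (k - eigenprojection A w k))"
  unfolding has_nontangential_limit_def
proof
  fix \<theta> :: real assume \<theta>: "\<theta> \<in> {0<..<pi / 2}"
  let ?F = "at (complex_of_real w) within stolz_sector w \<theta>"
  have F: "filterlim (\<lambda>x. x) (nhds (complex_of_real w)) ?F" by (rule tendsto_ident_at)
  have ev: "\<forall>\<^sub>F l in ?F. Im l \<noteq> 0 \<and> cmod (of_real w - l) \<le> (1 / sin \<theta>) * \<bar>Im l\<bar>"
    unfolding eventually_at_filter by (rule always_eventually) (use stolz_sector_bound[OF \<theta>] in blast)
  have R: "((\<lambda>l. resolvent A l (\<gamma> f)) \<longlongrightarrow> k - eigenprojection A w k) ?F"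
    by (rule resolvent_on_range_tendsto[OF sa F ev k])
  have "((\<lambda>l. cadjoint (Q z0) f + (l - cnj z0) *\<^sub>C cadjoint \<gamma> (\<gamma> f + (l - z0) *\<^sub>C resolvent A l (\<gamma> f)))
      \<longlongrightarrow> value_at w f (k - eigenprojection A w k)) ?F"
    unfolding value_at_def
    by (intro tendsto_add tendsto_scaleC tendsto_diff tendsto_const F R
        bounded_clinear_tendsto[OF cadjoint_bounded_clinear[OF \<gamma>]])
  moreover from ev have "\<forall>\<^sub>F l in ?F. cadjoint (Q z0) f
      + (l - cnj z0) *\<^sub>C cadjoint \<gamma> (\<gamma> f + (l - z0) *\<^sub>C resolvent A l (\<gamma> f)) = Q l f"
    by eventually_elim (simp add: realisation_value)
  ultimately show "((\<lambda>z. Q z f) \<longlongrightarrow> value_at w f (k - eigenprojection A w k)) ?F"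
    by (rule Lim_transform_eventually)
qed

lemma norm_sqrt_atom:
  "norm (op_sqrt (\<Sigma> {w}) f) = cmod (of_real w - z0) * norm (eigenprojection A w (\<gamma> f))"
proof -
  define z where "z n = Complex w (1 / real (Suc n))" for n
  \<comment> \<open>Recasts the vertical sequence as a filter on the spectral parameter; along it
    \<open>\<bar>w - l\<bar> = \<bar>Im l\<bar>\<close>, so the angle constant is 1.\<close>
  let ?F = "filtermap z sequentially"
  have "(\<lambda>n. complex_of_real w + \<i> * complex_of_real (1 / real (Suc n)))
      \<longlonglongrightarrow> complex_of_real w + \<i> * complex_of_real 0"
    by (intro tendsto_intros LIMSEQ_inverse_real_of_nat[unfolded inverse_eq_divide])
  moreover have "z = (\<lambda>n. complex_of_real w + \<i> * complex_of_real (1 / real (Suc n)))"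
    by (simp add: fun_eq_iff z_def Complex_eq)
  ultimately have zlim: "z \<longlonglongrightarrow> of_real w" by simp
  then have F: "filterlim (\<lambda>x. x) (nhds (complex_of_real w)) ?F" by (simp add: filterlim_filtermap)
  have wz: "of_real w - z n = - (\<i> * of_real (1 / real (Suc n)))" for n
    by (simp add: z_def complex_eq_iff)
  then have cmod_wz: "cmod (of_real w - z n) = 1 / real (Suc n)" for n
    by (simp only: norm_minus_cancel norm_mult norm_ii norm_of_real mult_1_left) simp
  have "\<forall>\<^sub>F l in ?F. Im l \<noteq> 0 \<and> cmod (of_real w - l) \<le> 1 * \<bar>Im l\<bar>"
    unfolding eventually_filtermap cmod_wz by (simp add: z_def)
  from resolvent_tendsto_eigenprojection[OF sa F this, of "\<gamma> f"]
  have R: "(\<lambda>n. (of_real w - z n) *\<^sub>C resolvent A (z n) (\<gamma> f)) \<longlonglongrightarrow> eigenprojection A w (\<gamma> f)"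
    by (simp add: filterlim_filtermap)
  define v where "v n = \<gamma> f + (z n - z0) *\<^sub>C resolvent A (z n) (\<gamma> f)" for n
  \<comment> \<open>The factor \<open>w - z n\<close>, of modulus \<open>1 / (n + 1)\<close>, is
    moved inside the norm: it kills \<open>\<gamma> f\<close> and turns the resolvent into the
    scaled one whose limit is known.\<close>
  have "(\<lambda>n. (norm ((of_real w - z n) *\<^sub>C \<gamma> f
        + (z n - z0) *\<^sub>C ((of_real w - z n) *\<^sub>C resolvent A (z n) (\<gamma> f))))\<^sup>2)
      \<longlonglongrightarrow> (norm ((of_real w - of_real w) *\<^sub>C \<gamma> f
        + (of_real w - z0) *\<^sub>C eigenprojection A w (\<gamma> f)))\<^sup>2"
    by (intro tendsto_power tendsto_norm tendsto_add tendsto_scaleC tendsto_diff tendsto_const zlim R)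
  moreover have "(of_real w - z n) *\<^sub>C \<gamma> f
        + (z n - z0) *\<^sub>C ((of_real w - z n) *\<^sub>C resolvent A (z n) (\<gamma> f)) = (of_real w - z n) *\<^sub>C v n" for n
    by (simp add: v_def scaleC_add_right scaleC_scaleC mult.commute)
  ultimately have 1: "(\<lambda>n. (1 / real (Suc n))\<^sup>2 * (norm (v n))\<^sup>2)
      \<longlonglongrightarrow> (cmod (of_real w - z0) * norm (eigenprojection A w (\<gamma> f)))\<^sup>2"
    by (simp only: norm_scaleC cmod_wz power_mult_distrib diff_self
        complex_vector.scale_zero_left add_0_left)
  have v: "(norm (v n))\<^sup>2 = Re (cinner (D f) f)
      + (\<integral>t. 1 / ((t - w)\<^sup>2 + (1 / real (Suc n))\<^sup>2) \<partial>scalar_measure \<Sigma> f)" for n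
    unfolding v_def z_def by (rule realisation_norm) simp
  have inv: "(\<lambda>n. 1 / real (Suc n)) \<longlonglongrightarrow> 0"
    using LIMSEQ_inverse_real_of_nat by (simp only: inverse_eq_divide)
  have "(\<lambda>n. (1 / real (Suc n))\<^sup>2 * Re (cinner (D f) f) + (1 / real (Suc n))\<^sup>2 *
        (\<integral>t. 1 / ((t - w)\<^sup>2 + (1 / real (Suc n))\<^sup>2) \<partial>scalar_measure \<Sigma> f))
      \<longlonglongrightarrow> 0\<^sup>2 * Re (cinner (D f) f) + Re (cinner (\<Sigma> {w} f) f)"
    by (intro tendsto_add tendsto_mult tendsto_power inv tendsto_const Poisson_integral_atom[OF rep])
  then have "(\<lambda>n. (1 / real (Suc n))\<^sup>2 * (norm (v n))\<^sup>2) \<longlonglongrightarrow> Re (cinner (\<Sigma> {w} f) f)"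
    unfolding v distrib_left by simp
  from LIMSEQ_unique[OF this 1]
  have "(norm (op_sqrt (\<Sigma> {w}) f))\<^sup>2 = (cmod (of_real w - z0) * norm (eigenprojection A w (\<gamma> f)))\<^sup>2"
    using norm_op_sqrt[OF op_measure_positive[OF rep_measure[OF rep], of "{w}"], of f] by simp
  then show ?thesis by (simp add: power2_eq_iff_nonneg)
qed

lemma sqrt_atom_positive: "positive_op (op_sqrt (\<Sigma> {w}))"
  by (rule op_sqrt_positive[OF op_measure_positive[OF rep_measure[OF rep]]]) auto

text \<open>Both inclusions are instances of Douglas' lemma, since \<open>\<Sigma>({w})\<^sup>1\<^sup>/\<^sup>2\<close> and \<open>P \<gamma>\<close>
  (\<open>P\<close> the projection onto the eigenspace) have proportional norms by \<open>norm_sqrt_atom\<close>.\<close>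

lemma range_sqrt_atom:
  "range (op_sqrt (\<Sigma> {w})) = cadjoint \<gamma> ` {k. (k, of_real w *\<^sub>C k) \<in> A}"
proof -
  let ?S = "op_sqrt (\<Sigma> {w})" and ?P = "eigenprojection A w"
  note S = sqrt_atom_positive[of w]
  note SL = positive_op_clinear[OF S] and PL = bounded_clinear_eigenprojection[OF sa, of w]
  have wz: "cmod (of_real w - z0) > 0" using z0 by (auto simp: complex_eq_iff)
  have lin_right: "linear (\<lambda>f. cinner f y)" "cinner (c *\<^sub>C x) y = c * cinner x y" for x y :: 'g and c
    by (auto intro!: linearI simp: cinner_simps scaleR_scaleC scaleC_complex_def)
  have eqI: "x = y" if "\<And>f. cinner f x = cinner f y" for x y :: 'g
    by (rule cinner_eqI) (metis that cinner_commute)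
  have adj: "cinner f (cadjoint \<gamma> k) = cinner (\<gamma> f) k" for f k
    by (rule cadjoint_works[OF \<gamma>, symmetric])
  have "cadjoint \<gamma> k \<in> range ?S" if k: "(k, of_real w *\<^sub>C k) \<in> A" for k
  proof -
    have "cmod (cinner f (cadjoint \<gamma> k)) \<le> norm k / cmod (of_real w - z0) * norm (?S f)" for f
    proof -
      have "cinner f (cadjoint \<gamma> k) = cinner (?P (\<gamma> f)) k"
        unfolding adj by (rule cinner_eigenprojection[OF sa k, symmetric])
      then have "cmod (cinner f (cadjoint \<gamma> k)) \<le> norm (?P (\<gamma> f)) * norm k"
        by (simp add: norm_cinner_le)
      then show ?thesis unfolding norm_sqrt_atom using wz by (simp add: mult.commute)
    qed
    then obtain s where s: "\<And>f. cinner (?S f) s = cinner f (cadjoint \<gamma> k)"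
      using cinner_representation[OF bounded_clinear_linear[OF SL] bounded_clinear_scaleC[OF SL]
          lin_right(1) lin_right(2) complex_vector.subspace_UNIV] by (metis UNIV_I)
    have "?S s = cadjoint \<gamma> k"
      by (rule eqI) (simp add: s[symmetric] positive_op_hermitian[OF S])
    then show ?thesis by (metis rangeI)
  qed
  moreover have "?S g \<in> cadjoint \<gamma> ` {k. (k, of_real w *\<^sub>C k) \<in> A}" for g
  proof -
    define B where "B f = ?P (\<gamma> f)" for f
    have B: "linear B" "\<And>c f. B (c *\<^sub>C f) = c *\<^sub>C B f"
      by (auto intro!: linearI simp: B_def bounded_clinear_add[OF PL] bounded_clinear_add[OF \<gamma>]
          bounded_clinear_scaleC[OF PL] bounded_clinear_scaleC[OF \<gamma>] scaleR_scaleC)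
    have "cmod (cinner f (?S g)) \<le> norm g * cmod (of_real w - z0) * norm (B f)" for f
    proof -
      have "cmod (cinner f (?S g)) \<le> norm (?S f) * norm g"
        unfolding positive_op_hermitian[OF S, symmetric] by (rule norm_cinner_le)
      then show ?thesis unfolding norm_sqrt_atom B_def by (simp add: mult_ac)
    qed
    then obtain k where k: "k \<in> closure (range B)" "\<And>f. cinner (B f) k = cinner f (?S g)"
      using cinner_representation[OF B lin_right(1) lin_right(2) complex_vector.subspace_UNIV]
      by (metis UNIV_I)
    \<comment> \<open>The representing vector lies only in the closure of the range of
      \<open>B\<close>; closedness of \<open>A\<close> keeps it in the eigenspace.\<close>
    obtain r where r: "\<And>n. r n \<in> range B" "r \<longlonglongrightarrow> k"
      using k(1) unfolding closure_sequential by auto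
    have "(r n, of_real w *\<^sub>C r n) \<in> A" for n
      using r(1)[of n] eigenprojection_mem[OF sa] by (auto simp: B_def)
    then have kA: "(k, of_real w *\<^sub>C k) \<in> A"
      by (intro sa_closed[OF sa sequentially_bot r(2) tendsto_scaleC[OF tendsto_const r(2)]]) simp
    have "?S g = cadjoint \<gamma> k"
    proof (rule eqI)
      fix f
      show "cinner f (?S g) = cinner f (cadjoint \<gamma> k)"
        unfolding adj k(2)[symmetric] B_def by (rule cinner_eigenprojection[OF sa kA])
    qed
    with kA show ?thesis by blast
  qed
  ultimately show ?thesis by blast
qed

section \<open>Splitting the generalised value\<close>

lemma eigenprojection_eigenvector:
  "(k, complex_of_real w *\<^sub>C k) \<in> A \<Longrightarrow> eigenprojection A w k = k"
  by (rule eigenprojection_unique[OF sa]) simp_all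

lemma eigenprojection_residual: "eigenprojection A w (k - eigenprojection A w k) = 0"
  by (simp add: bounded_clinear_diff[OF bounded_clinear_eigenprojection[OF sa]]
      eigenprojection_eigenvector[OF eigenprojection_mem[OF sa]])

lemma range_residual:
  assumes k: "(k, \<gamma> f + of_real w *\<^sub>C k) \<in> A"
  shows "(k - eigenprojection A w k, \<gamma> f + of_real w *\<^sub>C (k - eigenprojection A w k)) \<in> A"
  using sa_diff[OF sa k eigenprojection_mem[OF sa, of w k]]
  by (simp add: complex_vector.scale_right_diff_distrib add_diff_eq)

text \<open>The nontangential limit selects the preimage orthogonal to the eigenspace. This replaces
  limits by a linear condition on \<open>k\<close>, from which the subspace property
  follows.\<close>

lemma op_part_iff:
  "(f, l) \<in> op_part Q \<Sigma> w \<longleftrightarrow>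
    (\<exists>k. (k, \<gamma> f + of_real w *\<^sub>C k) \<in> A \<and> eigenprojection A w k = 0 \<and> l = value_at w f k)"
proof
  assume "(f, l) \<in> op_part Q \<Sigma> w"
  then have f: "f \<in> value_domain \<Sigma> w" and l: "has_nontangential_limit (\<lambda>z. Q z f) w l"
    by (auto simp: op_part_def)
  obtain k where k: "(k, \<gamma> f + of_real w *\<^sub>C k) \<in> A" using f value_domain_iff_range by blast
  have "l = value_at w f (k - eigenprojection A w k)"
    by (rule has_nontangential_limit_unique[OF l value_nontangential_limit[OF k]])
  then show "\<exists>k. (k, \<gamma> f + of_real w *\<^sub>C k) \<in> A \<and> eigenprojection A w k = 0 \<and> l = value_at w f k"
    using range_residual[OF k] eigenprojection_residual by blast
next
  assume "\<exists>k. (k, \<gamma> f + of_real w *\<^sub>C k) \<in> A \<and> eigenprojection A w k = 0 \<and> l = value_at w f k"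
  then obtain k where k: "(k, \<gamma> f + of_real w *\<^sub>C k) \<in> A"
      and k0: "eigenprojection A w k = 0" and l: "l = value_at w f k" by blast
  have "has_nontangential_limit (\<lambda>z. Q z f) w l"
    using value_nontangential_limit[OF k] by (simp add: k0 l)
  moreover have "f \<in> value_domain \<Sigma> w" using k value_domain_iff_range by blast
  ultimately show "(f, l) \<in> op_part Q \<Sigma> w" by (simp add: op_part_def)
qed

lemma generalised_value_at_iff:
  "(f, y) \<in> generalised_value Q A \<gamma> z0 (of_real w) \<longleftrightarrow>
    (\<exists>k. (k, \<gamma> f + of_real w *\<^sub>C k) \<in> A \<and> y = value_at w f k)"
  unfolding generalised_value_iff value_at_def ..

lemma cadjoint_Q_clinear: "bounded_clinear (cadjoint (Q z0))"
  using z0 by (intro cadjoint_bounded_clinear rep_bounded_clinear[OF rep]) simp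

lemma value_at_add: "value_at w (f + f') (k + k') = value_at w f k + value_at w f' k'"
proof -
  have "\<gamma> (f + f') + (of_real w - z0) *\<^sub>C (k + k')
      = (\<gamma> f + (of_real w - z0) *\<^sub>C k) + (\<gamma> f' + (of_real w - z0) *\<^sub>C k')"
    by (simp only: bounded_clinear_add[OF \<gamma>] scaleC_add_right) (simp only: ac_simps)
  then show ?thesis
    unfolding value_at_def
    by (simp only: bounded_clinear_add[OF cadjoint_Q_clinear] scaleC_add_right
        bounded_clinear_add[OF cadjoint_bounded_clinear[OF \<gamma>]]) (simp only: ac_simps)
qed

lemma value_at_scaleC: "value_at w (c *\<^sub>C f) (c *\<^sub>C k) = c *\<^sub>C value_at w f k"
proof -
  have "\<gamma> (c *\<^sub>C f) + (of_real w - z0) *\<^sub>C (c *\<^sub>C k) = c *\<^sub>C (\<gamma> f + (of_real w - z0) *\<^sub>C k)"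
    by (simp add: bounded_clinear_scaleC[OF \<gamma>] scaleC_add_right scaleC_scaleC mult.commute)
  then show ?thesis
    unfolding value_at_def
    by (simp only: bounded_clinear_scaleC[OF cadjoint_bounded_clinear[OF \<gamma>]])
      (simp add: bounded_clinear_scaleC[OF cadjoint_Q_clinear] scaleC_add_right scaleC_scaleC
        mult.commute)
qed

text \<open>For \<open>f = 0\<close> the admissible \<open>k\<close> are the eigenvectors, so this
  describes the multivalued part; the scalar is the square of the distance from \<open>w\<close> to
  \<open>z0\<close>.\<close>

lemma value_at_0: "value_at w 0 k = ((of_real w - cnj z0) * (of_real w - z0)) *\<^sub>C cadjoint \<gamma> k"
  by (simp add: value_at_def bounded_clinear_0[OF cadjoint_Q_clinear] bounded_clinear_0[OF \<gamma>]
      bounded_clinear_scaleC[OF cadjoint_bounded_clinear[OF \<gamma>]] scaleC_scaleC)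

lemma csubspace_op_part: "csubspace (op_part Q \<Sigma> w)"
  unfolding complex_vector.subspace_def
proof (intro conjI ballI allI)
  note PL = bounded_clinear_eigenprojection[OF sa, of w]
  show "0 \<in> op_part Q \<Sigma> w"
    unfolding zero_prod_def op_part_iff
    by (intro exI[of _ 0]) (simp add: value_at_0 bounded_clinear_0[OF \<gamma>] bounded_clinear_0[OF PL]
        sa_zero[OF sa] bounded_clinear_0[OF cadjoint_bounded_clinear[OF \<gamma>]])
  show "x + y \<in> op_part Q \<Sigma> w" if "x \<in> op_part Q \<Sigma> w" "y \<in> op_part Q \<Sigma> w" for x y
  proof -
    obtain f l f' l' where x: "x = (f, l)" and y: "y = (f', l')" by (metis surj_pair)
    obtain k k' where k: "(k, \<gamma> f + of_real w *\<^sub>C k) \<in> A" "eigenprojection A w k = 0" "l = value_at w f k"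
      and k': "(k', \<gamma> f' + of_real w *\<^sub>C k') \<in> A" "eigenprojection A w k' = 0" "l' = value_at w f' k'"
      using \<open>x \<in> op_part Q \<Sigma> w\<close> \<open>y \<in> op_part Q \<Sigma> w\<close> unfolding x y op_part_iff by blast
    have "\<gamma> (f + f') + of_real w *\<^sub>C (k + k') = (\<gamma> f + of_real w *\<^sub>C k) + (\<gamma> f' + of_real w *\<^sub>C k')"
      by (simp only: bounded_clinear_add[OF \<gamma>] scaleC_add_right) (simp only: ac_simps)
    then have "(k + k', \<gamma> (f + f') + of_real w *\<^sub>C (k + k')) \<in> A"
      using sa_add[OF sa k(1) k'(1)] by simp
    then have "(f + f', l + l') \<in> op_part Q \<Sigma> w"
      unfolding op_part_iff using k k'
      by (intro exI[of _ "k + k'"]) (simp add: value_at_add bounded_clinear_add[OF PL])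
    then show ?thesis by (simp add: x y)
  qed
  show "c *\<^sub>C x \<in> op_part Q \<Sigma> w" if "x \<in> op_part Q \<Sigma> w" for c x
  proof -
    obtain f l where x: "x = (f, l)" by (metis surj_pair)
    obtain k where k: "(k, \<gamma> f + of_real w *\<^sub>C k) \<in> A" "eigenprojection A w k = 0" "l = value_at w f k"
      using \<open>x \<in> op_part Q \<Sigma> w\<close> unfolding x op_part_iff by blast
    have "\<gamma> (c *\<^sub>C f) + of_real w *\<^sub>C (c *\<^sub>C k) = c *\<^sub>C (\<gamma> f + of_real w *\<^sub>C k)"
      by (simp add: bounded_clinear_scaleC[OF \<gamma>] scaleC_add_right scaleC_scaleC mult.commute)
    then have "(c *\<^sub>C k, \<gamma> (c *\<^sub>C f) + of_real w *\<^sub>C (c *\<^sub>C k)) \<in> A"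
      using sa_scale[OF sa k(1), of c] by simp
    then have "(c *\<^sub>C f, c *\<^sub>C l) \<in> op_part Q \<Sigma> w"
      unfolding op_part_iff using k
      by (intro exI[of _ "c *\<^sub>C k"]) (simp add: value_at_scaleC bounded_clinear_scaleC[OF PL])
    then show ?thesis by (simp add: x scaleC_prod_def)
  qed
qed

text \<open>Split \<open>k\<close> into \<open>k - P k\<close> and \<open>P k\<close>, where
  \<open>P\<close> is the eigenprojection: the first part carries \<open>f\<close> and gives the
  operator part, the second gives a multivalued element.\<close>

lemma generalised_value_direct_sum:
  "is_direct_sum (generalised_value Q A \<gamma> z0 (of_real w))
    (op_part Q \<Sigma> w) ({0::'g} \<times> range (op_sqrt (\<Sigma> {w})))"
  unfolding is_direct_sum_def
proof (intro conjI csubspace_op_part)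
  let ?S = "op_sqrt (\<Sigma> {w})" and ?P = "eigenprojection A w"
  note SL = positive_op_clinear[OF sqrt_atom_positive[of w]]
  have c0: "(of_real w - cnj z0) * (of_real w - z0) \<noteq> 0"
    using z0 by (auto simp: complex_eq_iff)
  have scaleS: "c *\<^sub>C y \<in> range ?S" if "y \<in> range ?S" for c y
    using that bounded_clinear_scaleC[OF SL, of c, symmetric] by auto
  show "csubspace ({0::'g} \<times> range ?S)"
    unfolding complex_vector.subspace_def
  proof (intro conjI ballI allI)
    show "0 \<in> {0::'g} \<times> range ?S"
      using bounded_clinear_0[OF SL] by (metis SigmaI insertI1 rangeI zero_prod_def)
    show "x + y \<in> {0::'g} \<times> range ?S" if "x \<in> {0::'g} \<times> range ?S" "y \<in> {0::'g} \<times> range ?S" for x y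
      using that by (auto simp: bounded_clinear_add[OF SL, symmetric])
    show "c *\<^sub>C x \<in> {0::'g} \<times> range ?S" if "x \<in> {0::'g} \<times> range ?S" for c x
      using that scaleS by (auto simp: scaleC_prod_def)
  qed
  show "op_part Q \<Sigma> w \<inter> ({0::'g} \<times> range ?S) = {0}"
  proof
    show "{0} \<subseteq> op_part Q \<Sigma> w \<inter> ({0::'g} \<times> range ?S)"
      using complex_vector.subspace_0[OF csubspace_op_part[of w]]
        complex_vector.subspace_0[OF \<open>csubspace ({0::'g} \<times> range ?S)\<close>] by simp
    show "op_part Q \<Sigma> w \<inter> ({0::'g} \<times> range ?S) \<subseteq> {0}"
    proof
      fix x assume x: "x \<in> op_part Q \<Sigma> w \<inter> ({0::'g} \<times> range ?S)"
      then obtain l where x_eq: "x = (0, l)" by auto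
      with x obtain k where k: "(k, \<gamma> 0 + of_real w *\<^sub>C k) \<in> A" "?P k = 0" "l = value_at w 0 k"
        using op_part_iff[of 0 l w] by auto
      \<comment> \<open>For \<open>f = 0\<close> the vector \<open>k\<close> is itself an
        eigenvector, hence equal to its projection, which vanishes.\<close>
      then have "k = 0" using eigenprojection_eigenvector[of k w] by (simp add: bounded_clinear_0[OF \<gamma>])
      then have "l = 0"
        using k(3) by (simp add: value_at_0 bounded_clinear_0[OF cadjoint_bounded_clinear[OF \<gamma>]])
      then show "x \<in> {0}" by (simp add: x_eq zero_prod_def)
    qed
  qed
  show "generalised_value Q A \<gamma> z0 (of_real w)
    = {s + t | s t. s \<in> op_part Q \<Sigma> w \<and> t \<in> {0::'g} \<times> range ?S}"
  proof (intro Set.set_eqI iffI)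
    fix x assume x: "x \<in> generalised_value Q A \<gamma> z0 (of_real w)"
    obtain f y where x_eq: "x = (f, y)" by (metis surj_pair)
    obtain k where k: "(k, \<gamma> f + of_real w *\<^sub>C k) \<in> A" "y = value_at w f k"
      using x unfolding x_eq generalised_value_at_iff by blast
    have 1: "(f, value_at w f (k - ?P k)) \<in> op_part Q \<Sigma> w"
      unfolding op_part_iff using range_residual[OF k(1)] eigenprojection_residual by blast
    have "cadjoint \<gamma> (?P k) \<in> range ?S"
      unfolding range_sqrt_atom using eigenprojection_mem[OF sa] by blast
    then have 2: "(0, value_at w 0 (?P k)) \<in> {0::'g} \<times> range ?S"
      unfolding value_at_0 using scaleS by blast
    have "x = (f, value_at w f (k - ?P k)) + (0, value_at w 0 (?P k))"
      using value_at_add[of w f 0 "k - ?P k" "?P k"] by (simp add: x_eq k(2))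
    with 1 2 show "x \<in> {s + t | s t. s \<in> op_part Q \<Sigma> w \<and> t \<in> {0::'g} \<times> range ?S}" by blast
  next
    fix x assume "x \<in> {s + t | s t. s \<in> op_part Q \<Sigma> w \<and> t \<in> {0::'g} \<times> range ?S}"
    then obtain f l y where fl: "(f, l) \<in> op_part Q \<Sigma> w" and y: "y \<in> range ?S"
        and x: "x = (f, l) + (0, y)" by auto
    obtain k where k: "(k, \<gamma> f + of_real w *\<^sub>C k) \<in> A" "l = value_at w f k"
      using fl unfolding op_part_iff by blast
    obtain h where h: "(h, of_real w *\<^sub>C h) \<in> A" "y = cadjoint \<gamma> h"
      using y unfolding range_sqrt_atom by blast
    \<comment> \<open>Divides out the nonzero scalar of \<open>value_at_0\<close>, so that
      \<open>y\<close> becomes a value at \<open>f = 0\<close>.\<close>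
    define h' where "h' = (1 / ((of_real w - cnj z0) * (of_real w - z0))) *\<^sub>C h"
    have h': "(h', of_real w *\<^sub>C h') \<in> A"
      using sa_scale[OF sa h(1), of "1 / ((of_real w - cnj z0) * (of_real w - z0))"]
      unfolding h'_def scaleC_scaleC by (simp only: mult.commute)
    have "y = value_at w 0 h'"
      using c0 by (simp add: value_at_0 h'_def bounded_clinear_scaleC[OF cadjoint_bounded_clinear[OF \<gamma>]]
          scaleC_scaleC scaleC_one h(2))
    then have "x = (f, value_at w f (k + h'))"
      using value_at_add[of w f 0 k h'] by (simp add: x k(2))
    moreover have "(k + h', \<gamma> f + of_real w *\<^sub>C (k + h')) \<in> A"
      using sa_add[OF sa k(1) h'] by (simp add: scaleC_add_right add.assoc)
    ultimately show "x \<in> generalised_value Q A \<gamma> z0 (of_real w)"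
      using generalised_value_at_iff by blast
  qed
qed

end

theorem theorem3p29:
  fixes Q :: "complex \<Rightarrow> 'g::chilbert_space \<Rightarrow> 'g"
    and C D :: "'g \<Rightarrow> 'g"
    and \<Sigma> :: "real set \<Rightarrow> 'g \<Rightarrow> 'g"
    and A :: "('h::chilbert_space \<times> 'h) set"
    and \<gamma> :: "'g \<Rightarrow> 'h"
    and z0 :: complex
    and \<omega> :: real
  assumes "Q \<in> \<N>\<^sub>0"
    and "integral_representation Q C D \<Sigma>"
    and "minimal_realisation Q A \<gamma> z0"
  shows "(\<forall>f \<in> value_domain \<Sigma> \<omega>. \<exists>l. has_nontangential_limit (\<lambda>z. Q z f) \<omega> l) \<and>
         is_direct_sum (generalised_value Q A \<gamma> z0 (of_real \<omega>))
           (op_part Q \<Sigma> \<omega>) ({0} \<times> range (op_sqrt (\<Sigma> {\<omega>})))"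
  using value_domain_iff_range[OF assms] value_nontangential_limit[OF assms]
    generalised_value_direct_sum[OF assms] by blast

end
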